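(* Let $\mathbb{F}$ be an algebraically closed field and let $n,d$ be positive integers and $m\ge 2$ an integer. Then $\alpha(\mathbb{F},n,d,m)\ge 2$ if and only if $d(n-2)\ge m2^{d-1}$.
   Context: $\mathrm{Hom}^d(\mathbb{F}^n,\mathbb{F}^m)$ denotes the space of $d$-linear maps $T:(\mathbb{F}^n)^d\to\mathbb{F}^m$. For $T$ in this space, $\alpha(T)$ is the largest $s$ such that there exist $s$-dimensional subspaces $\mathbb{V}_1,\dots,\mathbb{V}_d\subseteq\mathbb{F}^n$ with $T(v_1,\dots,v_d)=0$ for all $(v_1,\dots,v_d)\in\mathbb{V}_1\times\cdots\times\mathbb{V}_d$. Then $\alpha(\mathbb{F},n,d,m)=\min\{\alpha(T):T\in\mathrm{Hom}^d(\mathbb{F}^n,\mathbb{F}^m)\}$. *)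

theory Defs
  imports "HOL-Analysis.Analysis" "HOL-Computational_Algebra.Polynomial"
begin

text \<open>
  The dimensions \<open>n\<close>, \<open>d\<close>, \<open>m\<close> are the cardinalities of finite (hence nonempty) index types
  \<open>'n\<close>, \<open>'d\<close>, \<open>'m\<close>. An element of \<open>('a ^ 'n) ^ 'd\<close> is a \<open>d\<close>-tuple of vectors of \<open>F\<^sup>n\<close>.
\<close>

definition multilinear_maps :: "('a::field ^ 'n ^ 'd \<Rightarrow> 'a ^ 'm) set" where
  "multilinear_maps =
     {T. \<forall>i v. Vector_Spaces.linear (*s) (*s) (\<lambda>x. T (\<chi> j. if j = i then x else v $ j))}"

definition vanishing_dims :: "('a::field ^ 'n ^ 'd \<Rightarrow> 'a ^ 'm) \<Rightarrow> nat set" where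
  "vanishing_dims T =
     {s. \<exists>V :: 'd \<Rightarrow> ('a ^ 'n) set.
           (\<forall>i. vec.subspace (V i) \<and> vec.dim (V i) = s) \<and>
           (\<forall>v. (\<forall>i. v $ i \<in> V i) \<longrightarrow> T v = 0)}"

definition alpha_map :: "('a::field ^ 'n ^ 'd \<Rightarrow> 'a ^ 'm) \<Rightarrow> nat" where
  "alpha_map T = Max (vanishing_dims T)"

definition alpha ::
  "'a::field itself \<Rightarrow> 'n::finite itself \<Rightarrow> 'd::finite itself \<Rightarrow> 'm::finite itself \<Rightarrow> nat" where
  "alpha _ _ _ _ = Min (alpha_map ` (multilinear_maps :: ('a ^ 'n ^ 'd \<Rightarrow> 'a ^ 'm) set))"

text \<open>The maximum and the minimum above are taken over finite nonempty sets.\<close>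

lemma vanishing_dims_le:
  fixes T :: "'a::field ^ 'n ^ 'd \<Rightarrow> 'a ^ 'm"
  assumes "s \<in> vanishing_dims T"
  shows "s \<le> CARD('n)"
proof -
  from assms obtain V :: "'d \<Rightarrow> ('a ^ 'n) set" where "\<forall>i. vec.dim (V i) = s"
    unfolding vanishing_dims_def by blast
  then show ?thesis
    using dim_subset_UNIV_cart_gen by metis
qed

lemma finite_vanishing_dims: "finite (vanishing_dims T)"
  using vanishing_dims_le finite_nat_set_iff_bounded_le by blast

lemma zero_in_vanishing_dims:
  fixes T :: "'a::field ^ 'n ^ 'd \<Rightarrow> 'a ^ 'm"
  assumes "T \<in> multilinear_maps"
  shows "0 \<in> vanishing_dims T"
proof -
  have "T v = 0" if v: "\<forall>i. v $ i = 0" for v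
  proof -
    fix i :: 'd
    have "Vector_Spaces.linear (*s) (*s) (\<lambda>x. T (\<chi> j. if j = i then x else v $ j))"
      using assms unfolding multilinear_maps_def by blast
    then have "T (\<chi> j. if j = i then 0 else v $ j) = 0"
      by (rule vec.linear_0)
    moreover have "(\<chi> j. if j = i then 0 else v $ j) = v"
      using v by (simp add: vec_eq_iff)
    ultimately show ?thesis by simp
  qed
  then have "\<exists>V :: 'd \<Rightarrow> ('a ^ 'n) set. (\<forall>i. vec.subspace (V i) \<and> vec.dim (V i) = 0) \<and>
           (\<forall>v. (\<forall>i. v $ i \<in> V i) \<longrightarrow> T v = 0)"
    by (intro exI[of _ "\<lambda>_. {0}"]) (auto simp: vec.subspace_0 vec.subspace_def)
  then show ?thesis
    unfolding vanishing_dims_def by simp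
qed

lemma alpha_map_le:
  fixes T :: "'a::field ^ 'n ^ 'd \<Rightarrow> 'a ^ 'm"
  assumes "T \<in> multilinear_maps"
  shows "alpha_map T \<le> CARD('n)"
proof -
  have "Max (vanishing_dims T) \<in> vanishing_dims T"
    using zero_in_vanishing_dims[OF assms] finite_vanishing_dims by (intro Max_in) auto
  then show ?thesis
    unfolding alpha_map_def by (rule vanishing_dims_le)
qed

lemma finite_alpha_map_image:
  "finite (alpha_map ` (multilinear_maps :: ('a::field ^ 'n ^ 'd \<Rightarrow> 'a ^ 'm) set))"
  by (rule finite_subset[of _ "{..CARD('n)}"]) (auto simp: alpha_map_le)

lemma multilinear_maps_nonempty:
  "(multilinear_maps :: ('a::field ^ 'n ^ 'd \<Rightarrow> 'a ^ 'm) set) \<noteq> {}"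
proof -
  have "(\<lambda>_. 0) \<in> (multilinear_maps :: ('a ^ 'n ^ 'd \<Rightarrow> 'a ^ 'm) set)"
    unfolding multilinear_maps_def by (simp add: vec.linear_zero)
  then show ?thesis by blast
qed

end

theory Submission
  imports Defs
begin

text \<open>
  Let \<open>Y\<close> be the set of coefficient arrays of multilinear maps that vanish on some product of
  planes. In a chart of the Grassmannians, \<open>Y\<close> is the image of a polynomial map with
  \<open>2 d (n - 2) + m (n\<^sup>d - 2\<^sup>d)\<close> parameters, so if \<open>d (n - 2) < m 2\<^bsup>d - 1\<^esup>\<close> it lies in the zero set of
  a nonzero polynomial. If \<open>d (n - 2) \<ge> m 2\<^bsup>d - 1\<^esup>\<close>, then \<open>Y\<close> is everything, because it is both
  closed and dense. Closedness replaces the properness of Grassmannians by a place (Chevalley's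
  extension theorem, carried out for rings of functions on \<open>Y\<close>). Density holds because the
  parametrisation has a surjective differential at a suitable point: one needs families
  \<open>t\<^sub>i\<close> of at most \<open>n - 2\<close> tensors, without factor in position \<open>i\<close>, such that the \<open>F\<^sup>2 \<otimes>\<^sub>i t\<^sub>i\<close>
  together span \<open>(F\<^sup>2)\<^bsup>\<otimes> d\<^esup> \<otimes> F\<^sup>m\<close>. These are built by induction on \<open>d\<close>, for families of arbitrary
  sizes \<open>q\<^sub>i\<close> with \<open>\<Sum>q\<^sub>i \<ge> m 2\<^bsup>d - 1\<^esup>\<close>: a new direction is created by gluing two solutions that share
  their tensors in one old direction and splitting these shared tensors between the two.
\<close>

section \<open>Polynomial functions\<close>

text \<open>The inequality is half the comparison between the number of chart parameters and the m *
  n^d coefficients, so the hard direction says that nothing but this count obstructs killing planes.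
  The obstacle is integrality: cutting the cube into halves forces the sizes of the families to be
  shared out in integers, which is why arbitrary sizes are treated although only n - 2 in every
  direction is wanted. Counting is not enough in the smallest case m = 1, d = 2 with sizes 1 and 1:
  the spaces F^2 tensor a and b tensor F^2 meet in b tensor a, hence do not span. Gluing along a
  single shared tensor would meet this configuration, so at least two tensors are shared; m >= 2
  makes the total so large that two directions always have sizes adding up to 4, which provides
  them. Algebraic closedness enters twice: the field is infinite, and a proper ideal of F[X] has a
  zero in F, so that the limits of planes are defined over F itself.\<close>

lemma infinite_UNIV_alg_closed: "infinite (UNIV :: 'a::alg_closed_field set)"
proof
  assume fin: "finite (UNIV :: 'a set)"
  define p :: "'a poly" where "p = (\<Prod>a\<in>UNIV. [:- a, 1:])"
  have root: "poly p a = 0" for a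
    unfolding p_def poly_prod by (rule prod_zero[OF fin]) (auto intro: bexI[of _ a])
  have "p \<noteq> 0" unfolding p_def using fin by auto
  have "degree p = card (UNIV :: 'a set)"
    unfolding p_def by (subst degree_prod_eq_sum_degree) auto
  then have "degree (p + 1) > 0"
    using fin by (subst degree_add_eq_left) (auto simp: card_gt_0_iff)
  then obtain a where "poly (p + 1) a = 0" using alg_closed_imp_poly_has_root by blast
  then show False using root[of a] by simp
qed

lemma poly_eq_0_if_vanishes:
  fixes p :: "'a::idom poly"
  assumes "infinite (UNIV :: 'a set)" "\<And>t. poly p t = 0" shows "p = 0"
proof (rule ccontr)
  assume "p \<noteq> 0"
  then have "finite {t. poly p t = 0}" by (rule poly_roots_finite)
  then show False using assms by simp
qed

text \<open>Polynomials are treated as functions. \<open>K\<close> contains the variables that may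
  occur and \<open>n\<close> is only an upper bound for the degree, hence the free \<open>n\<close>
  in \<open>const\<close> and \<open>var\<close>; the bound is what the counting in
  \<open>algebraic_dependence\<close> uses.\<close>

inductive polyfun :: "'j set \<Rightarrow> nat \<Rightarrow> (('j \<Rightarrow> 'a::comm_ring_1) \<Rightarrow> 'a) \<Rightarrow> bool" for K where
  const: "polyfun K n (\<lambda>_. c)"
| var: "k \<in> K \<Longrightarrow> polyfun K (Suc n) (\<lambda>x. x k)"
| add: "polyfun K n f \<Longrightarrow> polyfun K n g \<Longrightarrow> polyfun K n (\<lambda>x. f x + g x)"
| mult: "polyfun K m f \<Longrightarrow> polyfun K n g \<Longrightarrow> polyfun K (m + n) (\<lambda>x. f x * g x)"

lemma polyfun_mono:
  assumes "polyfun K m f" "m \<le> n" shows "polyfun K n f"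
  using polyfun.mult[OF assms(1) polyfun.const[of K "n - m" 1]] assms(2) by simp

lemma polyfun_diff:
  assumes "polyfun K n f" "polyfun K n g" shows "polyfun K n (\<lambda>x. f x - g x)"
  using polyfun.add[OF assms(1) polyfun.mult[OF polyfun.const[of K 0 "- 1"] assms(2), simplified]]
  by simp

lemma polyfun_sum:
  assumes "\<And>i. i \<in> A \<Longrightarrow> polyfun K n (f i)" shows "polyfun K n (\<lambda>x. \<Sum>i\<in>A. f i x)"
  using assms
  by (induction A rule: infinite_finite_induct) (auto intro: polyfun.intros)

lemma polyfun_prod:
  assumes "\<And>i. i \<in> A \<Longrightarrow> polyfun K (d i) (f i)" "(\<Sum>i\<in>A. d i) \<le> n"
  shows "polyfun K n (\<lambda>x. \<Prod>i\<in>A. f i x)"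
proof -
  have "polyfun K (\<Sum>i\<in>A. d i) (\<lambda>x. \<Prod>i\<in>A. f i x)"
    using assms(1)
    by (induction A rule: infinite_finite_induct) (auto intro: polyfun.intros)
  then show ?thesis using assms(2) by (rule polyfun_mono)
qed

lemma polyfun_compose:
  assumes "polyfun J n P" "\<And>j. j \<in> J \<Longrightarrow> polyfun K e (\<Phi> j)"
  shows "polyfun K (n * e) (\<lambda>x. P (\<lambda>j. \<Phi> j x))"
  using assms(1)
proof induction
  case (var k n)
  then show ?case using polyfun_mono[OF assms(2)[of k], of "Suc n * e"] by simp
next
  case (mult m f n g)
  then show ?case using polyfun.mult[of K "m * e" _ "n * e"] by (simp add: algebra_simps)
qed (auto intro: polyfun.intros)

lemma polyfun_curve:
  assumes "polyfun K n P" shows "\<exists>q. \<forall>t. P (\<lambda>j. poly (p j) t) = poly q t"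
  using assms
proof induction
  case (const n c)
  then show ?case by (intro exI[of _ "[:c:]"]) simp
next
  case (add n f g)
  then show ?case by (metis poly_add)
next
  case (mult m f n g)
  then show ?case by (metis poly_mult)
qed auto

text \<open>Taylor expansion at \<open>c\<close>: coefficient k of \<open>h S\<close> plays the role
  of the degree-k part of \<open>P\<close> around \<open>c\<close>. It is recorded as a polynomial
  function of \<open>S\<close>, so that it can itself be followed along a curve of
  directions.\<close>

lemma polyfun_expand:
  assumes "polyfun UNIV n P"
  shows "\<exists>h. (\<forall>k. polyfun UNIV n (\<lambda>S. coeff (h S) k)) \<and> (\<forall>S. degree (h S) \<le> n) \<and>
             (\<forall>S a. poly (h S) a = P (\<lambda>j. c j + a * S j))"
  using assms
proof induction
  case (const n b)
  then show ?case by (intro exI[of _ "\<lambda>_. [:b:]"]) (auto intro: polyfun.const)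
next
  case (var k n)
  have "polyfun UNIV (Suc n) (\<lambda>S. coeff [:c k, S k:] i)" for i
  proof -
    consider "i = 0" | "i = 1" | j where "i = Suc (Suc j)" by (metis One_nat_def not0_implies_Suc)
    then show ?thesis by cases (auto intro: polyfun.intros)
  qed
  then show ?case by (intro exI[of _ "\<lambda>S. [:c k, S k:]"]) auto
next
  case (add n f g)
  then obtain h1 h2 where
    "\<And>k. polyfun UNIV n (\<lambda>S. coeff (h1 S) k)" "\<And>S. degree (h1 S) \<le> n"
    "\<And>S a. poly (h1 S) a = f (\<lambda>j. c j + a * S j)"
    "\<And>k. polyfun UNIV n (\<lambda>S. coeff (h2 S) k)" "\<And>S. degree (h2 S) \<le> n"
    "\<And>S a. poly (h2 S) a = g (\<lambda>j. c j + a * S j)"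
    by metis
  then show ?case
    by (intro exI[of _ "\<lambda>S. h1 S + h2 S"]) (auto intro: polyfun.add degree_add_le)
next
  case (mult m f n g)
  then obtain h1 h2 where h:
    "\<And>k. polyfun UNIV m (\<lambda>S. coeff (h1 S) k)" "\<And>S. degree (h1 S) \<le> m"
    "\<And>S a. poly (h1 S) a = f (\<lambda>j. c j + a * S j)"
    "\<And>k. polyfun UNIV n (\<lambda>S. coeff (h2 S) k)" "\<And>S. degree (h2 S) \<le> n"
    "\<And>S a. poly (h2 S) a = g (\<lambda>j. c j + a * S j)"
    by metis
  have "degree (h1 S * h2 S) \<le> m + n" for S
    using degree_mult_le[of "h1 S" "h2 S"] h(2)[of S] h(5)[of S] by linarith
  moreover have "polyfun UNIV (m + n) (\<lambda>S. coeff (h1 S * h2 S) k)" for k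
    unfolding coeff_mult by (intro polyfun_sum polyfun.mult h)
  ultimately show ?case
    using h(3,6) by (intro exI[of _ "\<lambda>S. h1 S * h2 S"]) auto
qed

text \<open>Along such a curve, the lowest nonzero homogeneous part of \<open>P\<close> around \<open>c\<close> vanishes at \<open>S\<close>.\<close>

lemma polyfun_eq_0_if_curves:
  fixes P :: "('j \<Rightarrow> 'a::idom) \<Rightarrow> 'a"
  assumes inf: "infinite (UNIV :: 'a set)" and P: "polyfun UNIV n P"
    and curves: "\<And>S. \<exists>p. (\<forall>j. coeff (p j) 0 = c j \<and> coeff (p j) 1 = S j) \<and>
                   (\<forall>t. P (\<lambda>j. poly (p j) t) = 0)"
  shows "P x = 0"
proof -
  obtain h where h: "\<And>k. polyfun UNIV n (\<lambda>S. coeff (h S) k)" "\<And>S. degree (h S) \<le> n"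
    "\<And>S a. poly (h S) a = P (\<lambda>j. c j + a * S j)"
    using polyfun_expand[OF P, of c] by metis
  have zero: "\<forall>S. coeff (h S) k = 0" if "k \<le> n" for k
    using that
  proof (induction k rule: less_induct)
    case (less k)
    show ?case
    proof
      fix S
      obtain p where p: "\<And>j. coeff (p j) 0 = c j" "\<And>j. coeff (p j) 1 = S j"
        "\<And>t. P (\<lambda>j. poly (p j) t) = 0" using curves[of S] by blast
      \<comment> \<open>The point of the curve at t is c + t * r(t), so \<open>P\<close> there
        equals \<open>h (r(t))\<close> evaluated at t. The parts of degree below k vanish in every
        direction, in particular in direction r(t); what is left at order t^k is coefficient k of
        \<open>h\<close> in direction r(0) = \<open>S\<close>.\<close>
      define r where "r j = poly_shift 1 (p j)" for j
      have pr: "p j = pCons (c j) (r j)" for j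
        by (rule poly_eqI) (simp add: r_def coeff_poly_shift coeff_pCons p(1) split: nat.split)
      have r0: "poly (r j) 0 = S j" for j
        using p(2)[of j] by (simp add: r_def poly_0_coeff_0 coeff_poly_shift)
      obtain q where q: "\<And>i t. coeff (h (\<lambda>j. poly (r j) t)) i = poly (q i) t"
        using polyfun_curve[OF h(1), of r] by metis
      have q0: "q i = 0" if "i < k" for i
        using less that by (intro poly_eq_0_if_vanishes[OF inf]) (simp flip: q)
      define s where "s = (\<Sum>i\<le>n. monom 1 i * q i)"
      have "poly s t = 0" for t
      proof -
        have "poly s t = (\<Sum>i\<le>n. t ^ i * coeff (h (\<lambda>j. poly (r j) t)) i)"
          by (simp add: s_def poly_sum poly_monom q)
        also have "\<dots> = poly (h (\<lambda>j. poly (r j) t)) t"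
          unfolding poly_altdef[of "h (\<lambda>j. poly (r j) t)"] using h(2)[of "\<lambda>j. poly (r j) t"]
          by (intro sum.mono_neutral_cong_right) (auto simp: coeff_eq_0)
        also have "\<dots> = 0" using p(3)[of t] by (simp add: h(3) pr)
        finally show ?thesis .
      qed
      then have "s = 0" by (rule poly_eq_0_if_vanishes[OF inf])
      have "coeff s k = (\<Sum>i\<le>n. if i = k then coeff (q i) 0 else 0)"
        unfolding s_def coeff_sum
        by (intro sum.cong) (auto simp: coeff_monom_mult q0)
      also have "\<dots> = coeff (q k) 0" using less.prems by simp
      finally have "poly (q k) 0 = 0" using \<open>s = 0\<close> by (simp add: poly_0_coeff_0)
      then show "coeff (h S) k = 0" using q[of 0 k] by (simp add: r0)
    qed
  qed
  have "h (\<lambda>j. x j - c j) = 0"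
  proof (rule poly_eqI)
    fix i show "coeff (h (\<lambda>j. x j - c j)) i = coeff 0 i"
      using zero[of i] h(2)[of "\<lambda>j. x j - c j"] by (cases "i \<le> n") (auto simp: coeff_eq_0)
  qed
  then show ?thesis using h(3)[of "\<lambda>j. x j - c j" 1] by simp
qed

text \<open>On the line joining a point good for the new function to a point good for all the old
  ones, every function restricts to a nonzero polynomial in one variable, and the product of these
  has a non-root.\<close>

lemma polyfun_common_nonzero:
  fixes P :: "'i \<Rightarrow> ('j \<Rightarrow> 'a::idom) \<Rightarrow> 'a"
  assumes inf: "infinite (UNIV :: 'a set)" and "finite I"
    and "\<And>i. i \<in> I \<Longrightarrow> polyfun K (n i) (P i)" "\<And>i. i \<in> I \<Longrightarrow> \<exists>z. P i z \<noteq> 0"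
  shows "\<exists>z. \<forall>i\<in>I. P i z \<noteq> 0"
  using assms(2-)
proof (induction I)
  case (insert i I)
  then obtain z2 where z2: "\<forall>i\<in>I. P i z2 \<noteq> 0" by auto
  obtain z1 where z1: "P i z1 \<noteq> 0" using insert.prems(2)[of i] by auto
  let ?line = "\<lambda>j. [:z1 j, z2 j - z1 j:]"
  have "\<forall>l\<in>insert i I. \<exists>q. \<forall>t. P l (\<lambda>j. poly (?line j) t) = poly q t"
    using polyfun_curve[OF insert.prems(1), of _ ?line] by blast
  from bchoice[OF this] obtain q where
    q: "\<And>l t. l \<in> insert i I \<Longrightarrow> P l (\<lambda>j. poly (?line j) t) = poly (q l) t"
    by blast
  have "q l \<noteq> 0" if "l \<in> insert i I" for l
  proof (cases "l = i")
    case True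
    then show ?thesis using q[of i 0] z1 by auto
  next
    case False
    then have "poly (q l) 1 \<noteq> 0" using q[of l 1] z2 that by auto
    then show ?thesis by auto
  qed
  then have "(\<Prod>l\<in>insert i I. q l) \<noteq> 0" using insert.hyps by auto
  then obtain t where "poly (\<Prod>l\<in>insert i I. q l) t \<noteq> 0"
    using poly_eq_0_if_vanishes[OF inf] by blast
  then have "\<forall>l\<in>insert i I. poly (q l) t \<noteq> 0"
    using insert.hyps(1) by (auto simp: poly_prod)
  then have "\<forall>l\<in>insert i I. P l (\<lambda>j. poly (?line j) t) \<noteq> 0" using q[of _ t] by simp
  then show ?case by blast
qed auto

section \<open>Polynomials vanishing on the image of a polynomial map, by counting\<close>

lemma underdetermined_system:
  fixes a :: "'e \<Rightarrow> 'u \<Rightarrow> 'a::field"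
  assumes "finite E" "finite U" "card E < card U"
  shows "\<exists>c. (\<exists>u\<in>U. c u \<noteq> 0) \<and> (\<forall>e\<in>E. (\<Sum>u\<in>U. a e u * c u) = 0)"
  using assms
proof (induction E arbitrary: U a)
  case empty
  then obtain u where "u \<in> U" by fastforce
  then show ?case by (intro exI[of _ "\<lambda>_. 1"]) auto
next
  case (insert e E)
  show ?case
  proof (cases "\<forall>u\<in>U. a e u = 0")
    case True
    obtain c where "\<exists>u\<in>U. c u \<noteq> 0" "\<forall>e\<in>E. (\<Sum>u\<in>U. a e u * c u) = 0"
      using insert.IH[of U a] insert.prems insert.hyps by auto
    then show ?thesis using True by (intro exI[of _ c]) auto
  next
    case False
    then obtain w where w: "w \<in> U" "a e w \<noteq> 0" by auto
    define V where "V = U - {w}"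
    have V: "finite V" "w \<notin> V" "U = insert w V" using w insert.prems by (auto simp: V_def)
    have "card E < card V" using insert.prems insert.hyps V by simp
    then obtain c where c: "\<exists>u\<in>V. c u \<noteq> 0"
      "\<And>e'. e' \<in> E \<Longrightarrow> (\<Sum>u\<in>V. (a e' u - a e' w * a e u / a e w) * c u) = 0"
      using insert.IH[OF V(1), of "\<lambda>e' u. a e' u - a e' w * a e u / a e w"] by auto
    define s where "s = - (\<Sum>u\<in>V. a e u * c u) / a e w"
    define c' where "c' = c(w := s)"
    have sum: "(\<Sum>u\<in>U. a e' u * c' u) = a e' w * s + (\<Sum>u\<in>V. a e' u * c u)" for e'
    proof -
      have "(\<Sum>u\<in>V. a e' u * c' u) = (\<Sum>u\<in>V. a e' u * c u)"
        using V(2) by (intro sum.cong) (auto simp: c'_def)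
      then show ?thesis using V by (simp add: c'_def)
    qed
    have "(\<Sum>u\<in>U. a e' u * c' u) = 0" if "e' \<in> insert e E" for e'
    proof (cases "e' = e")
      case True
      then show ?thesis using w(2) by (simp add: sum s_def)
    next
      case False
      then have "0 = (\<Sum>u\<in>V. a e' u * c u - a e' w / a e w * (a e u * c u))"
        using c(2)[of e'] that by (simp add: left_diff_distrib mult.assoc)
      also have "\<dots> = (\<Sum>u\<in>V. a e' u * c u) + a e' w * s"
        by (simp add: sum_subtractf s_def sum_distrib_left sum_divide_distrib)
      finally show ?thesis by (simp add: sum add.commute)
    qed
    moreover have "\<exists>u\<in>U. c' u \<noteq> 0" using c(1) V by (auto simp: c'_def)
    ultimately show ?thesis by blast
  qed
qed

text \<open>The bound is on each exponent separately, which is coarser than total degree but makes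
  the number of monomials the plain power \<open>Suc n ^ card K\<close>.\<close>

definition monomial_sums :: "'j set \<Rightarrow> nat \<Rightarrow> (('j \<Rightarrow> 'a::comm_ring_1) \<Rightarrow> 'a) set" where
  "monomial_sums K n =
     {f. \<exists>a. \<forall>x. f x = (\<Sum>\<nu>\<in>PiE K (\<lambda>_. {..n}). a \<nu> * (\<Prod>k\<in>K. x k ^ \<nu> k))}"

lemma monomial_sums_add:
  assumes "f \<in> monomial_sums K n" "g \<in> monomial_sums K n"
  shows "(\<lambda>x. f x + g x) \<in> monomial_sums K n"
proof -
  obtain a b where "\<And>x. f x = (\<Sum>\<nu>\<in>PiE K (\<lambda>_. {..n}). a \<nu> * (\<Prod>k\<in>K. x k ^ \<nu> k))"
    "\<And>x. g x = (\<Sum>\<nu>\<in>PiE K (\<lambda>_. {..n}). b \<nu> * (\<Prod>k\<in>K. x k ^ \<nu> k))"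
    using assms by (auto simp: monomial_sums_def)
  then show ?thesis
    unfolding monomial_sums_def mem_Collect_eq
    by (intro exI[of _ "\<lambda>\<nu>. a \<nu> + b \<nu>"]) (simp add: distrib_right sum.distrib)
qed

lemma monomial_sums_monomial:
  assumes "finite K" "\<And>k. k \<in> K \<Longrightarrow> \<mu> k \<le> n"
  shows "(\<lambda>x. b * (\<Prod>k\<in>K. x k ^ \<mu> k)) \<in> monomial_sums K n"
proof -
  have "(\<Sum>\<nu>\<in>PiE K (\<lambda>_. {..n}). (if \<nu> = restrict \<mu> K then b else 0) * (\<Prod>k\<in>K. x k ^ \<nu> k))
      = b * (\<Prod>k\<in>K. x k ^ \<mu> k)" for x :: "'a \<Rightarrow> 'b"
  proof -
    have "(\<Sum>\<nu>\<in>PiE K (\<lambda>_. {..n}). (if \<nu> = restrict \<mu> K then b else 0) * (\<Prod>k\<in>K. x k ^ \<nu> k))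
      = (\<Sum>\<nu>\<in>PiE K (\<lambda>_. {..n}). if \<nu> = restrict \<mu> K then b * (\<Prod>k\<in>K. x k ^ \<mu> k) else 0)"
      by (intro sum.cong) auto
    also have "\<dots> = b * (\<Prod>k\<in>K. x k ^ \<mu> k)"
      using assms by (subst sum.delta) (auto simp: finite_PiE)
    finally show ?thesis .
  qed
  then show ?thesis
    unfolding monomial_sums_def mem_Collect_eq
    by (intro exI[of _ "\<lambda>\<nu>. if \<nu> = restrict \<mu> K then b else 0"]) simp
qed

lemma monomial_sums_sum:
  assumes "finite K" "\<And>i. i \<in> A \<Longrightarrow> f i \<in> monomial_sums K n"
  shows "(\<lambda>x. \<Sum>i\<in>A. f i x) \<in> monomial_sums K n"
proof -
  have "(\<lambda>_. 0) \<in> monomial_sums K n"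
    using monomial_sums_monomial[OF assms(1), of "\<lambda>_. 0" n 0] by simp
  then show ?thesis
    using assms(2)
    by (induction A rule: infinite_finite_induct) (auto intro: monomial_sums_add)
qed

lemma polyfun_monomial_sums:
  fixes f :: "('j \<Rightarrow> 'a::comm_ring_1) \<Rightarrow> 'a"
  assumes "finite K" "polyfun K n f" shows "f \<in> monomial_sums K n"
  using assms(2)
proof induction
  case (const n c)
  then show ?case using monomial_sums_monomial[OF assms(1), of "\<lambda>_. 0" n c] by simp
next
  case (var k n)
  have eq: "1 * (\<Prod>i\<in>K. x i ^ (if i = k then 1 else 0)) = x k" for x :: "'j \<Rightarrow> 'a"
  proof -
    have "(\<Prod>i\<in>K. x i ^ (if i = k then 1 else 0)) = (\<Prod>i\<in>K. if i = k then x i else 1)"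
      by (intro prod.cong) auto
    then show ?thesis using var assms(1) by simp
  qed
  have "(\<lambda>x :: 'j \<Rightarrow> 'a. 1 * (\<Prod>i\<in>K. x i ^ (if i = k then 1 else 0))) \<in> monomial_sums K (Suc n)"
    by (rule monomial_sums_monomial[OF assms(1)]) auto
  then show ?case unfolding eq .
next
  case (add n f g)
  then show ?case by (intro monomial_sums_add)
next
  case (mult m f n g)
  then obtain a b where
    a: "\<And>x. f x = (\<Sum>\<nu>\<in>PiE K (\<lambda>_. {..m}). a \<nu> * (\<Prod>k\<in>K. x k ^ \<nu> k))" and
    b: "\<And>x. g x = (\<Sum>\<nu>\<in>PiE K (\<lambda>_. {..n}). b \<nu> * (\<Prod>k\<in>K. x k ^ \<nu> k))"
    by (auto simp: monomial_sums_def)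
  have eq: "f x * g x = (\<Sum>\<nu>\<in>PiE K (\<lambda>_. {..m}). \<Sum>\<mu>\<in>PiE K (\<lambda>_. {..n}).
      (a \<nu> * b \<mu>) * (\<Prod>k\<in>K. x k ^ (\<nu> k + \<mu> k)))" for x
    unfolding a b sum_product by (intro sum.cong refl) (simp add: power_add prod.distrib mult_ac)
  show ?case
    unfolding eq
    by (intro monomial_sums_sum monomial_sums_monomial assms(1)) (auto simp: PiE_iff add_mono)
qed

text \<open>There are more functions separating the points of a large grid in \<open>J\<close>-space than monomials
  of the corresponding degree in the \<open>K\<close>-variables.\<close>

lemma algebraic_dependence:
  fixes \<Phi> :: "'j \<Rightarrow> ('k \<Rightarrow> 'a::field) \<Rightarrow> 'a"
  assumes inf: "infinite (UNIV :: 'a set)" and K: "finite K" and J: "finite J"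
    and card: "card K < card J" and \<Phi>: "\<And>j. j \<in> J \<Longrightarrow> polyfun K e (\<Phi> j)"
  shows "\<exists>n P. polyfun J n P \<and> (\<exists>z. P z \<noteq> 0) \<and> (\<forall>x. P (\<lambda>j. \<Phi> j x) = 0)"
proof -
  \<comment> \<open>The grid has \<open>Suc D\<close> points in each of the \<open>card J\<close>
    coordinates, and \<open>n\<close> bounds the degree of a Lagrange product after substituting
    \<open>\<Phi>\<close>. As \<open>Suc n \<le> b * Suc D\<close> and
    \<open>D = b ^ card K\<close>, the monomials number at most \<open>D * Suc D ^ card K\<close>,
    which is less than \<open>Suc D ^ card J\<close>.\<close>
  define b where "b = card J * Suc e"
  define D where "D = b ^ card K"
  define n where "n = card J * D * e"
  obtain S :: "'a set" where S: "finite S" "card S = Suc D"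
    using infinite_arbitrarily_large[OF inf] by blast
  define U where "U = PiE J (\<lambda>_. S)"
  \<comment> \<open>Unnormalised Lagrange basis of the grid: \<open>L s\<close> vanishes at every
    grid point except \<open>s\<close>, so a nontrivial combination of these is a nonzero
    function.\<close>
  define L where "L s z = (\<Prod>j\<in>J. \<Prod>r\<in>S - {s j}. z j - r)" for s z :: "'j \<Rightarrow> 'a"
  have L: "polyfun J (card J * D) (L s)" if "s \<in> U" for s
  proof -
    have "polyfun J D (\<lambda>z. \<Prod>r\<in>S - {s j}. z j - r)" if j: "j \<in> J" for j
    proof (rule polyfun_prod[where d = "\<lambda>_. 1"])
      show "polyfun J 1 (\<lambda>z. z j - r)" for r
        using j by (auto intro!: polyfun_diff polyfun.const polyfun.var)
      show "(\<Sum>i\<in>S - {s j}. 1) \<le> D" using S that \<open>s \<in> U\<close> j by (simp add: U_def PiE_iff)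
    qed
    then show ?thesis
      unfolding L_def[abs_def] by (rule polyfun_prod[where d = "\<lambda>_. D"]) auto
  qed
  have "\<exists>a. \<forall>x. L s (\<lambda>j. \<Phi> j x) = (\<Sum>\<nu>\<in>PiE K (\<lambda>_. {..n}). a \<nu> * (\<Prod>k\<in>K. x k ^ \<nu> k))"
    if "s \<in> U" for s
    using polyfun_monomial_sums[OF K polyfun_compose[OF L[OF that] \<Phi>]]
    by (simp add: monomial_sums_def n_def)
  then obtain a where a: "\<And>s x. s \<in> U \<Longrightarrow>
      L s (\<lambda>j. \<Phi> j x) = (\<Sum>\<nu>\<in>PiE K (\<lambda>_. {..n}). a s \<nu> * (\<Prod>k\<in>K. x k ^ \<nu> k))"
    by metis
  have "card (PiE K (\<lambda>_. {..n})) < card U"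
  proof -
    have "Suc n \<le> b * Suc D" using card by (auto simp: n_def b_def algebra_simps)
    then have "Suc n ^ card K \<le> (b * Suc D) ^ card K" by (rule power_mono) simp
    also have "\<dots> = D * Suc D ^ card K" by (simp only: power_mult_distrib D_def)
    also have "\<dots> < Suc D ^ Suc (card K)" by simp
    also have "\<dots> \<le> Suc D ^ card J" using card by (intro power_increasing) auto
    finally show ?thesis using K J S by (simp add: U_def card_PiE)
  qed
  moreover have "finite U" using J S by (auto simp: U_def finite_PiE)
  ultimately obtain c where c: "\<exists>s\<in>U. c s \<noteq> 0"
    "\<And>\<nu>. \<nu> \<in> PiE K (\<lambda>_. {..n}) \<Longrightarrow> (\<Sum>s\<in>U. a s \<nu> * c s) = 0"
    using underdetermined_system[of "PiE K (\<lambda>_. {..n})" U "\<lambda>\<nu> s. a s \<nu>"] K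
    by (auto simp: finite_PiE)
  define P where "P z = (\<Sum>s\<in>U. c s * L s z)" for z
  have "polyfun J (0 + card J * D) P"
    unfolding P_def[abs_def] by (intro polyfun_sum polyfun.mult polyfun.const L)
  moreover have "\<exists>z. P z \<noteq> 0"
  proof -
    obtain s where s: "s \<in> U" "c s \<noteq> 0" using c(1) by auto
    have "L s' s = 0" if "s' \<in> U" "s' \<noteq> s" for s'
    proof -
      have "\<not> (\<forall>j\<in>J. s' j = s j)"
        using that s(1) PiE_ext[of s' J "\<lambda>_. S" s] unfolding U_def by blast
      then obtain j where j: "j \<in> J" "s' j \<noteq> s j" by blast
      then have "(\<Prod>r\<in>S - {s' j}. s j - r) = 0"
        using s(1) S by (intro prod_zero) (auto simp: U_def PiE_iff)
      then show ?thesis unfolding L_def using j J by (intro prod_zero) auto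
    qed
    then have "P s = (\<Sum>s'\<in>U. if s' = s then c s * L s s else 0)"
      unfolding P_def by (intro sum.cong) auto
    also have "\<dots> = c s * L s s" using s \<open>finite U\<close> by simp
    also have "\<dots> \<noteq> 0" using s J S by (auto simp: L_def)
    finally show ?thesis by blast
  qed
  moreover have "P (\<lambda>j. \<Phi> j x) = 0" for x
  proof -
    have "P (\<lambda>j. \<Phi> j x) = (\<Sum>s\<in>U. \<Sum>\<nu>\<in>PiE K (\<lambda>_. {..n}). (a s \<nu> * c s) * (\<Prod>k\<in>K. x k ^ \<nu> k))"
      unfolding P_def by (intro sum.cong refl) (simp add: a sum_distrib_left mult_ac)
    also have "\<dots> = (\<Sum>\<nu>\<in>PiE K (\<lambda>_. {..n}). (\<Sum>s\<in>U. a s \<nu> * c s) * (\<Prod>k\<in>K. x k ^ \<nu> k))"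
      by (subst sum.swap) (simp add: sum_distrib_right)
    also have "\<dots> = 0" using c(2) by simp
    finally show ?thesis .
  qed
  ultimately show ?thesis by blast
qed

section \<open>Places and projective limits\<close>

definition function_ring :: "('x \<Rightarrow> 'a::comm_ring_1) set \<Rightarrow> bool" where
  "function_ring G \<longleftrightarrow> (\<forall>c. (\<lambda>_. c) \<in> G) \<and>
     (\<forall>f\<in>G. \<forall>g\<in>G. (\<lambda>x. f x + g x) \<in> G \<and> (\<lambda>x. f x * g x) \<in> G)"

lemma function_ring_const: "function_ring G \<Longrightarrow> (\<lambda>_. c) \<in> G"
  and function_ring_add: "function_ring G \<Longrightarrow> f \<in> G \<Longrightarrow> g \<in> G \<Longrightarrow> (\<lambda>x. f x + g x) \<in> G"
  and function_ring_mult: "function_ring G \<Longrightarrow> f \<in> G \<Longrightarrow> g \<in> G \<Longrightarrow> (\<lambda>x. f x * g x) \<in> G"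
  by (auto simp: function_ring_def)

lemma function_ring_diff:
  assumes "function_ring G" "f \<in> G" "g \<in> G" shows "(\<lambda>x. f x - g x) \<in> G"
proof -
  have "(\<lambda>x. f x + (\<lambda>_. - 1) x * g x) \<in> G"
    using assms by (intro function_ring_add function_ring_mult function_ring_const)
  then show ?thesis by simp
qed

lemma function_ring_sum:
  assumes "function_ring G" "\<And>i. i \<in> A \<Longrightarrow> f i \<in> G" shows "(\<lambda>x. \<Sum>i\<in>A. f i x) \<in> G"
  using assms(2)
proof (induction A rule: infinite_finite_induct)
  case (insert a A)
  then show ?case using function_ring_add[OF assms(1)] by simp
qed (use function_ring_const[OF assms(1)] in auto)

lemma function_ring_prod:
  assumes "function_ring G" "\<And>i. i \<in> A \<Longrightarrow> f i \<in> G" shows "(\<lambda>x. \<Prod>i\<in>A. f i x) \<in> G"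
  using assms(2)
proof (induction A rule: infinite_finite_induct)
  case (insert a A)
  then show ?case using function_ring_mult[OF assms(1)] by simp
qed (use function_ring_const[OF assms(1)] in auto)

text \<open>The ring G[X], with a polynomial over \<open>G\<close> stored pointwise as a family of
  polynomials over the field. Thus \<open>f t\<close> is the result of applying the place to its
  coefficients.\<close>

definition poly_ring :: "('x \<Rightarrow> 'a::comm_ring_1) set \<Rightarrow> ('x \<Rightarrow> 'a poly) set" where
  "poly_ring G = {f. (\<exists>n. \<forall>x. degree (f x) \<le> n) \<and> (\<forall>i. (\<lambda>x. coeff (f x) i) \<in> G)}"

lemma poly_ring_coeff: "f \<in> poly_ring G \<Longrightarrow> (\<lambda>x. coeff (f x) i) \<in> G"
  by (auto simp: poly_ring_def)

lemma poly_ring_const: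
  assumes "function_ring G" shows "(\<lambda>_. p) \<in> poly_ring G"
  using function_ring_const[OF assms] by (auto simp: poly_ring_def)

lemma poly_ring_scalar:
  assumes "function_ring G" "g \<in> G" shows "(\<lambda>x. [:g x:]) \<in> poly_ring G"
proof -
  have "(\<lambda>x. coeff [:g x:] i) \<in> G" for i
    using assms function_ring_const[OF assms(1)] by (cases i) auto
  then show ?thesis by (auto simp: poly_ring_def)
qed

lemma poly_ring_add:
  assumes "function_ring G" "f \<in> poly_ring G" "g \<in> poly_ring G"
  shows "(\<lambda>x. f x + g x) \<in> poly_ring G"
proof -
  obtain m n where "\<And>x. degree (f x) \<le> m" "\<And>x. degree (g x) \<le> n"
    using assms by (auto simp: poly_ring_def)
  then have "degree (f x + g x) \<le> max m n" for x
    by (intro degree_add_le) (auto simp: le_max_iff_disj)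
  then show ?thesis
    using assms function_ring_add[OF assms(1)] by (auto simp: poly_ring_def)
qed

lemma poly_ring_mult:
  assumes "function_ring G" "f \<in> poly_ring G" "g \<in> poly_ring G"
  shows "(\<lambda>x. f x * g x) \<in> poly_ring G"
proof -
  obtain m n where mn: "\<And>x. degree (f x) \<le> m" "\<And>x. degree (g x) \<le> n"
    using assms by (auto simp: poly_ring_def)
  have "degree (f x * g x) \<le> m + n" for x
    using degree_mult_le[of "f x" "g x"] mn[of x] by (meson add_mono le_trans)
  moreover have "(\<lambda>x. coeff (f x * g x) i) \<in> G" for i
    unfolding coeff_mult
    using assms by (intro function_ring_sum function_ring_mult poly_ring_coeff)
  ultimately show ?thesis by (auto simp: poly_ring_def)
qed

lemma poly_ring_diff:
  assumes "function_ring G" "f \<in> poly_ring G" "g \<in> poly_ring G"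
  shows "(\<lambda>x. f x - g x) \<in> poly_ring G"
proof -
  have "(\<lambda>x. f x + (\<lambda>_. - 1) x * g x) \<in> poly_ring G"
    using assms by (intro poly_ring_add poly_ring_mult poly_ring_const)
  then show ?thesis by simp
qed

lemma poly_ring_eval:
  assumes "function_ring G" "f \<in> poly_ring G" "h \<in> G" shows "(\<lambda>x. poly (f x) (h x)) \<in> G"
proof -
  obtain n where n: "\<And>x. degree (f x) \<le> n" using assms by (auto simp: poly_ring_def)
  have hp: "(\<lambda>x. h x ^ i) \<in> G" for i
    by (induction i) (use function_ring_const[OF assms(1)] function_ring_mult[OF assms(1,3)] in auto)
  have "poly (f x) (h x) = (\<Sum>i\<le>n. coeff (f x) i * h x ^ i)" for x
    unfolding poly_altdef using n[of x]
    by (intro sum.mono_neutral_left) (auto simp: coeff_eq_0)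
  then show ?thesis
    using assms hp by (simp add: function_ring_sum function_ring_mult poly_ring_coeff)
qed

text \<open>Evaluation at \<open>t\<close> factors through restriction to \<open>Y\<close>. The
  extra point \<open>t\<close> lets one function carry both an element of the ring of functions on
  \<open>Y\<close> and its residue at the place.\<close>

definition determines :: "'x set \<Rightarrow> 'x \<Rightarrow> ('x \<Rightarrow> 'a::zero) set \<Rightarrow> bool" where
  "determines Y t G \<longleftrightarrow> (\<forall>g\<in>G. (\<forall>y\<in>Y. g y = 0) \<longrightarrow> g t = 0)"

lemma determinesD: "determines Y t G \<Longrightarrow> g \<in> G \<Longrightarrow> (\<And>y. y \<in> Y \<Longrightarrow> g y = 0) \<Longrightarrow> g t = 0"
  by (auto simp: determines_def)

text \<open>A place at \<open>t\<close>: the values on \<open>Y\<close> of the functions in \<open>G\<close> form a ring, on which evaluation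
  at \<open>t\<close> is a well-defined homomorphism that cannot be extended further.\<close>

locale place =
  fixes Y :: "'x set" and t :: 'x and G :: "('x \<Rightarrow> 'a::alg_closed_field) set"
  assumes t_notin: "t \<notin> Y"
    and ring: "function_ring G"
    and det: "determines Y t G"
    and maximal: "\<And>G'. function_ring G' \<Longrightarrow> determines Y t G' \<Longrightarrow> G \<subseteq> G' \<Longrightarrow> G' = G"

lemma place_exists:
  fixes P :: "('x \<Rightarrow> 'a::alg_closed_field) set"
  assumes "t \<notin> Y" "function_ring P" "determines Y t P"
  shows "\<exists>G. P \<subseteq> G \<and> place Y t G"
proof -
  let ?A = "{G. P \<subseteq> G \<and> function_ring G \<and> determines Y t G}"
  have "\<exists>M\<in>?A. \<forall>X\<in>?A. M \<subseteq> X \<longrightarrow> X = M"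
  proof (rule subset_Zorn_nonempty)
    show "?A \<noteq> {}" using assms by auto
    fix C assume C: "C \<noteq> {}" "subset.chain ?A C"
    have sub: "C \<subseteq> ?A" using C by (simp add: subset_chain_def)
    obtain G0 where G0: "G0 \<in> C" using C by auto
    have two: "\<exists>G\<in>C. f \<in> G \<and> g \<in> G" if fg: "f \<in> \<Union>C" "g \<in> \<Union>C" for f g
    proof -
      obtain F1 F2 where F: "F1 \<in> C" "f \<in> F1" "F2 \<in> C" "g \<in> F2" using fg by auto
      then have "F1 \<subseteq> F2 \<or> F2 \<subseteq> F1" using C(2) by (auto simp: subset_chain_def)
      then show ?thesis using F by blast
    qed
    have "function_ring (\<Union>C)"
      unfolding function_ring_def
    proof (intro conjI allI ballI)
      fix c show "(\<lambda>_. c) \<in> \<Union>C" using G0 sub function_ring_const[of G0 c] by blast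
    next
      fix f g assume "f \<in> \<Union>C" "g \<in> \<Union>C"
      then obtain G where G: "G \<in> C" "f \<in> G" "g \<in> G" using two by blast
      then have "function_ring G" using sub by auto
      then show "(\<lambda>x. f x + g x) \<in> \<Union>C" "(\<lambda>x. f x * g x) \<in> \<Union>C"
        using G function_ring_add function_ring_mult by blast+
    qed
    moreover have "determines Y t (\<Union>C)" using sub by (auto simp: determines_def)
    moreover have "P \<subseteq> \<Union>C" using G0 sub by auto
    ultimately show "\<Union>C \<in> ?A" by simp
  qed
  then obtain M where "M \<in> ?A" "\<forall>X\<in>?A. M \<subseteq> X \<longrightarrow> X = M" by blast
  then show ?thesis
    using assms(1) by (intro exI[of _ M]) (auto simp: place_def)
qed

context place
begin

definition defined :: "('x \<Rightarrow> 'a) \<Rightarrow> bool" where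
  "defined h \<longleftrightarrow> (\<exists>g\<in>G. \<forall>y\<in>Y. g y = h y)"

text \<open>The polynomials over \<open>G\<close> that annihilate \<open>h\<close> on
  \<open>Y\<close> have as residues at \<open>t\<close> an ideal \<open>J\<close> of F[X]. If 1 is
  in \<open>J\<close>, this is the relation. Otherwise the generator of \<open>J\<close> is zero or
  nonconstant, so \<open>J\<close> has a zero \<open>c\<close>; assigning the value \<open>c\<close>
  to \<open>h\<close> at \<open>t\<close> extends the place to G[h], and by maximality
  \<open>h\<close> was already defined.\<close>

lemma defined_or_relation:
  "defined h \<or> (\<exists>f\<in>poly_ring G. (\<forall>y\<in>Y. poly (f y) (h y) = 0) \<and> f t = 1)"
proof (cases "\<exists>f\<in>poly_ring G. (\<forall>y\<in>Y. poly (f y) (h y) = 0) \<and> f t = 1")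
  case False
  define J where "J = {f t | f. f \<in> poly_ring G \<and> (\<forall>y\<in>Y. poly (f y) (h y) = 0)}"
  have J_mult: "p * q \<in> J" if q: "q \<in> J" for p q
  proof -
    obtain f where f: "f \<in> poly_ring G" "\<forall>y\<in>Y. poly (f y) (h y) = 0" "q = f t"
      using q by (auto simp: J_def)
    have "(\<lambda>x. (\<lambda>_. p) x * f x) \<in> poly_ring G"
      using f(1) ring by (intro poly_ring_mult poly_ring_const)
    then show ?thesis unfolding J_def using f(2,3) by force
  qed
  have J_diff: "p - q \<in> J" if pq: "p \<in> J" "q \<in> J" for p q
  proof -
    obtain f g where f: "f \<in> poly_ring G" "\<forall>y\<in>Y. poly (f y) (h y) = 0" "p = f t"
      and g: "g \<in> poly_ring G" "\<forall>y\<in>Y. poly (g y) (h y) = 0" "q = g t"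
      using pq by (auto simp: J_def)
    have "(\<lambda>x. f x - g x) \<in> poly_ring G"
      using f(1) g(1) ring by (intro poly_ring_diff)
    then show ?thesis unfolding J_def using f(2,3) g(2,3) by force
  qed
  have J_one: "1 \<notin> J" using False by (auto simp: J_def)
  have "\<exists>c. \<forall>p\<in>J. poly p c = 0"
  proof (cases "J \<subseteq> {0}")
    case True
    then have "\<forall>p\<in>J. poly p 0 = 0" by auto
    then show ?thesis by blast
  next
    case False
    then obtain g where g: "g \<in> J" "g \<noteq> 0"
      and gmin: "\<And>p. p \<in> J \<Longrightarrow> p \<noteq> 0 \<Longrightarrow> degree g \<le> degree p"
      using exists_least_iff[of "\<lambda>n. \<exists>p\<in>J. p \<noteq> 0 \<and> degree p = n"]
      by (metis insertCI linorder_not_le subsetI)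
    have dvd: "g dvd p" if "p \<in> J" for p
    proof -
      have "p mod g \<in> J"
        using J_diff[OF that J_mult[OF g(1), of "p div g"]] by (simp add: minus_div_mult_eq_mod)
      then have "p mod g = 0"
        using gmin[of "p mod g"] degree_mod_less'[OF g(2), of p] by fastforce
      then show ?thesis by (simp add: dvd_eq_mod_eq_0)
    qed
    have "degree g > 0"
    proof (rule ccontr)
      assume "\<not> degree g > 0"
      then obtain c where c: "g = [:c:]" using degree_eq_zeroE[of g] by auto
      then have "[:inverse c:] * g = 1" using g(2) by (simp add: one_pCons)
      then show False using J_mult[OF g(1), of "[:inverse c:]"] J_one by simp
    qed
    then obtain c where "poly g c = 0" using alg_closed_imp_poly_has_root by blast
    then show ?thesis using dvd by (metis dvdE mult_zero_left poly_mult)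
  qed
  then obtain c where c: "\<And>p. p \<in> J \<Longrightarrow> poly p c = 0" by blast
  \<comment> \<open>As \<open>t\<close> lies outside \<open>Y\<close>, the value of \<open>h\<close>
    there carries no information and may be reset to the residue \<open>c\<close>.\<close>
  define h' where "h' = h(t := c)"
  define G' where "G' = {\<lambda>x. poly (f x) (h' x) | f. f \<in> poly_ring G}"
  have "function_ring G'"
    unfolding function_ring_def
  proof (intro conjI allI ballI)
    fix c show "(\<lambda>_. c) \<in> G'"
      using poly_ring_const[OF ring, of "[:c:]"] unfolding G'_def by force
  next
    fix f g assume "f \<in> G'" "g \<in> G'"
    then obtain p q where p: "p \<in> poly_ring G" "f = (\<lambda>x. poly (p x) (h' x))"
      and q: "q \<in> poly_ring G" "g = (\<lambda>x. poly (q x) (h' x))"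
      unfolding G'_def by auto
    show "(\<lambda>x. f x + g x) \<in> G'"
      unfolding G'_def using p q poly_ring_add[OF ring p(1) q(1)] by force
    show "(\<lambda>x. f x * g x) \<in> G'"
      unfolding G'_def using p q poly_ring_mult[OF ring p(1) q(1)] by force
  qed
  moreover have "determines Y t G'"
    unfolding determines_def
  proof (intro ballI impI)
    fix g assume g: "g \<in> G'" "\<forall>y\<in>Y. g y = 0"
    then obtain p where p: "p \<in> poly_ring G" "g = (\<lambda>x. poly (p x) (h' x))"
      unfolding G'_def by auto
    have "\<forall>y\<in>Y. poly (p y) (h y) = 0"
      using g(2) p(2) t_notin unfolding h'_def by (metis fun_upd_other)
    then have "p t \<in> J" unfolding J_def using p(1) by auto
    then show "g t = 0" using c p(2) by (simp add: h'_def)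
  qed
  moreover have "G \<subseteq> G'"
  proof
    fix g assume "g \<in> G"
    then show "g \<in> G'" using poly_ring_scalar[OF ring] unfolding G'_def by force
  qed
  ultimately have "G' = G" by (rule maximal)
  moreover have "h' \<in> G'"
    unfolding G'_def using poly_ring_const[OF ring, of "[:0,1:]"] by force
  ultimately have "h' \<in> G" by simp
  then show ?thesis
    unfolding defined_def using t_notin by (intro disjI1 bexI[of _ h']) (auto simp: h'_def)
qed blast

text \<open>For a relation \<open>f\<close>, the product f(0) * f(1) would vanish on
  \<open>Y\<close>, where \<open>e\<close> is 0 or 1, but would be 1 at \<open>t\<close>.\<close>

lemma defined_idempotent:
  assumes "\<And>y. y \<in> Y \<Longrightarrow> e y = 0 \<or> e y = 1" shows "defined e"
proof (rule ccontr)
  assume "\<not> defined e"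
  then obtain f where f: "f \<in> poly_ring G" "\<forall>y\<in>Y. poly (f y) (e y) = 0" "f t = 1"
    using defined_or_relation by blast
  let ?g = "\<lambda>x. poly (f x) 0 * poly (f x) 1"
  have "?g \<in> G"
    using function_ring_mult[OF ring poly_ring_eval[OF ring f(1)] poly_ring_eval[OF ring f(1)],
        OF function_ring_const[OF ring] function_ring_const[OF ring]] .
  moreover have "?g y = 0" if "y \<in> Y" for y using f(2) that assms[OF that] by auto
  ultimately have "?g t = 0" by (rule determinesD[OF det])
  then show False using f(3) by simp
qed

text \<open>The supports with this property form an ultrafilter on \<open>Y\<close>.\<close>

definition large :: "('x \<Rightarrow> 'a) \<Rightarrow> bool" where
  "large h \<longleftrightarrow> (\<exists>e\<in>G. (\<forall>y\<in>Y. e y = of_bool (h y \<noteq> 0)) \<and> e t = 1)"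

lemma small_support:
  assumes "\<not> large h" obtains e where "e \<in> G" "\<And>y. y \<in> Y \<Longrightarrow> e y = of_bool (h y \<noteq> 0)" "e t = 0"
proof -
  have "defined (\<lambda>y. of_bool (h y \<noteq> 0))" by (rule defined_idempotent) auto
  then obtain e where e: "e \<in> G" "\<And>y. y \<in> Y \<Longrightarrow> e y = of_bool (h y \<noteq> 0)"
    by (auto simp: defined_def)
  have "(\<lambda>x. e x * e x - e x) \<in> G"
    using e(1) ring by (intro function_ring_diff function_ring_mult)
  then have "e t * e t - e t = 0" by (rule determinesD[OF det]) (simp add: e(2))
  then have "e t = 0 \<or> e t = 1" by auto
  then show ?thesis using assms e that unfolding large_def by blast
qed

text \<open>The place does not see the support of \<open>h\<close>. For a relation \<open>f\<close>,
  the function \<open>1 - e\<close> times the constant term of \<open>f\<close> vanishes on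
  \<open>Y\<close>: the first factor does where \<open>h\<close> is nonzero, the second where
  \<open>h\<close> is zero. At \<open>t\<close> it would be 1.\<close>

lemma defined_if_small:
  assumes e: "e \<in> G" "e t = 0" and h: "\<And>y. y \<in> Y \<Longrightarrow> h y \<noteq> 0 \<Longrightarrow> e y = 1"
  shows "defined h"
proof (rule ccontr)
  assume "\<not> defined h"
  then obtain f where f: "f \<in> poly_ring G" "\<forall>y\<in>Y. poly (f y) (h y) = 0" "f t = 1"
    using defined_or_relation by blast
  let ?g = "\<lambda>x. (1 - e x) * coeff (f x) 0"
  have "?g \<in> G"
    using e(1) f(1) ring
    by (intro function_ring_mult function_ring_diff function_ring_const poly_ring_coeff)
  moreover have "?g y = 0" if "y \<in> Y" for y
    using f(2) that h[OF that] by (cases "h y = 0") (auto simp: poly_0_coeff_0)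
  ultimately have "?g t = 0" by (rule determinesD[OF det])
  then show False using f(3) e(2) by simp
qed

lemma defined_add:
  assumes "defined f" "defined g" shows "defined (\<lambda>x. f x + g x)"
proof -
  obtain f' g' where "f' \<in> G" "g' \<in> G" "\<forall>y\<in>Y. f' y = f y" "\<forall>y\<in>Y. g' y = g y"
    using assms by (auto simp: defined_def)
  then show ?thesis
    unfolding defined_def by (intro bexI[OF _ function_ring_add[OF ring, of f' g']]) auto
qed

lemma defined_mult:
  assumes "defined f" "defined g" shows "defined (\<lambda>x. f x * g x)"
proof -
  obtain f' g' where "f' \<in> G" "g' \<in> G" "\<forall>y\<in>Y. f' y = f y" "\<forall>y\<in>Y. g' y = g y"
    using assms by (auto simp: defined_def)
  then show ?thesis
    unfolding defined_def by (intro bexI[OF _ function_ring_mult[OF ring, of f' g']]) auto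
qed

section \<open>The valuation property of a place and projective limits\<close>

definition relation :: "nat \<Rightarrow> ('x \<Rightarrow> 'a) \<Rightarrow> bool" where
  "relation n h \<longleftrightarrow> (\<exists>f\<in>poly_ring G. (\<forall>y\<in>Y. poly (f y) (h y) = 0) \<and> f t = 1 \<and> (\<forall>x. degree (f x) \<le> n))"

lemma no_relation_0: "\<not> relation 0 h"
proof
  assume "relation 0 h"
  then obtain f where f: "f \<in> poly_ring G" "\<forall>y\<in>Y. poly (f y) (h y) = 0" "f t = 1"
    "\<And>x. degree (f x) = 0" unfolding relation_def by auto
  have "coeff (f y) 0 = 0" if "y \<in> Y" for y
  proof -
    obtain c where "f y = [:c:]" using f(4) degree_eq_zeroE by blast
    then show ?thesis using f(2) that by auto
  qed
  then have "coeff (f t) 0 = 0"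
    using determinesD[OF det poly_ring_coeff[OF f(1), of 0]] by simp
  then show False using f(3) by simp
qed

text \<open>Chevalley's argument: the reversed relation for \<open>1 / h\<close> has leading coefficient \<open>1\<close> at \<open>t\<close>,
  so one step of pseudo-division lowers the degree of the relation for \<open>h\<close>.\<close>

lemma relation_decrease:
  assumes A: "relation (Suc r) h" and B: "relation s (\<lambda>x. inverse (h x))" and "s \<le> Suc r"
  shows "relation r h"
proof -
  obtain f where f: "f \<in> poly_ring G" "\<forall>y\<in>Y. poly (f y) (h y) = 0" "f t = 1"
    "\<And>x. degree (f x) \<le> Suc r" using A unfolding relation_def by auto
  obtain k where k: "k \<in> poly_ring G" "\<forall>y\<in>Y. poly (k y) (inverse (h y)) = 0" "k t = 1"
    "\<And>x. degree (k x) \<le> s" using B unfolding relation_def by auto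
  \<comment> \<open>Otherwise \<open>h\<close> is zero off a set invisible to the place, where the
    constant term of \<open>f\<close> must vanish, against \<open>f t = 1\<close>.\<close>
  have "large h"
  proof (rule ccontr)
    assume "\<not> large h"
    then obtain e where e: "e \<in> G" "\<And>y. y \<in> Y \<Longrightarrow> e y = of_bool (h y \<noteq> 0)" "e t = 0"
      by (rule small_support) blast
    let ?g = "\<lambda>x. (1 - e x) * coeff (f x) 0"
    have "?g \<in> G"
      using e(1) f(1) ring
      by (intro function_ring_mult function_ring_diff function_ring_const poly_ring_coeff)
    moreover have "?g y = 0" if "y \<in> Y" for y
      using f(2) that e(2)[OF that] by (cases "h y = 0") (auto simp: poly_0_coeff_0)
    ultimately have "?g t = 0" by (rule determinesD[OF det])
    then show False using f(3) e(3) by simp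
  qed
  then obtain e where e: "e \<in> G" "\<And>y. y \<in> Y \<Longrightarrow> e y = of_bool (h y \<noteq> 0)" "e t = 1"
    unfolding large_def by auto
  \<comment> \<open>\<open>k\<close> reversed with respect to the bound \<open>s\<close>. The factor
    \<open>e\<close> discards the points with \<open>h y = 0\<close>, where
    \<open>inverse (h y)\<close> is 0 by convention and the reversed polynomial need not vanish at
    \<open>h y\<close>; since \<open>e t = 1\<close>, the residue is unaffected.\<close>
  define b where "b x = (\<Sum>i\<le>s. monom (e x * coeff (k x) i) (s - i))" for x
  have coeff_b: "coeff (b x) j = (if j \<le> s then e x * coeff (k x) (s - j) else 0)" for x j
  proof -
    have "coeff (b x) j = (\<Sum>i\<le>s. if i = s - j \<and> j \<le> s then e x * coeff (k x) i else 0)"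
      unfolding b_def coeff_sum coeff_monom by (intro sum.cong) auto
    then show ?thesis by (auto simp: sum.delta)
  qed
  have deg_b: "degree (b x) \<le> s" for x by (intro degree_le) (simp add: coeff_b)
  have b_mem: "b \<in> poly_ring G"
  proof -
    have "(\<lambda>x. coeff (b x) j) \<in> G" for j
    proof (cases "j \<le> s")
      case True
      then show ?thesis
        using function_ring_mult[OF ring e(1) poly_ring_coeff[OF k(1)]] by (simp add: coeff_b)
    qed (use function_ring_const[OF ring] in \<open>simp add: coeff_b\<close>)
    then show ?thesis using deg_b by (auto simp: poly_ring_def)
  qed
  have b_root: "poly (b y) (h y) = 0" if y: "y \<in> Y" for y
  proof (cases "h y = 0")
    case True
    then show ?thesis using e(2)[OF y] by (simp add: b_def poly_sum)
  next
    case False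
    have "poly (b y) (h y) = (\<Sum>i\<le>s. coeff (k y) i * h y ^ (s - i))"
      using e(2)[OF y] False by (simp add: b_def poly_sum poly_monom)
    also have "\<dots> = h y ^ s * (\<Sum>i\<le>s. coeff (k y) i * inverse (h y) ^ i)"
      unfolding sum_distrib_left
      by (intro sum.cong refl) (use False in \<open>auto simp: power_diff field_simps\<close>)
    also have "(\<Sum>i\<le>s. coeff (k y) i * inverse (h y) ^ i) = poly (k y) (inverse (h y))"
      unfolding poly_altdef using k(4)[of y]
      by (intro sum.mono_neutral_right) (auto simp: coeff_eq_0)
    also have "\<dots> = 0" using k(2) y by simp
    finally show ?thesis by simp
  qed
  \<comment> \<open>Cross-multiplication cancels the terms of degree \<open>Suc r\<close> without a
    division. At \<open>t\<close> the multiplier of \<open>f\<close> is 1, and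
    \<open>coeff (f t) (Suc r) = 0\<close> because \<open>f t = 1\<close>; hence
    \<open>w t = 1\<close>.\<close>
  define w where "w x = [:coeff (b x) s:] * f x - [:coeff (f x) (Suc r):] * (monom 1 (Suc r - s) * b x)" for x
  have "w \<in> poly_ring G"
    unfolding w_def[abs_def]
    using ring f(1) b_mem
    by (intro poly_ring_diff poly_ring_mult poly_ring_scalar poly_ring_coeff poly_ring_const)
  moreover have "\<forall>y\<in>Y. poly (w y) (h y) = 0" using f(2) b_root by (simp add: w_def)
  moreover have "w t = 1"
    using f(3) k(3) e(3) by (simp add: w_def coeff_b one_pCons)
  moreover have "degree (w x) \<le> r" for x
  proof (rule degree_le, intro allI impI)
    fix i assume "i > r"
    then consider "i = Suc r" | "i > Suc r" by linarith
    then show "coeff (w x) i = 0"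
    proof cases
      case 1
      then show ?thesis using assms(3) by (simp add: w_def coeff_monom_mult)
    next
      case 2
      then have "coeff (f x) i = 0" "coeff (b x) (i - (Suc r - s)) = 0"
        using f(4)[of x] deg_b[of x] assms(3) by (auto intro!: coeff_eq_0 simp del: One_nat_def)
      then show ?thesis by (simp add: w_def coeff_monom_mult)
    qed
  qed
  ultimately show ?thesis unfolding relation_def by blast
qed

text \<open>This is the valuation-ring property. Were both undefined, both would satisfy relations,
  and \<open>relation_decrease\<close>, applied to the one of larger degree, would descend to a
  relation of degree 0, contradicting \<open>no_relation_0\<close>.\<close>

lemma defined_or_inverse: "defined h \<or> defined (\<lambda>x. inverse (h x))"
proof (rule ccontr)
  assume neg: "\<not> (defined h \<or> defined (\<lambda>x. inverse (h x)))"
  have ex: "\<exists>n. relation n k" if "\<not> defined k" for k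
    using defined_or_relation[of k] that unfolding relation_def poly_ring_def by blast
  obtain r s where "relation r h" "relation s (\<lambda>x. inverse (h x))"
    using ex neg by blast
  then show False
  proof (induction "r + s" arbitrary: r s rule: less_induct)
    case less
    have inv: "(\<lambda>x. inverse (inverse (h x))) = h" by simp
    have "r \<noteq> 0" "s \<noteq> 0" using less.prems no_relation_0 by (metis)+
    then obtain r' s' where rs: "r = Suc r'" "s = Suc s'" by (metis not0_implies_Suc)
    show False
    proof (cases "s \<le> r")
      case True
      then have "relation r' h" using relation_decrease[of r' h s] less.prems rs by simp
      then show False using less.hyps[of r' s] less.prems rs by simp
    next
      case False
      then have "relation s' (\<lambda>x. inverse (h x))"
        using relation_decrease[of s' "\<lambda>x. inverse (h x)" r] less.prems rs inv by simp
      then show False using less.hyps[of r s'] less.prems rs by simp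
    qed
  qed
qed

text \<open>The valuative form of properness of projective space: some coordinate \<open>j\<close>
  divides all the others at the place. Where \<open>h j y = 0\<close> all the quotients are 0 by
  convention; these points are invisible because \<open>h j\<close> is large, which also gives
  \<open>g j t = 1\<close>.\<close>

lemma projective_limit:
  fixes h :: "'i \<Rightarrow> 'x \<Rightarrow> 'a"
  assumes fin: "finite K" and nz: "\<And>y. y \<in> Y \<Longrightarrow> \<exists>i\<in>K. h i y \<noteq> 0"
  shows "\<exists>j\<in>K. \<exists>g. g j t = 1 \<and> (\<forall>i\<in>K. g i \<in> G \<and> (\<forall>y\<in>Y. g i y = h i y / h j y))"
proof -
  have "(\<forall>i\<in>K. \<not> large (h i)) \<or> (\<exists>j\<in>K. large (h j) \<and> (\<forall>i\<in>K. defined (\<lambda>x. h i x / h j x)))"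
    using fin
  proof (induction K)
    case (insert k K)
    have self: "defined (\<lambda>x. h k x / h k x)" by (rule defined_idempotent) auto
    have small: "defined (\<lambda>x. h i x / h j x)" if i: "\<not> large (h i)" for i j
    proof -
      obtain e where e: "e \<in> G" "\<And>y. y \<in> Y \<Longrightarrow> e y = of_bool (h i y \<noteq> 0)" "e t = 0"
        using small_support[OF i] by blast
      then show ?thesis by (intro defined_if_small[of e]) auto
    qed
    show ?case
    proof (cases "large (h k)")
      case k: True
      show ?thesis
      proof (cases "\<forall>i\<in>K. \<not> large (h i)")
        case True
        then show ?thesis using k self small by blast
      next
        case False
        then obtain j where j: "j \<in> K" "large (h j)" "\<And>i. i \<in> K \<Longrightarrow> defined (\<lambda>x. h i x / h j x)"
          using insert.IH by blast
        have "defined (\<lambda>x. h k x / h j x) \<or> defined (\<lambda>x. h j x / h k x)"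
          using defined_or_inverse[of "\<lambda>x. h k x / h j x"] by simp
        then show ?thesis
        proof
          assume "defined (\<lambda>x. h k x / h j x)"
          then show ?thesis using j by blast
        next
          assume jk: "defined (\<lambda>x. h j x / h k x)"
          obtain e where e: "e \<in> G" "\<And>y. y \<in> Y \<Longrightarrow> e y = of_bool (h j y \<noteq> 0)" "e t = 1"
            using j(2) unfolding large_def by auto
          have "defined (\<lambda>x. h i x / h k x)" if i: "i \<in> K" for i
          proof -
            \<comment> \<open>Transitivity of divisibility holds only where \<open>h j\<close> is
              nonzero. The correction term lives on the zeros of \<open>h j\<close>, a set invisible
              to the place, and is defined for that reason.\<close>
            have "(\<lambda>x. 1 - e x) \<in> G" using e(1) ring by (intro function_ring_diff function_ring_const)
            then have "defined (\<lambda>x. of_bool (h j x = 0) * (h i x / h k x))"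
              by (rule defined_if_small) (use e in \<open>auto split: if_splits\<close>)
            then have "defined (\<lambda>x. (h i x / h j x) * (h j x / h k x) + of_bool (h j x = 0) * (h i x / h k x))"
              by (rule defined_add[OF defined_mult[OF j(3)[OF i] jk]])
            moreover have "(\<lambda>x. (h i x / h j x) * (h j x / h k x) + of_bool (h j x = 0) * (h i x / h k x))
                = (\<lambda>x. h i x / h k x)" by (intro ext) auto
            ultimately show ?thesis by simp
          qed
          then show ?thesis using k self by blast
        qed
      qed
    next
      case False
      then show ?thesis using insert.IH small by (metis insert_iff)
    qed
  qed simp
  moreover have "\<not> (\<forall>i\<in>K. \<not> large (h i))"
  proof
    assume *: "\<forall>i\<in>K. \<not> large (h i)"
    have "\<forall>i\<in>K. \<exists>e\<in>G. (\<forall>y\<in>Y. e y = of_bool (h i y \<noteq> 0)) \<and> e t = 0"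
      using * small_support by metis
    then obtain e where e: "\<And>i. i \<in> K \<Longrightarrow> e i \<in> G"
      "\<And>i y. i \<in> K \<Longrightarrow> y \<in> Y \<Longrightarrow> e i y = of_bool (h i y \<noteq> 0)" "\<And>i. i \<in> K \<Longrightarrow> e i t = 0"
      by metis
    let ?g = "\<lambda>x. \<Prod>i\<in>K. 1 - e i x"
    have "?g \<in> G"
      using e(1) ring by (intro function_ring_prod function_ring_diff function_ring_const)
    moreover have "?g y = 0" if y: "y \<in> Y" for y
      using nz[OF y] e(2)[OF _ y] fin by (intro prod_zero) auto
    ultimately have "?g t = 0" by (rule determinesD[OF det])
    then show False using e(3) by simp
  qed
  ultimately obtain j where j: "j \<in> K" "large (h j)" "\<And>i. i \<in> K \<Longrightarrow> defined (\<lambda>x. h i x / h j x)"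
    by blast
  then obtain g where g: "\<And>i. i \<in> K \<Longrightarrow> g i \<in> G" "\<And>i y. i \<in> K \<Longrightarrow> y \<in> Y \<Longrightarrow> g i y = h i y / h j y"
    unfolding defined_def by metis
  obtain e where e: "e \<in> G" "\<And>y. y \<in> Y \<Longrightarrow> e y = of_bool (h j y \<noteq> 0)" "e t = 1"
    using j(2) unfolding large_def by auto
  have "(\<lambda>x. g j x - e x) \<in> G" using ring g(1)[OF j(1)] e(1) by (rule function_ring_diff)
  then have "g j t - e t = 0" by (rule determinesD[OF det]) (use g(2)[OF j(1)] e(2) in auto)
  then show ?thesis using j(1) g e(3) by (intro bexI[of _ j] exI[of _ g]) auto
qed

end

section \<open>Separating families on hypercubes\<close>

lemma span_UNIV_if_no_annihilator:
  fixes S :: "('a::field ^ 'n) set"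
  assumes "\<And>\<psi>. (\<And>v. v \<in> S \<Longrightarrow> (\<Sum>i\<in>UNIV. v $ i * \<psi> i) = 0) \<Longrightarrow> \<psi> = (\<lambda>_. 0)"
  shows "vec.span S = UNIV"
proof (rule ccontr)
  assume "vec.span S \<noteq> UNIV"
  then obtain v where v: "v \<notin> vec.span S" by auto
  obtain B where B: "B \<subseteq> S" "vec.independent B" "S \<subseteq> vec.span B"
    using vec.maximal_independent_subset by blast
  then have vB: "v \<notin> vec.span B" using v vec.span_mono by blast
  then have "vec.independent (insert v B)" 
    using B(2) vec.independent_insert[of v B] by (auto dest: vec.span_base)
  then obtain f :: "'a ^ 'n \<Rightarrow> 'a ^ 'n" where f: "Vector_Spaces.linear (*s) (*s) f"
    "\<forall>x\<in>insert v B. f x = (if x = v then v else 0)"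
    using vec.linear_independent_extend[of "insert v B" "\<lambda>x. if x = v then v else 0"] by blast
  have fB: "f b = 0" if "b \<in> B" for b using f(2) that vB vec.span_base by force
  have fS: "f b = 0" if "b \<in> S" for b
    using vec.linear_eq_0_on_span[OF f(1), of B b] fB B(3) that by auto
  have "v \<noteq> 0" using vB vec.span_zero[of B] by metis
  then obtain i where i: "v $ i \<noteq> 0" by (auto simp: vec_eq_iff)
  have fx: "f x $ i = (\<Sum>j\<in>UNIV. x $ j * matrix f $ i $ j)" for x
    by (subst matrix_works[OF f(1), symmetric]) (simp add: matrix_vector_mult_def mult.commute)
  have "(\<lambda>j. matrix f $ i $ j) = (\<lambda>_. 0)"
    by (rule assms) (use fx fS in \<open>metis zero_index\<close>)
  then have "f v $ i = 0" unfolding fx by (simp add: fun_eq_iff)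
  then show False using i f(2) by simp
qed

lemma span_image_explicit:
  fixes v :: "'e \<Rightarrow> 'a::field ^ 'n"
  assumes "x \<in> vec.span (v ` E)"
  shows "\<exists>F r. finite F \<and> F \<subseteq> E \<and> x = (\<Sum>e\<in>F. r e *s v e)"
proof -
  obtain T r where T: "finite T" "T \<subseteq> v ` E" "x = (\<Sum>a\<in>T. r a *s a)"
    using assms unfolding vec.span_explicit by blast
  obtain F where F: "F \<subseteq> E" "inj_on v F" "T = v ` F"
    using T(2) unfolding subset_image_inj by blast
  have "finite F" using F(2,3) T(1) finite_imageD by blast
  then show ?thesis
    using F T(3) by (intro exI[of _ F] exI[of _ "\<lambda>e. r (v e)"]) (simp add: sum.reindex)
qed

text \<open>A left inverse of the system at \<open>s = 0\<close> turns the system at \<open>s\<close> into \<open>1 + s X\<close>.\<close>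

lemma finite_singular_parameters:
  fixes E :: "(('z::finite \<Rightarrow> 'a::field) \<times> ('z \<Rightarrow> 'a)) set"
  assumes inj: "\<And>\<psi>. (\<And>e. e \<in> E \<Longrightarrow> (\<Sum>z\<in>UNIV. fst e z * \<psi> z) = 0) \<Longrightarrow> \<psi> = (\<lambda>_. 0)"
  shows "finite {s. \<exists>\<psi>. \<psi> \<noteq> (\<lambda>_. 0) \<and> (\<forall>e\<in>E. (\<Sum>z\<in>UNIV. (fst e z + s * snd e z) * \<psi> z) = 0)}"
proof -
  have "vec.span ((\<lambda>e. \<chi> z. fst e z) ` E) = UNIV"
    by (rule span_UNIV_if_no_annihilator, rule inj) force
  then have "\<forall>z. \<exists>F r. finite F \<and> F \<subseteq> E \<and> axis z 1 = (\<Sum>e\<in>F. r e *s (\<chi> z. fst e z))"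
    by (intro allI span_image_explicit) simp
  then obtain F r where F: "\<And>z. finite (F z)" "\<And>z. F z \<subseteq> E"
    "\<And>z. axis z 1 = (\<Sum>e\<in>F z. r z e *s (\<chi> z. fst e z))"
    unfolding choice_iff by blast
  define X :: "'a ^ 'z ^ 'z" where "X = (\<chi> z z'. \<Sum>e\<in>F z. r z e * snd e z')"
  have delta: "(\<Sum>e\<in>F z. r z e * fst e z') = (if z' = z then 1 else 0)" for z z'
  proof -
    have "(\<Sum>e\<in>F z. r z e * fst e z') = axis z 1 $ z'" unfolding F(3) by simp
    then show ?thesis by (simp add: axis_def)
  qed
  define M where "M s = (\<chi> z z'. (if z' = z then 1 else 0) + s * X $ z $ z')" for s
  define p where "p = (\<Sum>\<pi>\<in>{\<pi>. \<pi> permutes (UNIV :: 'z set)}. of_int (sign \<pi>) *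
      (\<Prod>i\<in>UNIV. [:(if \<pi> i = i then 1 else 0), X $ i $ \<pi> i:]))"
  have p: "poly p s = det (M s)" for s
    by (simp add: p_def det_def M_def poly_sum poly_prod mult.commute)
  have "M 0 = mat 1" by (auto simp: M_def mat_def vec_eq_iff)
  then have "p \<noteq> 0" using p[of 0] by auto
  have "det (M s) = 0"
    if \<psi>: "\<psi> \<noteq> (\<lambda>_. 0)" "\<forall>e\<in>E. (\<Sum>z\<in>UNIV. (fst e z + s * snd e z) * \<psi> z) = 0" for s \<psi>
  proof -
    have "(\<Sum>z'\<in>UNIV. M s $ z $ z' * \<psi> z') = 0" for z
    proof -
      have "M s $ z $ z' = (\<Sum>e\<in>F z. r z e * (fst e z' + s * snd e z'))" for z'
        using delta[of z z']
        by (simp add: M_def X_def distrib_left sum.distrib sum_distrib_left mult_ac)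
      then have "(\<Sum>z'\<in>UNIV. M s $ z $ z' * \<psi> z')
          = (\<Sum>z'\<in>UNIV. \<Sum>e\<in>F z. r z e * ((fst e z' + s * snd e z') * \<psi> z'))"
        by (simp add: sum_distrib_right mult.assoc)
      also have "\<dots> = (\<Sum>e\<in>F z. r z e * (\<Sum>z'\<in>UNIV. (fst e z' + s * snd e z') * \<psi> z'))"
        by (subst sum.swap) (simp add: sum_distrib_left)
      also have "\<dots> = 0" using \<psi>(2) F(2)[of z] by (intro sum.neutral) auto
      finally show ?thesis .
    qed
    then have "M s *v (\<chi> z. \<psi> z) = 0" by (simp add: matrix_vector_mult_def vec_eq_iff)
    moreover have "(\<chi> z. \<psi> z) \<noteq> 0" using \<psi>(1) by (auto simp: vec_eq_iff)
    ultimately have "\<not> invertible (M s)"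
      using matrix_left_invertible_ker[of "M s"] by (auto simp: invertible_def)
    then show ?thesis using invertible_det_nz by blast
  qed
  then have "{s. \<exists>\<psi>. \<psi> \<noteq> (\<lambda>_. 0) \<and> (\<forall>e\<in>E. (\<Sum>z\<in>UNIV. (fst e z + s * snd e z) * \<psi> z) = 0)}
      \<subseteq> {s. poly p s = 0}"
    by (auto simp: p)
  then show ?thesis using poly_roots_finite[OF \<open>p \<noteq> 0\<close>] finite_subset by blast
qed

text \<open>Bits outside \<open>D\<close> are fixed to False, so that the cubes of all subsets
  \<open>D\<close> live in one type during the induction.\<close>

definition cube :: "'d set \<Rightarrow> ('d \<Rightarrow> bool) set" where
  "cube D = {z. \<forall>i. z i \<longrightarrow> i \<in> D}"

text \<open>Elements of \<open>(F\<^sup>2)\<^bsup>\<otimes> D\<^esup> \<otimes> F\<^sup>m\<close> are functions on \<open>cube D \<times> UNIV\<close>. A tensor \<open>\<tau>\<close> without factor in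
  position \<open>i\<close> is only read where \<open>z i = False\<close>; the sum contracts \<open>\<psi>\<close> with \<open>e\<^sub>a \<otimes> \<tau>\<close>, where the
  basis vector \<open>e\<^sub>a\<close> of \<open>F\<^sup>2\<close> sits at position \<open>i\<close>.\<close>

definition contract :: "'d set \<Rightarrow> 'd \<Rightarrow> (('d \<Rightarrow> bool) \<Rightarrow> 'm \<Rightarrow> 'a) \<Rightarrow> bool \<Rightarrow>
    (('d \<Rightarrow> bool) \<Rightarrow> 'm \<Rightarrow> 'a) \<Rightarrow> 'a::field" where
  "contract D i \<tau> a \<psi> =
     (\<Sum>z\<in>cube D. if z i = a then \<Sum>l\<in>UNIV. \<tau> (z(i := False)) l * \<psi> z l else 0)"

text \<open>Dual form of spanning: no nonzero \<psi> on the cube is orthogonal to all products of a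
  member of \<open>t i\<close> with a basis vector in position \<open>i\<close>. In this form the
  induction only has to restrict \<psi> to halves of the cube.\<close>

definition separating :: "'d set \<Rightarrow> ('d \<Rightarrow> (('d \<Rightarrow> bool) \<Rightarrow> 'm \<Rightarrow> 'a::field) set) \<Rightarrow> bool" where
  "separating D t \<longleftrightarrow> (\<forall>\<psi>. (\<forall>i\<in>D. \<forall>\<tau>\<in>t i. \<forall>a. contract D i \<tau> a \<psi> = 0) \<longrightarrow>
     (\<forall>z\<in>cube D. \<forall>l. \<psi> z l = 0))"

definition admissible :: "'d set \<Rightarrow> ('d \<Rightarrow> nat) \<Rightarrow>
    ('d \<Rightarrow> (('d \<Rightarrow> bool) \<Rightarrow> 'm \<Rightarrow> 'a::field) set) \<Rightarrow> bool" where
  "admissible D q t \<longleftrightarrow> (\<forall>i\<in>D. finite (t i) \<and> card (t i) \<le> q i) \<and> separating D t"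

lemma separating_mono:
  assumes "separating D t" "\<And>i. i \<in> D \<Longrightarrow> t i \<subseteq> t' i" shows "separating D t'"
  using assms unfolding separating_def by blast

lemma finite_nonseparating:
  fixes f h :: "nat \<Rightarrow> ('d::finite \<Rightarrow> bool) \<Rightarrow> 'm::finite \<Rightarrow> 'a::field"
  assumes "separating D (t(d := f ` {..<c}))"
  shows "finite {s. \<not> separating D (t(d := (\<lambda>k z l. f k z l + s * h k z l) ` {..<c}))}"
proof -
  define row :: "'d \<Rightarrow> (('d \<Rightarrow> bool) \<Rightarrow> 'm \<Rightarrow> 'a) \<Rightarrow> bool \<Rightarrow> ('d \<Rightarrow> bool) \<times> 'm \<Rightarrow> 'a"
    where "row i \<tau> a = (\<lambda>(z, l). if z \<in> cube D \<and> z i = a then \<tau> (z(i := False)) l else 0)"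
    for i \<tau> a
  define unit :: "('d \<Rightarrow> bool) \<times> 'm \<Rightarrow> ('d \<Rightarrow> bool) \<times> 'm \<Rightarrow> 'a"
    where "unit p = (\<lambda>p'. if p' = p then 1 else 0)" for p
  have row: "(\<Sum>p\<in>UNIV. row i \<tau> a p * \<psi> p) = contract D i \<tau> a (\<lambda>z l. \<psi> (z, l))" for i \<tau> a \<psi>
  proof -
    have "(\<Sum>p\<in>UNIV. row i \<tau> a p * \<psi> p) = (\<Sum>z\<in>UNIV. \<Sum>l\<in>UNIV. row i \<tau> a (z, l) * \<psi> (z, l))"
      by (simp add: sum.cartesian_product)
    also have "\<dots> = (\<Sum>z\<in>cube D. \<Sum>l\<in>UNIV. row i \<tau> a (z, l) * \<psi> (z, l))"
      by (intro sum.mono_neutral_right) (auto simp: row_def)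
    also have "\<dots> = contract D i \<tau> a (\<lambda>z l. \<psi> (z, l))"
      unfolding contract_def by (intro sum.cong refl) (auto simp: row_def)
    finally show ?thesis .
  qed
  have unit: "(\<Sum>p'\<in>UNIV. unit p p' * \<psi> p') = \<psi> p" for p \<psi>
    by (simp add: unit_def if_distrib[of "\<lambda>x. x * _"] cong: if_cong)
  \<comment> \<open>One linear system with rows affine in \<open>s\<close>, constant outside
    direction \<open>d\<close>. The \<open>unit\<close> rows force \<psi> to vanish off the cube, so
    that injectivity of the system is the same as separation.\<close>
  define E where "E = {(row i \<tau> a, \<lambda>_. 0) | i \<tau> a. i \<in> D - {d} \<and> \<tau> \<in> t i} \<union>
    {(row d (f k) a, row d (h k) a) | k a. d \<in> D \<and> k < c} \<union> {(unit p, \<lambda>_. 0) | p. fst p \<notin> cube D}"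
  have line: "row d (f k) a p + s * row d (h k) a p = row d (\<lambda>z l. f k z l + s * h k z l) a p" for k a p s
    by (auto simp: row_def split: prod.split)
  have E: "(\<forall>e\<in>E. (\<Sum>z\<in>UNIV. (fst e z + s * snd e z) * \<psi> z) = 0) \<longleftrightarrow>
      (\<forall>i\<in>D. \<forall>\<tau>\<in>(t(d := (\<lambda>k z l. f k z l + s * h k z l) ` {..<c})) i. \<forall>a.
         contract D i \<tau> a (\<lambda>z l. \<psi> (z, l)) = 0) \<and> (\<forall>p. fst p \<notin> cube D \<longrightarrow> \<psi> p = 0)"
    (is "?L \<longleftrightarrow> ?R1 \<and> ?R2") for s \<psi>
  proof -
    define Q where "Q e \<longleftrightarrow> (\<Sum>z\<in>UNIV. (fst e z + s * snd e z) * \<psi> z) = 0" for e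
    have "?L \<longleftrightarrow> (\<forall>e\<in>E. Q e)" by (simp add: Q_def)
    also have "\<dots> \<longleftrightarrow> (\<forall>i\<in>D - {d}. \<forall>\<tau>\<in>t i. \<forall>a. Q (row i \<tau> a, \<lambda>_. 0)) \<and>
      (d \<in> D \<longrightarrow> (\<forall>k<c. \<forall>a. Q (row d (f k) a, row d (h k) a))) \<and>
      (\<forall>p. fst p \<notin> cube D \<longrightarrow> Q (unit p, \<lambda>_. 0))"
      unfolding E_def by blast
    also have "\<dots> \<longleftrightarrow> (\<forall>i\<in>D - {d}. \<forall>\<tau>\<in>t i. \<forall>a. contract D i \<tau> a (\<lambda>z l. \<psi> (z, l)) = 0) \<and>
      (d \<in> D \<longrightarrow> (\<forall>k<c. \<forall>a. contract D d (\<lambda>z l. f k z l + s * h k z l) a (\<lambda>z l. \<psi> (z, l)) = 0)) \<and> ?R2"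
      by (simp add: Q_def line row unit)
    also have "\<dots> \<longleftrightarrow> ?R1 \<and> ?R2" by auto
    finally show ?thesis .
  qed
  have "finite {s. \<exists>\<psi>. \<psi> \<noteq> (\<lambda>_. 0) \<and> (\<forall>e\<in>E. (\<Sum>z\<in>UNIV. (fst e z + s * snd e z) * \<psi> z) = 0)}"
  proof (rule finite_singular_parameters)
    fix \<psi> assume "\<And>e. e \<in> E \<Longrightarrow> (\<Sum>z\<in>UNIV. fst e z * \<psi> z) = 0"
    then have "\<forall>e\<in>E. (\<Sum>z\<in>UNIV. (fst e z + 0 * snd e z) * \<psi> z) = 0" by simp
    then have *: "\<forall>i\<in>D. \<forall>\<tau>\<in>(t(d := f ` {..<c})) i. \<forall>a. contract D i \<tau> a (\<lambda>z l. \<psi> (z, l)) = 0"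
      "\<forall>p. fst p \<notin> cube D \<longrightarrow> \<psi> p = 0"
      unfolding E by simp_all
    then have "\<forall>z\<in>cube D. \<forall>l. \<psi> (z, l) = 0"
      using assms unfolding separating_def by blast
    then show "\<psi> = (\<lambda>_. 0)" using *(2) by (metis ext prod.collapse)
  qed
  moreover have "{s. \<not> separating D (t(d := (\<lambda>k z l. f k z l + s * h k z l) ` {..<c}))} \<subseteq>
     {s. \<exists>\<psi>. \<psi> \<noteq> (\<lambda>_. 0) \<and> (\<forall>e\<in>E. (\<Sum>z\<in>UNIV. (fst e z + s * snd e z) * \<psi> z) = 0)}"
  proof
    fix s assume "s \<in> {s. \<not> separating D (t(d := (\<lambda>k z l. f k z l + s * h k z l) ` {..<c}))}"
    then obtain \<psi> z0 l0 where \<psi>: "\<forall>i\<in>D. \<forall>\<tau>\<in>(t(d := (\<lambda>k z l. f k z l + s * h k z l) ` {..<c})) i. \<forall>a.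
         contract D i \<tau> a \<psi> = 0" "z0 \<in> cube D" "\<psi> z0 l0 \<noteq> 0"
      unfolding separating_def by blast
    define \<psi>' where "\<psi>' = (\<lambda>(z, l). if z \<in> cube D then \<psi> z l else 0)"
    have "contract D i \<tau> a (\<lambda>z l. \<psi>' (z, l)) = contract D i \<tau> a \<psi>" for i \<tau> a
      unfolding contract_def by (intro sum.cong refl) (auto simp: \<psi>'_def)
    then have "\<forall>e\<in>E. (\<Sum>z\<in>UNIV. (fst e z + s * snd e z) * \<psi>' z) = 0"
      unfolding E using \<psi>(1) by (auto simp: \<psi>'_def)
    moreover have "\<psi>' (z0, l0) \<noteq> 0" using \<psi>(2,3) by (simp add: \<psi>'_def)
    then have "\<psi>' \<noteq> (\<lambda>_. 0)" by auto
    ultimately show "s \<in> {s. \<exists>\<psi>. \<psi> \<noteq> (\<lambda>_. 0) \<and>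
      (\<forall>e\<in>E. (\<Sum>z\<in>UNIV. (fst e z + s * snd e z) * \<psi> z) = 0)}" by blast
  qed
  ultimately show ?thesis by (rule rev_finite_subset)
qed

lemma finite_subset_image_of_card_le:
  assumes "finite A" "finite B" "card A \<le> card B" shows "\<exists>f. A \<subseteq> f ` B"
proof -
  obtain g where g: "g ` A \<subseteq> B" "inj_on g A" using card_le_inj[OF assms] by blast
  have "a \<in> inv_into A g ` B" if "a \<in> A" for a
    using g that by (metis image_eqI image_subset_iff inv_into_f_f)
  then show ?thesis by blast
qed

text \<open>Both families move along the one line f + s * (f' - f): s = 0 suits the first, s = 1 the
  second, and each fails for finitely many s only. The common family is a sequence, so that the
  shorter one is an initial segment of the longer.\<close>

lemma separating_common_family:
  fixes t t' :: "'d::finite \<Rightarrow> (('d \<Rightarrow> bool) \<Rightarrow> 'm::finite \<Rightarrow> 'a::field) set"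
  assumes inf: "infinite (UNIV :: 'a set)"
    and t: "separating D t" "finite (t d)" "card (t d) \<le> c"
    and t': "separating D t'" "finite (t' d)" "card (t' d) \<le> c'"
  shows "\<exists>f. separating D (t(d := f ` {..<c})) \<and> separating D (t'(d := f ` {..<c'}))"
proof -
  obtain f where f: "t d \<subseteq> f ` {..<c}" 
    using finite_subset_image_of_card_le[of "t d" "{..<c}"] t by auto
  obtain f' where f': "t' d \<subseteq> f' ` {..<c'}" 
    using finite_subset_image_of_card_le[of "t' d" "{..<c'}"] t' by auto
  have s0: "separating D (t(d := f ` {..<c}))" "separating D (t'(d := f' ` {..<c'}))"
    by (rule separating_mono[OF t(1)], use f in auto) (rule separating_mono[OF t'(1)], use f' in auto)
  define h where "h k z l = f' k z l - f k z l" for k z l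
  define g where "g s k z l = f k z l + s * h k z l" for s k z l
  have g: "g s = (\<lambda>k z l. f k z l + s * h k z l)"
    and g': "g s = (\<lambda>k z l. f' k z l + (s - 1) * h k z l)" for s
    by (intro ext; simp add: g_def h_def algebra_simps)+
  have fin1: "finite {s. \<not> separating D (t(d := g s ` {..<c}))}"
    unfolding g by (rule finite_nonseparating[OF s0(1)])
  have "finite {s. \<not> separating D (t'(d := (\<lambda>k z l. f' k z l + s * h k z l) ` {..<c'}))}"
    (is "finite ?S") by (rule finite_nonseparating[OF s0(2)])
  then have "finite ((\<lambda>s. s + 1) ` ?S)" by simp
  moreover have "{s. \<not> separating D (t'(d := g s ` {..<c'}))} \<subseteq> (\<lambda>s. s + 1) ` ?S"
  proof
    fix s assume "s \<in> {s. \<not> separating D (t'(d := g s ` {..<c'}))}"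
    then have "s - 1 \<in> ?S" unfolding g' by simp
    then show "s \<in> (\<lambda>s. s + 1) ` ?S" by force
  qed
  ultimately have "finite {s. \<not> separating D (t'(d := g s ` {..<c'}))}" by (rule rev_finite_subset)
  then have "finite ({s. \<not> separating D (t(d := g s ` {..<c}))} \<union>
     {s. \<not> separating D (t'(d := g s ` {..<c'}))})" using fin1 by simp
  then obtain s where "s \<notin> {s. \<not> separating D (t(d := g s ` {..<c}))} \<union>
     {s. \<not> separating D (t'(d := g s ` {..<c'}))}"
    using ex_new_if_finite[OF inf] by blast
  then show ?thesis by (intro exI[of _ "g s"]) simp
qed

text \<open>\<open>separating\<close> for two directions, as a condition on arrays
  \<open>g k u b\<close>: k numbers the shared tensors, u is the bit of the old direction and b that
  of the new one. Members of \<open>A\<close> have no factor in the old direction, members of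
  \<open>B\<close> none in the new one.\<close>

definition resolving :: "nat \<Rightarrow> (nat \<Rightarrow> bool \<Rightarrow> 'a::field) set \<Rightarrow> (nat \<Rightarrow> bool \<Rightarrow> 'a) set \<Rightarrow> bool" where
  "resolving N A B \<longleftrightarrow> (\<forall>\<alpha>\<in>A \<union> B. \<forall>k\<ge>N. \<alpha> k = (\<lambda>_. 0)) \<and>
    (\<forall>g. (\<forall>\<alpha>\<in>A. \<forall>u. (\<Sum>k<N. \<Sum>b\<in>UNIV. \<alpha> k b * g k u b) = 0) \<longrightarrow>
         (\<forall>\<beta>\<in>B. \<forall>b. (\<Sum>k<N. \<Sum>u\<in>UNIV. \<beta> k u * g k u b) = 0) \<longrightarrow>
         (\<forall>k<N. \<forall>u b. g k u b = 0))"

text \<open>The case of two directions. The pair of blocks \<open>k = 0, 1\<close> absorbs odd budgets: a family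
  with three elements in one direction and a single one in the other is separating there.\<close>

lemma resolving_exists:
  assumes "N \<ge> 2" "x + y \<ge> 2 * N"
  shows "\<exists>A B :: (nat \<Rightarrow> bool \<Rightarrow> 'a::field) set.
    finite A \<and> card A \<le> x \<and> finite B \<and> card B \<le> y \<and> resolving N A B"
proof -
  define e :: "nat \<Rightarrow> bool \<Rightarrow> nat \<Rightarrow> bool \<Rightarrow> 'a"
    where "e k b = (\<lambda>k' b'. if k' = k \<and> b' = b then 1 else 0)" for k b
  show ?thesis
    using assms
  proof (induction N arbitrary: x y rule: nat_induct_at_least)
    case base
    \<comment> \<open>With \<open>A\<close> consisting of \<open>e 0 True\<close>,
      \<open>e 1 False\<close> and \<open>m\<close>, what survives is
      \<open>g 0 u False = g 1 u True\<close>. In each of the two equations given by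
      \<open>p\<close> one term is already zero, so the other is too, and this kills the
      rest.\<close>
    define m where "m = (\<lambda>k b. e 0 False k b - e 1 True k b)"
    define p where "p = (\<lambda>k b. e 0 False k b + e 1 True k b)"
    have two: "(\<Sum>k<2. \<Sum>b\<in>UNIV. f k b) = f 0 False + f 0 True + (f 1 False + f 1 True)"
      for f :: "nat \<Rightarrow> bool \<Rightarrow> 'a"
      by (simp add: numeral_2_eq_2 UNIV_bool add_ac)
    note defs = resolving_def two e_def m_def p_def less_2_cases_iff all_bool_eq
    let ?E = "[e 0 False, e 0 True, e 1 False, e 1 True]"
    have r: "resolving 2 (set ?E) (set [])" "resolving 2 (set []) (set ?E)"
      "resolving 2 (set [e 0 False, e 0 True]) (set [e 1 False, e 1 True])"
      "resolving 2 (set [e 0 True, e 1 False, m]) (set [p])"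
      "resolving 2 (set [p]) (set [e 0 True, e 1 False, m])"
      by (auto simp: defs)
    have mono: ?case if "resolving 2 (set xs) (set ys)" "length xs \<le> x" "length ys \<le> y"
      for xs ys :: "(nat \<Rightarrow> bool \<Rightarrow> 'a) list"
      using that card_length[of xs] card_length[of ys]
      by (intro exI[of _ "set xs"] exI[of _ "set ys"]) auto
    consider "4 \<le> x" | "4 \<le> y" | "2 \<le> x" "2 \<le> y" | "3 \<le> x" "1 \<le> y" | "1 \<le> x" "3 \<le> y"
      using base by linarith
    then show ?case
      by cases (rule mono[OF r(1)] mono[OF r(2)] mono[OF r(3)] mono[OF r(4)] mono[OF r(5)]; simp; fail)+
  next
    case (Suc N)
    have card: "card (A \<union> {e N False, e N True}) \<le> card A + 2" for A
      by (rule order_trans[OF card_Un_le]) (simp add: card_insert_if)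
    have e0: "e N b k = (\<lambda>_. 0)" if "k \<ge> Suc N" for b k using that by (auto simp: e_def)
    have eN: "(\<Sum>k<Suc N. \<Sum>b'\<in>UNIV. e N b k b' * f k b') = f N b" for b f
      by (cases b) (simp_all add: e_def UNIV_bool)
    have extend: "(\<Sum>k<Suc N. \<Sum>b\<in>UNIV. \<alpha> k b * f k b) = (\<Sum>k<N. \<Sum>b\<in>UNIV. \<alpha> k b * f k b)"
      if "\<forall>k\<ge>N. \<alpha> k = (\<lambda>_. 0)" for \<alpha> f :: "nat \<Rightarrow> bool \<Rightarrow> 'a"
      using that by simp
    \<comment> \<open>The additional block has four entries \<open>g N u b\<close>, which the two
      unit vectors \<open>e N\<close> remove from either side. So two units of a single budget pay
      for it.\<close>
    have "x \<ge> 2 \<or> y \<ge> 2"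
    proof (rule ccontr)
      assume "\<not> (x \<ge> 2 \<or> y \<ge> 2)"
      then have "x \<le> 1" "y \<le> 1" by auto
      then show False using Suc.prems Suc.hyps by simp
    qed
    then consider "x \<ge> 2" | "y \<ge> 2" by blast
    then show ?case
    proof cases
      case 1
      then have "x - 2 + y \<ge> 2 * N" using Suc.prems by simp
      from Suc.IH[OF this] obtain A B :: "(nat \<Rightarrow> bool \<Rightarrow> 'a) set" where P: "finite A" "card A \<le> x - 2"
        "finite B" "card B \<le> y" "resolving N A B"
        by blast
      have "resolving (Suc N) (A \<union> {e N False, e N True}) B"
        unfolding resolving_def
      proof (intro conjI allI impI)
        show "\<forall>\<alpha>\<in>A \<union> {e N False, e N True} \<union> B. \<forall>k\<ge>Suc N. \<alpha> k = (\<lambda>_. 0)"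
          using P(5) e0 unfolding resolving_def by auto
        fix g k u b
        assume A: "\<forall>\<alpha>\<in>A \<union> {e N False, e N True}. \<forall>u. (\<Sum>k<Suc N. \<Sum>b\<in>UNIV. \<alpha> k b * g k u b) = 0"
          and B: "\<forall>\<beta>\<in>B. \<forall>b. (\<Sum>k<Suc N. \<Sum>u\<in>UNIV. \<beta> k u * g k u b) = 0" and k: "k < Suc N"
        have z: "\<forall>k\<ge>N. \<alpha> k = (\<lambda>_. 0)" if "\<alpha> \<in> A \<union> B" for \<alpha>
          using P(5) that unfolding resolving_def by blast
        have "\<forall>\<alpha>\<in>A. \<forall>u. (\<Sum>k<N. \<Sum>b\<in>UNIV. \<alpha> k b * g k u b) = 0"
        proof (intro ballI allI)
          fix \<alpha> u assume "\<alpha> \<in> A"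
          then show "(\<Sum>k<N. \<Sum>b\<in>UNIV. \<alpha> k b * g k u b) = 0"
            using extend[OF z[of \<alpha>], of "\<lambda>k b. g k u b"] A by (simp del: sum.lessThan_Suc)
        qed
        moreover have "\<forall>\<beta>\<in>B. \<forall>b. (\<Sum>k<N. \<Sum>u\<in>UNIV. \<beta> k u * g k u b) = 0"
        proof (intro ballI allI)
          fix \<beta> b assume "\<beta> \<in> B"
          then show "(\<Sum>k<N. \<Sum>u\<in>UNIV. \<beta> k u * g k u b) = 0"
            using extend[OF z[of \<beta>], of "\<lambda>k u. g k u b"] B by (simp del: sum.lessThan_Suc)
        qed
        ultimately have "\<forall>k<N. \<forall>u b. g k u b = 0"
          using P(5) unfolding resolving_def by blast
        moreover have "g N u b = 0"
          using A eN[of b "\<lambda>k b. g k u b"] by (cases b) (auto simp del: sum.lessThan_Suc)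
        ultimately show "g k u b = 0" using k by (auto simp: less_Suc_eq)
      qed
      moreover have "card (A \<union> {e N False, e N True}) \<le> x" using card[of A] P(2) 1 by linarith
      moreover have "finite (A \<union> {e N False, e N True})" using P(1) by simp
      ultimately show ?thesis using P(3,4) by (intro exI conjI)
    next
      case 2
      then have "x + (y - 2) \<ge> 2 * N" using Suc.prems by simp
      from Suc.IH[OF this] obtain A B :: "(nat \<Rightarrow> bool \<Rightarrow> 'a) set" where P: "finite A" "card A \<le> x"
        "finite B" "card B \<le> y - 2" "resolving N A B"
        by blast
      have "resolving (Suc N) A (B \<union> {e N False, e N True})"
        unfolding resolving_def
      proof (intro conjI allI impI)
        show "\<forall>\<alpha>\<in>A \<union> (B \<union> {e N False, e N True}). \<forall>k\<ge>Suc N. \<alpha> k = (\<lambda>_. 0)"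
          using P(5) e0 unfolding resolving_def by auto
        fix g k u b
        assume A: "\<forall>\<alpha>\<in>A. \<forall>u. (\<Sum>k<Suc N. \<Sum>b\<in>UNIV. \<alpha> k b * g k u b) = 0"
          and B: "\<forall>\<beta>\<in>B \<union> {e N False, e N True}. \<forall>b. (\<Sum>k<Suc N. \<Sum>u\<in>UNIV. \<beta> k u * g k u b) = 0"
          and k: "k < Suc N"
        have z: "\<forall>k\<ge>N. \<alpha> k = (\<lambda>_. 0)" if "\<alpha> \<in> A \<union> B" for \<alpha>
          using P(5) that unfolding resolving_def by blast
        have "\<forall>\<alpha>\<in>A. \<forall>u. (\<Sum>k<N. \<Sum>b\<in>UNIV. \<alpha> k b * g k u b) = 0"
        proof (intro ballI allI)
          fix \<alpha> u assume "\<alpha> \<in> A"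
          then show "(\<Sum>k<N. \<Sum>b\<in>UNIV. \<alpha> k b * g k u b) = 0"
            using extend[OF z[of \<alpha>], of "\<lambda>k b. g k u b"] A by (simp del: sum.lessThan_Suc)
        qed
        moreover have "\<forall>\<beta>\<in>B. \<forall>b. (\<Sum>k<N. \<Sum>u\<in>UNIV. \<beta> k u * g k u b) = 0"
        proof (intro ballI allI)
          fix \<beta> b assume "\<beta> \<in> B"
          then show "(\<Sum>k<N. \<Sum>u\<in>UNIV. \<beta> k u * g k u b) = 0"
            using extend[OF z[of \<beta>], of "\<lambda>k u. g k u b"] B by (simp del: sum.lessThan_Suc)
        qed
        ultimately have "\<forall>k<N. \<forall>u b. g k u b = 0"
          using P(5) unfolding resolving_def by blast
        moreover have "g N u b = 0"
          using B eN[of u "\<lambda>k u. g k u b"] by (cases u) (auto simp del: sum.lessThan_Suc)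
        ultimately show "g k u b = 0" using k by (auto simp: less_Suc_eq)
      qed
      moreover have "card (B \<union> {e N False, e N True}) \<le> y" using card[of B] P(4) 2 by linarith
      moreover have "finite (B \<union> {e N False, e N True})" using P(3) by simp
      ultimately show ?thesis using P(1,2) by (intro exI conjI)
    qed
  qed
qed

section \<open>Gluing two solutions along a new direction\<close>

lemma sum_cube_insert:
  fixes F :: "('d::finite \<Rightarrow> bool) \<Rightarrow> 'a::comm_monoid_add"
  assumes "d \<notin> D"
  shows "(\<Sum>z\<in>cube (insert d D). F z) = (\<Sum>z\<in>cube D. \<Sum>b\<in>UNIV. F (z(d := b)))"
proof -
  have "bij_betw (\<lambda>(z, b). z(d := b)) (cube D \<times> UNIV) (cube (insert d D))"
    by (rule bij_betw_byWitness[where f' = "\<lambda>z. (z(d := False), z d)"])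
      (use assms in \<open>auto simp: cube_def fun_eq_iff split: if_splits\<close>)
  then have "(\<Sum>z\<in>cube (insert d D). F z) = (\<Sum>(z, b)\<in>cube D \<times> UNIV. F (z(d := b)))"
    by (subst sum.reindex_bij_betw[symmetric]) (auto simp: case_prod_unfold)
  then show ?thesis by (simp add: sum.cartesian_product)
qed

lemma cube_not_in: "z \<in> cube D \<Longrightarrow> d \<notin> D \<Longrightarrow> z(d := False) = z"
  by (auto simp: cube_def fun_eq_iff)

text \<open>A tensor supported on the half \<open>z d = b\<close> tests only that half of \<psi>, so
  solutions placed on the two halves do not interfere.\<close>

lemma contract_half:
  fixes \<psi> :: "('d::finite \<Rightarrow> bool) \<Rightarrow> 'm::finite \<Rightarrow> 'a::field"
  assumes "i \<in> D" "d \<notin> D"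
  shows "contract (insert d D) i (\<lambda>z l. if z d = b then \<tau> (z(d := False)) l else 0) a \<psi>
    = contract D i \<tau> a (\<lambda>z. \<psi> (z(d := b)))"
proof -
  have "d \<noteq> i" using assms by auto
  show ?thesis
    unfolding contract_def sum_cube_insert[OF assms(2)]
  proof (intro sum.cong refl)
    fix z assume z: "z \<in> cube D"
    have "z(i := False, d := False) = z(i := False)"
      using cube_not_in[OF z assms(2)] \<open>d \<noteq> i\<close> by (simp add: fun_upd_twist)
    then have e: "(z(d := b'))(i := False, d := False) = z(i := False)" for b'
      using \<open>d \<noteq> i\<close> by (simp add: fun_upd_twist)
    let ?R = "if z i = a then \<Sum>l\<in>UNIV. \<tau> (z(i := False)) l * \<psi> (z(d := b)) l else 0"
    have "(if (z(d := b')) i = a then \<Sum>l\<in>UNIV.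
        (if ((z(d := b'))(i := False)) d = b then \<tau> ((z(d := b'))(i := False, d := False)) l else 0)
          * \<psi> (z(d := b')) l else 0) = (if b' = b then ?R else 0)" for b'
      unfolding e using \<open>d \<noteq> i\<close> by simp
    then show "(\<Sum>b'\<in>UNIV. if (z(d := b')) i = a then \<Sum>l\<in>UNIV.
        (if ((z(d := b'))(i := False)) d = b then \<tau> ((z(d := b'))(i := False, d := False)) l else 0)
          * \<psi> (z(d := b')) l else 0) = ?R"
      by simp
  qed
qed

text \<open>Adding a vector \<open>\<alpha> k\<close> in position \<open>d\<close> to a tensor
  without factor in position \<open>i\<close> keeps it usable in direction \<open>i\<close>, and its
  contractions are the sums tested by \<open>A\<close> in \<open>resolving\<close>.
  \<open>contract_new_direction\<close> treats \<open>B\<close>: there the vector fills position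
  \<open>i\<close> and the tensor is used in direction \<open>d\<close>.\<close>

lemma contract_old_direction:
  fixes \<psi> :: "('d::finite \<Rightarrow> bool) \<Rightarrow> 'm::finite \<Rightarrow> 'a::field"
  assumes "i \<in> D" "d \<notin> D"
  shows "contract (insert d D) i (\<lambda>z l. \<Sum>k<c. \<alpha> k (z d) * f k (z(d := False)) l) u \<psi>
    = (\<Sum>k<c. \<Sum>b\<in>UNIV. \<alpha> k b * contract D i (f k) u (\<lambda>z. \<psi> (z(d := b))))"
proof -
  have "d \<noteq> i" using assms by auto
  have "contract (insert d D) i (\<lambda>z l. \<Sum>k<c. \<alpha> k (z d) * f k (z(d := False)) l) u \<psi>
    = (\<Sum>z\<in>cube D. \<Sum>b\<in>UNIV. \<Sum>k<c. \<alpha> k b *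
        (if z i = u then \<Sum>l\<in>UNIV. f k (z(i := False)) l * \<psi> (z(d := b)) l else 0))"
    unfolding contract_def sum_cube_insert[OF assms(2)]
  proof (intro sum.cong refl)
    fix z b assume z: "z \<in> cube D"
    have "z(i := False, d := False) = z(i := False)"
      using cube_not_in[OF z assms(2)] \<open>d \<noteq> i\<close> by (simp add: fun_upd_twist)
    then have "(z(d := b))(i := False, d := False) = z(i := False)"
      using \<open>d \<noteq> i\<close> by (simp add: fun_upd_twist)
    moreover have "(\<Sum>l\<in>UNIV. (\<Sum>k<c. \<alpha> k b * f k (z(i := False)) l) * \<psi> (z(d := b)) l)
       = (\<Sum>k<c. \<alpha> k b * (\<Sum>l\<in>UNIV. f k (z(i := False)) l * \<psi> (z(d := b)) l))"
      by (simp add: sum_distrib_left sum_distrib_right mult.assoc) (rule sum.swap)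
    ultimately show "(if (z(d := b)) i = u then \<Sum>l\<in>UNIV.
        (\<Sum>k<c. \<alpha> k (((z(d := b))(i := False)) d) * f k ((z(d := b))(i := False, d := False)) l)
          * \<psi> (z(d := b)) l else 0)
      = (\<Sum>k<c. \<alpha> k b * (if z i = u then \<Sum>l\<in>UNIV. f k (z(i := False)) l * \<psi> (z(d := b)) l else 0))"
      using \<open>d \<noteq> i\<close> by simp
  qed
  also have "\<dots> = (\<Sum>b\<in>UNIV. \<Sum>k<c. \<Sum>z\<in>cube D. \<alpha> k b *
        (if z i = u then \<Sum>l\<in>UNIV. f k (z(i := False)) l * \<psi> (z(d := b)) l else 0))"
    by (subst sum.swap, intro sum.cong refl) (rule sum.swap)
  also have "\<dots> = (\<Sum>k<c. \<Sum>b\<in>UNIV. \<alpha> k b * contract D i (f k) u (\<lambda>z. \<psi> (z(d := b))))"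
    by (subst sum.swap) (simp only: contract_def sum_distrib_left)
  finally show ?thesis .
qed

lemma contract_new_direction:
  fixes \<psi> :: "('d::finite \<Rightarrow> bool) \<Rightarrow> 'm::finite \<Rightarrow> 'a::field"
  assumes "i \<in> D" "d \<notin> D"
  shows "contract (insert d D) d (\<lambda>z l. \<Sum>k<c. \<beta> k (z i) * f k (z(i := False)) l) b \<psi>
    = (\<Sum>k<c. \<Sum>u\<in>UNIV. \<beta> k u * contract D i (f k) u (\<lambda>z. \<psi> (z(d := b))))"
proof -
  have "d \<noteq> i" using assms by auto
  have "contract (insert d D) d (\<lambda>z l. \<Sum>k<c. \<beta> k (z i) * f k (z(i := False)) l) b \<psi>
    = (\<Sum>z\<in>cube D. \<Sum>k<c. \<Sum>u\<in>UNIV. \<beta> k u *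
        (if z i = u then \<Sum>l\<in>UNIV. f k (z(i := False)) l * \<psi> (z(d := b)) l else 0))"
    unfolding contract_def sum_cube_insert[OF assms(2)]
  proof (intro sum.cong refl)
    fix z assume z: "z \<in> cube D"
    have "(\<Sum>b'\<in>UNIV. if (z(d := b')) d = b then \<Sum>l\<in>UNIV.
        (\<Sum>k<c. \<beta> k (((z(d := b'))(d := False)) i) * f k ((z(d := b'))(d := False, i := False)) l)
          * \<psi> (z(d := b')) l else 0)
      = (\<Sum>l\<in>UNIV. (\<Sum>k<c. \<beta> k (z i) * f k (z(i := False)) l) * \<psi> (z(d := b)) l)"
      using \<open>d \<noteq> i\<close> cube_not_in[OF z assms(2)] by (cases b) (simp_all add: UNIV_bool)
    also have "\<dots> = (\<Sum>k<c. \<beta> k (z i) * (\<Sum>l\<in>UNIV. f k (z(i := False)) l * \<psi> (z(d := b)) l))"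
      by (simp add: sum_distrib_left sum_distrib_right mult.assoc) (rule sum.swap)
    also have "\<dots> = (\<Sum>k<c. \<Sum>u\<in>UNIV. \<beta> k u *
        (if z i = u then \<Sum>l\<in>UNIV. f k (z(i := False)) l * \<psi> (z(d := b)) l else 0))"
      by (cases "z i") (simp_all add: UNIV_bool)
    finally show "(\<Sum>b'\<in>UNIV. if (z(d := b')) d = b then \<Sum>l\<in>UNIV.
        (\<Sum>k<c. \<beta> k (((z(d := b'))(d := False)) i) * f k ((z(d := b'))(d := False, i := False)) l)
          * \<psi> (z(d := b')) l else 0) = \<dots>" .
  qed
  also have "\<dots> = (\<Sum>k<c. \<Sum>u\<in>UNIV. \<Sum>z\<in>cube D. \<beta> k u *
        (if z i = u then \<Sum>l\<in>UNIV. f k (z(i := False)) l * \<psi> (z(d := b)) l else 0))"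
    by (subst sum.swap, intro sum.cong refl) (rule sum.swap)
  also have "\<dots> = (\<Sum>k<c. \<Sum>u\<in>UNIV. \<beta> k u * contract D i (f k) u (\<lambda>z. \<psi> (z(d := b))))"
    by (simp only: contract_def sum_distrib_left)
  finally show ?thesis .
qed

text \<open>\<open>t\<close> serves the half \<open>e = False\<close> and \<open>t'\<close> the half
  \<open>e = True\<close>, after they have been made to share \<open>q d\<close> tensors in
  direction \<open>d\<close>. Using these on both halves separately would cost
  \<open>2 * q d\<close> in direction \<open>d\<close>; \<open>resolving\<close> splits this cost
  between \<open>d\<close> and the new direction \<open>e\<close>. The surplus
  \<open>q' d - q d\<close> tensors of \<open>t'\<close> are spent on its own half.\<close>

lemma admissible_step:
  fixes t t' :: "'d::finite \<Rightarrow> (('d \<Rightarrow> bool) \<Rightarrow> 'm::finite \<Rightarrow> 'a::field) set"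
  assumes inf: "infinite (UNIV :: 'a set)"
    and t: "admissible D q t" and t': "admissible D q' t'"
    and d: "d \<in> D" "e \<notin> D" and c: "2 \<le> q d" "q d \<le> q' d" and xy: "2 * q d \<le> x + y"
  shows "\<exists>s :: 'd \<Rightarrow> (('d \<Rightarrow> bool) \<Rightarrow> 'm \<Rightarrow> 'a) set. admissible (insert e D)
    (\<lambda>i. if i = d then x + (q' d - q d) else if i = e then y else q i + q' i) s"
proof -
  have ed: "e \<noteq> d" using d by auto
  obtain f where f: "separating D (t(d := f ` {..<q d}))" "separating D (t'(d := f ` {..<q' d}))"
    using separating_common_family[OF inf, of D t d "q d" t' "q' d"] t t' d(1)
    by (auto simp: admissible_def)
  obtain A B :: "(nat \<Rightarrow> bool \<Rightarrow> 'a) set" where AB: "finite A" "card A \<le> x" "finite B" "card B \<le> y"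
    "resolving (q d) A B"
    using resolving_exists[OF c(1) xy] by blast
  define half where "half b \<tau> = (\<lambda>z l. if z e = b then \<tau> (z(e := False)) l else 0)"
    for b and \<tau> :: "('d \<Rightarrow> bool) \<Rightarrow> 'm \<Rightarrow> 'a"
  define old where "old \<alpha> = (\<lambda>z l. \<Sum>k<q d. \<alpha> k (z e) * f k (z(e := False)) l)" for \<alpha>
  define new where "new \<beta> = (\<lambda>z l. \<Sum>k<q d. \<beta> k (z d) * f k (z(d := False)) l)" for \<beta>
  define s where "s i = (if i = d then old ` A \<union> half True ` f ` {q d..<q' d} else if i = e then new ` B
    else half False ` t i \<union> half True ` t' i)" for i
  have "separating (insert e D) s"
    unfolding separating_def
  proof (intro allI impI ballI)
    fix \<psi> z l
    assume ann: "\<forall>i\<in>insert e D. \<forall>\<tau>\<in>s i. \<forall>a. contract (insert e D) i \<tau> a \<psi> = 0"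
      and z: "z \<in> cube (insert e D)"
    define \<phi> where "\<phi> b = (\<lambda>z. \<psi> (z(e := b)))" for b
    have half: "contract (insert e D) i (half b \<tau>) a \<psi> = contract D i \<tau> a (\<phi> b)" if "i \<in> D" for i b \<tau> a
      unfolding half_def \<phi>_def by (rule contract_half[OF that d(2)])
    define g where "g k u b = contract D d (f k) u (\<phi> b)" for k u b
    have "\<forall>\<alpha>\<in>A. \<forall>u. (\<Sum>k<q d. \<Sum>b\<in>UNIV. \<alpha> k b * g k u b) = 0"
    proof (intro ballI allI)
      fix \<alpha> u assume "\<alpha> \<in> A"
      then have "contract (insert e D) d (old \<alpha>) u \<psi> = 0" using ann d(1) by (auto simp: s_def)
      then show "(\<Sum>k<q d. \<Sum>b\<in>UNIV. \<alpha> k b * g k u b) = 0"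
        unfolding old_def contract_old_direction[OF d] g_def \<phi>_def .
    qed
    moreover have "\<forall>\<beta>\<in>B. \<forall>b. (\<Sum>k<q d. \<Sum>u\<in>UNIV. \<beta> k u * g k u b) = 0"
    proof (intro ballI allI)
      fix \<beta> b assume "\<beta> \<in> B"
      then have "contract (insert e D) e (new \<beta>) b \<psi> = 0" using ann ed by (auto simp: s_def)
      then show "(\<Sum>k<q d. \<Sum>u\<in>UNIV. \<beta> k u * g k u b) = 0"
        unfolding new_def contract_new_direction[OF d] g_def \<phi>_def .
    qed
    ultimately have g: "g k u b = 0" if "k < q d" for k u b
      using AB(5) that unfolding resolving_def by blast
    have g': "contract D d (f k) u (\<phi> True) = 0" if "k < q' d" for k u
    proof (cases "k < q d")
      case True
      then show ?thesis using g[of k u True] by (simp add: g_def)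
    next
      case False
      then have "half True (f k) \<in> s d" using that by (auto simp: s_def)
      then show ?thesis using ann d(1) half[OF d(1), of True "f k" u] by auto
    qed
    have "contract D i \<tau> a (\<phi> False) = 0" if "i \<in> D" "\<tau> \<in> (t(d := f ` {..<q d})) i" for i \<tau> a
    proof (cases "i = d")
      case True
      then show ?thesis using that g[of _ a False] by (auto simp: g_def)
    next
      case False
      then have "half False \<tau> \<in> s i" using that d(2) by (auto simp: s_def)
      then show ?thesis using ann that(1) half[OF that(1), of False \<tau> a] by auto
    qed
    then have F: "\<forall>z\<in>cube D. \<forall>l. \<phi> False z l = 0"
      using f(1) unfolding separating_def by blast
    have "contract D i \<tau> a (\<phi> True) = 0" if "i \<in> D" "\<tau> \<in> (t'(d := f ` {..<q' d})) i" for i \<tau> a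
    proof (cases "i = d")
      case True
      then show ?thesis using that g' by auto
    next
      case False
      then have "half True \<tau> \<in> s i" using that d(2) by (auto simp: s_def)
      then show ?thesis using ann that(1) half[OF that(1), of True \<tau> a] by auto
    qed
    then have T: "\<forall>z\<in>cube D. \<forall>l. \<phi> True z l = 0"
      using f(2) unfolding separating_def by blast
    have "z(e := False) \<in> cube D" using z by (auto simp: cube_def)
    then have "\<phi> (z e) (z(e := False)) l = 0" using F T by (cases "z e") auto
    then show "\<psi> z l = 0" by (simp add: \<phi>_def)
  qed
  moreover have "finite (s i) \<and> card (s i) \<le> (if i = d then x + (q' d - q d) else if i = e then y else q i + q' i)"
    if i: "i \<in> insert e D" for i
  proof -
    consider "i = d" | "i = e" "i \<noteq> d" | "i \<in> D" "i \<noteq> d" "i \<noteq> e" using i by auto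
    then show ?thesis
    proof cases
      case 1
      have "card (old ` A \<union> half True ` f ` {q d..<q' d}) \<le> card A + (q' d - q d)"
        using card_Un_le[of "old ` A" "half True ` f ` {q d..<q' d}"] card_image_le[OF AB(1), of old]
          card_image_le[of "{q d..<q' d}" "\<lambda>k. half True (f k)"]
        by (simp add: image_image)
      then show ?thesis using 1 AB by (simp add: s_def)
    next
      case 2
      then show ?thesis using AB card_image_le[OF AB(3), of new] by (simp add: s_def)
    next
      case 3
      have "card (half False ` t i \<union> half True ` t' i) \<le> card (t i) + card (t' i)"
        using card_Un_le[of "half False ` t i" "half True ` t' i"] 3(1) t t'
          card_image_le[of "t i" "half False"] card_image_le[of "t' i" "half True"]
        by (auto simp: admissible_def)
      then show ?thesis using 3 t t' unfolding admissible_def by (fastforce simp: s_def)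
    qed
  qed
  ultimately show ?thesis unfolding admissible_def by blast
qed

section \<open>Distribution of the sizes and the induction on the number of directions\<close>

lemma subfunction_with_sum:
  fixes q :: "'i \<Rightarrow> nat"
  assumes "finite A" "s \<le> (\<Sum>i\<in>A. q i)"
  shows "\<exists>r. (\<forall>i. r i \<le> q i) \<and> (\<Sum>i\<in>A. r i) = s"
  using assms
proof (induction A arbitrary: s)
  case empty
  then show ?case by (intro exI[of _ "\<lambda>_. 0"]) auto
next
  case (insert a A)
  define s1 where "s1 = min s (q a)"
  have "s - s1 \<le> (\<Sum>i\<in>A. q i)" using insert.prems insert.hyps by (auto simp: s1_def min_def)
  then obtain r where r: "\<forall>i. r i \<le> q i" "(\<Sum>i\<in>A. r i) = s - s1" using insert.IH by blast
  have "(\<Sum>i\<in>A. (r(a := s1)) i) = (\<Sum>i\<in>A. r i)" using insert.hyps by (intro sum.cong) auto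
  then have "(\<Sum>i\<in>insert a A. (r(a := s1)) i) = s"
    using insert.hyps r(2) by (simp add: s1_def)
  then show ?case using r(1) by (intro exI[of _ "r(a := s1)"]) (auto simp: s1_def)
qed

lemma add_3_le_two_power: "n \<ge> 1 \<Longrightarrow> n + 3 \<le> 2 ^ Suc n"
  by (induction n rule: nat_induct_at_least) auto

lemma finite_argmax:
  fixes q :: "'d \<Rightarrow> nat"
  assumes "finite D" "D \<noteq> {}" shows "\<exists>d\<in>D. \<forall>i\<in>D. q i \<le> q d"
proof -
  have "Max (q ` D) \<in> q ` D" using assms by (intro Max_in) auto
  then obtain d where "d \<in> D" "q d = Max (q ` D)" by force
  then show ?thesis using assms(1) by (intro bexI[of _ d]) auto
qed

text \<open>If the two largest entries add up to at most 3, the second and hence all the remaining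
  ones are at most 1, so the total is at most n + 3, which is below 2^(n+2).\<close>

lemma two_large_entries:
  fixes q :: "'d \<Rightarrow> nat"
  assumes card: "card D = Suc (Suc n)" and sum: "(\<Sum>i\<in>D. q i) \<ge> 2 ^ Suc (Suc n)"
  shows "\<exists>d\<in>D. \<exists>e\<in>D. d \<noteq> e \<and> q d \<ge> q e \<and> q d + q e \<ge> 4"
proof -
  have fin: "finite D" using card by (auto intro: card_ge_0_finite)
  have "D \<noteq> {}" using card by auto
  then obtain d where d: "d \<in> D" "\<forall>i\<in>D. q i \<le> q d" using finite_argmax[OF fin] by blast
  have card_d: "card (D - {d}) = Suc n" using card d(1) fin by simp
  then have "D - {d} \<noteq> {}" by (metis card.empty nat.distinct(1))
  then obtain e where e: "e \<in> D - {d}" "\<forall>i\<in>D - {d}. q i \<le> q e"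
    using finite_argmax[of "D - {d}"] fin by blast
  have "q d + q e \<ge> 4"
  proof (rule ccontr)
    assume neg: "\<not> q d + q e \<ge> 4"
    then have "q e \<le> 1" using d e by force
    have "(\<Sum>i\<in>D. q i) = q d + (q e + (\<Sum>i\<in>D - {d} - {e}. q i))"
      using fin d(1) e(1) by (simp add: sum.remove[of D d] sum.remove[of "D - {d}" e])
    also have "(\<Sum>i\<in>D - {d} - {e}. q i) \<le> (\<Sum>i\<in>D - {d} - {e}. 1)"
      using e(2) \<open>q e \<le> 1\<close> by (intro sum_mono) (meson DiffD1 le_trans)
    also have "\<dots> = n" using card_d e(1) fin by simp
    finally have "(\<Sum>i\<in>D. q i) \<le> n + 3" using neg by simp
    moreover have "n + 3 < 2 ^ Suc (Suc n)"
      using add_3_le_two_power[of "Suc n"] by simp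
    ultimately show False using sum by simp
  qed
  moreover have "q e \<le> q d" "d \<noteq> e" "e \<in> D" using d(2) e(1) by auto
  ultimately show ?thesis using d(1) by (intro bexI[of _ d] bexI[of _ e] conjI)
qed

lemma admissible_singleton:
  fixes d :: "'d::finite"
  assumes "CARD('m::finite) \<le> q d"
  shows "\<exists>t :: 'd \<Rightarrow> (('d \<Rightarrow> bool) \<Rightarrow> 'm \<Rightarrow> 'a::field) set. admissible {d} q t"
proof -
  define \<delta> :: "'m \<Rightarrow> ('d \<Rightarrow> bool) \<Rightarrow> 'm \<Rightarrow> 'a" where "\<delta> m z l = (if l = m then 1 else 0)" for m z l
  have "contract {d} d (\<delta> m) (z d) \<psi> = \<psi> z m" if z: "z \<in> cube {d}" for m z \<psi>
  proof -
    have "(if z' d = z d then \<Sum>l\<in>UNIV. \<delta> m (z'(d := False)) l * \<psi> z' l else 0) =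
        (if z' = z then \<psi> z m else 0)" if "z' \<in> cube {d}" for z'
    proof -
      have "z' d = z d \<longleftrightarrow> z' = z" using z that by (auto simp: cube_def fun_eq_iff)
      then show ?thesis by (simp add: \<delta>_def if_distrib[of "\<lambda>x. x * _"] cong: if_cong)
    qed
    then show ?thesis using z by (simp add: contract_def cong: sum.cong)
  qed
  then have "separating {d} (\<lambda>_. range \<delta>)"
    unfolding separating_def by (metis UNIV_I image_eqI insertI1)
  moreover have "card (range \<delta>) \<le> CARD('m)" by (rule card_image_le) simp
  ultimately show ?thesis
    using assms unfolding admissible_def by (intro exI[of _ "\<lambda>_. range \<delta>"]) auto
qed

lemma admissible_exists:
  fixes D :: "'d::finite set"
  assumes inf: "infinite (UNIV :: 'a::field set)" and m: "CARD('m::finite) \<ge> 2"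
    and "D \<noteq> {}" and "CARD('m) * 2 ^ (card D - 1) \<le> (\<Sum>i\<in>D. q i)"
  shows "\<exists>t :: 'd \<Rightarrow> (('d \<Rightarrow> bool) \<Rightarrow> 'm \<Rightarrow> 'a) set. admissible D q t"
proof -
  have main: "\<exists>t :: 'd \<Rightarrow> (('d \<Rightarrow> bool) \<Rightarrow> 'm \<Rightarrow> 'a) set. admissible D q t"
    if "card D = Suc n" "CARD('m) * 2 ^ n \<le> (\<Sum>i\<in>D. q i)" for n and D :: "'d set" and q
    using that
  proof (induction n arbitrary: D q)
    case 0
    then obtain d where "D = {d}" by (auto simp: card_Suc_eq)
    then show ?case using admissible_singleton[of q d] 0 by auto
  next
    case (Suc n)
    define H where "H = CARD('m) * 2 ^ n"
    have sum: "2 * H \<le> (\<Sum>i\<in>D. q i)" using Suc.prems(2) by (simp add: H_def)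
    have "(2::nat) ^ Suc (Suc n) \<le> 2 * H" using m by (simp add: H_def)
    then obtain d e where de: "d \<in> D" "e \<in> D" "d \<noteq> e" "q d \<ge> q e" "q d + q e \<ge> 4"
      using two_large_entries[OF Suc.prems(1), of q] sum by (meson le_trans)
    \<comment> \<open>Direction \<open>e\<close> is absent from the two sub-solutions, whose sizes
      in direction \<open>d\<close> are the halves \<open>c\<close> and \<open>c'\<close> of
      \<open>q d + q e\<close>. Gluing costs \<open>2 * c\<close> for the shared tensors and
      \<open>c' - c\<close> for the surplus, exactly \<open>q d + q e\<close> in total.\<close>
    define c where "c = (q d + q e) div 2"
    define c' where "c' = q d + q e - c"
    have c: "2 \<le> c" "c \<le> c'" "c + c' = q d + q e" "c' - c \<le> q d" "2 * c \<le> (q d - (c' - c)) + q e"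
      "c' \<le> Suc c"
      using de(4,5) unfolding c_def c'_def by linarith+
    define R where "R = D - {e} - {d}"
    have R: "finite R" "d \<notin> R" "e \<notin> R" "D - {e} = insert d R" using de by (auto simp: R_def)
    have "(\<Sum>i\<in>D. q i) = q e + (q d + (\<Sum>i\<in>R. q i))"
      using de R by (simp add: sum.remove[of D e])
    then have S: "2 * H \<le> c + c' + (\<Sum>i\<in>R. q i)" using sum c(3) by simp
    then have "H - c' \<le> (\<Sum>i\<in>R. q i)" using c(2) by linarith
    \<comment> \<open>The second solution receives just enough of the other sizes to lift
      \<open>c'\<close> to \<open>H\<close>; the first keeps the rest.\<close>
    then obtain r where r: "\<forall>i. r i \<le> q i" "(\<Sum>i\<in>R. r i) = H - c'"
      using subfunction_with_sum[OF R(1)] by blast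
    have card: "card (D - {e}) = Suc n" using Suc.prems(1) de(2) by simp
    define q1 where "q1 = (\<lambda>i. q i - r i)(d := c)"
    define q2 where "q2 = r(d := c')"
    have "(\<Sum>i\<in>D - {e}. q1 i) = c + (\<Sum>i\<in>R. q i - r i)"
    proof -
      have "(\<Sum>i\<in>R. q1 i) = (\<Sum>i\<in>R. q i - r i)" using R(2) by (intro sum.cong) (auto simp: q1_def)
      then show ?thesis using R by (simp add: q1_def)
    qed
    also have "(\<Sum>i\<in>R. q i - r i) = (\<Sum>i\<in>R. q i) - (H - c')"
      using r by (simp add: sum_subtractf_nat)
    \<comment> \<open>If \<open>H \<le> c'\<close>, the second solution takes nothing from
      \<open>R\<close>, and the first reaches \<open>H\<close> because \<open>c\<close> and
      \<open>c'\<close> differ by at most one.\<close>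
    finally have "H \<le> (\<Sum>i\<in>D - {e}. q1 i)"
      using S c(6) \<open>H - c' \<le> (\<Sum>i\<in>R. q i)\<close> by (cases "H \<le> c'") linarith+
    then obtain t1 :: "'d \<Rightarrow> (('d \<Rightarrow> bool) \<Rightarrow> 'm \<Rightarrow> 'a) set" where t1: "admissible (D - {e}) q1 t1"
      using Suc.IH[OF card, of q1] unfolding H_def by blast
    have "(\<Sum>i\<in>D - {e}. q2 i) = c' + (\<Sum>i\<in>R. r i)"
    proof -
      have "(\<Sum>i\<in>R. q2 i) = (\<Sum>i\<in>R. r i)" using R(2) by (intro sum.cong) (auto simp: q2_def)
      then show ?thesis using R by (simp add: q2_def)
    qed
    then have "H \<le> (\<Sum>i\<in>D - {e}. q2 i)" using r(2) by linarith
    then obtain t2 :: "'d \<Rightarrow> (('d \<Rightarrow> bool) \<Rightarrow> 'm \<Rightarrow> 'a) set" where t2: "admissible (D - {e}) q2 t2"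
      using Suc.IH[OF card, of q2] unfolding H_def by blast
    have "\<exists>s :: 'd \<Rightarrow> (('d \<Rightarrow> bool) \<Rightarrow> 'm \<Rightarrow> 'a) set. admissible (insert e (D - {e}))
        (\<lambda>i. if i = d then (q d - (c' - c)) + (q2 d - q1 d) else if i = e then q e else q1 i + q2 i) s"
      by (rule admissible_step[OF inf t1 t2]) (use de c in \<open>auto simp: q1_def q2_def\<close>)
    moreover have "(\<lambda>i. if i = d then (q d - (c' - c)) + (q2 d - q1 d) else if i = e then q e else q1 i + q2 i) = q"
      using c(4) r(1) by (auto simp: q1_def q2_def)
    moreover have "insert e (D - {e}) = D" using de(2) by auto
    ultimately show ?case by simp
  qed
  have "card D = Suc (card D - 1)" using assms(3) by (simp add: card_gt_0_iff)
  then show ?thesis using main assms(4) by blast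
qed

section \<open>Multilinear maps as coefficient arrays\<close>

definition form :: "(('d::finite \<Rightarrow> 'n::finite) \<times> 'm \<Rightarrow> 'a::field) \<Rightarrow> ('d \<Rightarrow> 'n \<Rightarrow> 'a) \<Rightarrow> 'm \<Rightarrow> 'a" where
  "form c w l = (\<Sum>I\<in>UNIV. c (I, l) * (\<Prod>i\<in>UNIV. w i (I i)))"

definition multilinear_of :: "(('d::finite \<Rightarrow> 'n::finite) \<times> 'm \<Rightarrow> 'a::field) \<Rightarrow> 'a ^ 'n ^ 'd \<Rightarrow> 'a ^ 'm" where
  "multilinear_of c v = (\<chi> l. form c (\<lambda>i. ($) (v $ i)) l)"

lemma prod_sum_UNIV:
  fixes f :: "'d::finite \<Rightarrow> 'u::finite \<Rightarrow> 'a::comm_semiring_1"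
  shows "(\<Prod>i\<in>UNIV. \<Sum>u\<in>UNIV. f i u) = (\<Sum>z\<in>UNIV. \<Prod>i\<in>UNIV. f i (z i))"
  using prod_sum_PiE[of "UNIV :: 'd set" "\<lambda>_. UNIV :: 'u set" f] by simp

text \<open>Multilinear expansion, used with u running over the two basis vectors of a plane and,
  for \<open>transform\<close>, over all coordinates.\<close>

lemma form_combination:
  fixes x :: "'d::finite \<Rightarrow> 'u::finite \<Rightarrow> 'a::field"
  shows "form c (\<lambda>i k. \<Sum>u\<in>UNIV. x i u * w i u k) l =
    (\<Sum>z\<in>UNIV. (\<Prod>i\<in>UNIV. x i (z i)) * form c (\<lambda>i. w i (z i)) l)"
proof -
  have "form c (\<lambda>i k. \<Sum>u\<in>UNIV. x i u * w i u k) l =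
      (\<Sum>I\<in>UNIV. \<Sum>z\<in>UNIV. (\<Prod>i\<in>UNIV. x i (z i)) * (c (I, l) * (\<Prod>i\<in>UNIV. w i (z i) (I i))))"
    unfolding form_def prod_sum_UNIV by (simp add: sum_distrib_left prod.distrib mult_ac)
  also have "\<dots> = (\<Sum>z\<in>UNIV. (\<Prod>i\<in>UNIV. x i (z i)) * form c (\<lambda>i. w i (z i)) l)"
    unfolding form_def by (subst sum.swap) (simp only: sum_distrib_left)
  finally show ?thesis .
qed

lemma form_slot:
  "form c (\<lambda>j. if j = i then x else v j) l =
    (\<Sum>I\<in>UNIV. c (I, l) * (\<Prod>j\<in>UNIV - {i}. v j (I j)) * x (I i))"
proof -
  have "(\<Prod>j\<in>UNIV. (if j = i then x else v j) (I j)) = x (I i) * (\<Prod>j\<in>UNIV - {i}. v j (I j))" for I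
    by (subst prod.remove[of UNIV i]) (auto intro!: prod.cong)
  then show ?thesis by (simp add: form_def mult_ac)
qed

lemma multilinear_of_slot:
  "multilinear_of c (\<chi> j. if j = i then x else v $ j) =
    (\<chi> l. \<Sum>I\<in>UNIV. c (I, l) * (\<Prod>j\<in>UNIV - {i}. v $ j $ I j) * x $ I i)"
proof -
  have "(\<lambda>j. ($) ((\<chi> j. if j = i then x else v $ j) $ j))
      = (\<lambda>j. if j = i then ($) x else ($) (v $ j))" by auto
  then have "multilinear_of c (\<chi> j. if j = i then x else v $ j)
      = (\<chi> l. form c (\<lambda>j. if j = i then ($) x else ($) (v $ j)) l)"
    by (simp add: multilinear_of_def)
  also have "\<dots> = (\<chi> l. \<Sum>I\<in>UNIV. c (I, l) * (\<Prod>j\<in>UNIV - {i}. v $ j $ I j) * x $ I i)"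
    by (intro arg_cong[where f = vec_lambda] ext form_slot)
  finally show ?thesis .
qed

lemma multilinear_of_mem: "multilinear_of c \<in> multilinear_maps"
  unfolding multilinear_maps_def mem_Collect_eq multilinear_of_slot
  by (intro allI, unfold_locales)
    (simp_all add: vec_eq_iff distrib_left sum.distrib sum_distrib_left mult.left_commute)

lemma multilinear_of_axis:
  fixes c :: "('d::finite \<Rightarrow> 'n::finite) \<times> 'm::finite \<Rightarrow> 'a::field"
  shows "multilinear_of c (\<chi> i. axis (I i) 1) $ l = c (I, l)"
proof -
  have "(\<Prod>i\<in>UNIV. axis (I i) (1::'a) $ J i) = (if J = I then 1 else 0)" for J :: "'d \<Rightarrow> 'n"
  proof (cases "J = I")
    case False
    then obtain i where "J i \<noteq> I i" by auto
    then have "\<exists>i\<in>UNIV. axis (I i) (1::'a) $ J i = 0" by (auto simp: axis_def)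
    then show ?thesis using False by (simp add: prod_zero)
  qed (simp add: axis_def)
  then show ?thesis
    by (simp add: multilinear_of_def form_def if_distrib[of "\<lambda>x. _ * x"] cong: if_cong)
qed

text \<open>Induction on the set of positions whose argument may differ from a basis vector, with
  linearity in one more position at each step.\<close>

lemma multilinear_maps_eqI:
  fixes T T' :: "'a::field ^ 'n ^ 'd::finite \<Rightarrow> 'a ^ 'm"
  assumes T: "T \<in> multilinear_maps" and T': "T' \<in> multilinear_maps"
    and eq: "\<And>I. T (\<chi> i. axis (I i) 1) = T' (\<chi> i. axis (I i) 1)"
  shows "T = T'"
proof -
  have "\<forall>v. (\<forall>i. i \<notin> S \<longrightarrow> (\<exists>k. v $ i = axis k 1)) \<longrightarrow> T v = T' v" if "finite S" for S
    using that
  proof (induction S)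
    case empty
    show ?case
    proof (intro allI impI)
      fix v :: "'a ^ 'n ^ 'd" assume "\<forall>i. i \<notin> {} \<longrightarrow> (\<exists>k. v $ i = axis k 1)"
      then obtain I where "\<And>i. v $ i = axis (I i) 1" by (metis empty_iff)
      then have "v = (\<chi> i. axis (I i) 1)" by (simp add: vec_eq_iff)
      then show "T v = T' v" using eq by simp
    qed
  next
    case (insert i S)
    show ?case
    proof (intro allI impI)
      fix v :: "'a ^ 'n ^ 'd" assume v: "\<forall>j. j \<notin> insert i S \<longrightarrow> (\<exists>k. v $ j = axis k 1)"
      let ?f = "\<lambda>T x. T (\<chi> j. if j = i then x else v $ j)"
      have lin: "Vector_Spaces.linear (*s) (*s) (?f T)" "Vector_Spaces.linear (*s) (*s) (?f T')"
        using T T' unfolding multilinear_maps_def by blast+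
      have "?f T b = ?f T' b" if "b \<in> cart_basis" for b
        using that v insert.IH by (auto simp: cart_basis_def)
      then have "?f T (v $ i) = ?f T' (v $ i)"
        using vec.linear_eq_on_span[OF lin] span_cart_basis by blast
      moreover have "(\<chi> j. if j = i then v $ i else v $ j) = v" by (simp add: vec_eq_iff)
      ultimately show "T v = T' v" by simp
    qed
  qed
  from this[of UNIV] show ?thesis by (intro ext) simp
qed

lemma multilinear_maps_eq:
  "(multilinear_maps :: ('a::field ^ 'n ^ 'd \<Rightarrow> 'a ^ 'm) set) = range multilinear_of"
proof (intro equalityI subsetI)
  fix T :: "'a ^ 'n ^ 'd \<Rightarrow> 'a ^ 'm" assume T: "T \<in> multilinear_maps"
  have "T = multilinear_of (\<lambda>(I, l). T (\<chi> i. axis (I i) 1) $ l)"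
    by (rule multilinear_maps_eqI[OF T multilinear_of_mem]) (simp add: vec_eq_iff multilinear_of_axis)
  then show "T \<in> range multilinear_of" by blast
qed (use multilinear_of_mem in auto)

text \<open>Pluecker coordinates of the plane spanned by \<open>u\<close> and \<open>v\<close>, kept
  for all ordered pairs: as a matrix they are alternating and every row lies in the plane, which is
  how \<open>killed_closed\<close> reads vectors off a limit.\<close>

definition minor :: "('n \<Rightarrow> 'a::comm_ring) \<Rightarrow> ('n \<Rightarrow> 'a) \<Rightarrow> 'n \<times> 'n \<Rightarrow> 'a" where
  "minor u v = (\<lambda>(k, k'). u k * v k' - u k' * v k)"

text \<open>The planes are given by bases \<open>w i False\<close>, \<open>w i True\<close>; by
  multilinearity, vanishing on their product reduces to the 2^d tuples of basis vectors.\<close>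

definition killed :: "(('d::finite \<Rightarrow> 'n::finite) \<times> 'm \<Rightarrow> 'a::field) \<Rightarrow> bool" where
  "killed c \<longleftrightarrow> (\<exists>w :: 'd \<Rightarrow> bool \<Rightarrow> 'n \<Rightarrow> 'a. (\<forall>i. \<exists>p. minor (w i False) (w i True) p \<noteq> 0) \<and>
     (\<forall>z l. form c (\<lambda>i. w i (z i)) l = 0))"

lemma independent_pair_minor:
  fixes a b :: "'a::field ^ 'n"
  assumes "a \<noteq> b" "vec.independent {a, b}" shows "\<exists>p. minor (($) a) (($) b) p \<noteq> 0"
proof (rule ccontr)
  assume "\<not> ?thesis"
  then have m: "a $ k * b $ k' = a $ k' * b $ k" for k k' by (auto simp: minor_def)
  have "a \<noteq> 0" using assms(2) vec.dependent_zero[of "{a, b}"] by auto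
  then obtain k where k: "a $ k \<noteq> 0" by (auto simp: vec_eq_iff)
  have "b = (b $ k / a $ k) *s a" using m[of k] k by (simp add: vec_eq_iff field_simps)
  then have "b \<in> vec.span {a}" by (metis singletonI vec.span_base vec.span_scale)
  moreover have "{b, a} - {b} = {a}" using assms(1) by auto
  ultimately have "vec.dependent {b, a}" unfolding vec.dependent_def by (metis insertI1)
  then show False using assms(2) by (simp add: insert_commute)
qed

lemma minor_independent_pair:
  fixes a b :: "'a::field ^ 'n"
  assumes "minor (($) a) (($) b) p \<noteq> 0" shows "a \<noteq> b" "vec.independent {a, b}"
proof -
  show ne: "a \<noteq> b" using assms by (auto simp: minor_def split: prod.splits)
  have "b \<noteq> 0" using assms by (auto simp: minor_def split: prod.splits)
  moreover have "a \<notin> vec.span {b}"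
  proof
    assume "a \<in> vec.span {b}"
    then obtain r where "a = r *s b" by (auto simp: vec.span_singleton)
    then show False using assms by (auto simp: minor_def split: prod.splits)
  qed
  ultimately show "vec.independent {a, b}" by (simp add: vec.independent_insert)
qed

text \<open>A subspace of dimension at least 2 contains a plane, and vanishing passes to smaller
  subspaces.\<close>

lemma vanishing_dims_iff_killed:
  fixes c :: "('d::finite \<Rightarrow> 'n::finite) \<times> 'm::finite \<Rightarrow> 'a::field"
  shows "(\<exists>s\<in>vanishing_dims (multilinear_of c). s \<ge> 2) \<longleftrightarrow> killed c"
proof
  assume "\<exists>s\<in>vanishing_dims (multilinear_of c). s \<ge> 2"
  then obtain s and V :: "'d \<Rightarrow> ('a ^ 'n) set" where s: "s \<ge> 2"
    "\<And>i. vec.subspace (V i)" "\<And>i. vec.dim (V i) = s"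
    "\<And>v. (\<And>i. v $ i \<in> V i) \<Longrightarrow> multilinear_of c v = 0"
    unfolding vanishing_dims_def by blast
  have "\<exists>a b. a \<in> V i \<and> b \<in> V i \<and> (\<exists>p. minor (($) a) (($) b) p \<noteq> 0)" for i
  proof -
    obtain B where B: "B \<subseteq> V i" "vec.independent B" "card B = s"
      using vec.basis_exists[of "V i"] s(3)[of i] by metis
    then obtain a b where ab: "a \<in> B" "b \<in> B" "a \<noteq> b"
      using s(1) by (metis card_le_Suc0_iff_eq card.infinite not_less_eq_eq numeral_2_eq_2 zero_le)
    then have "vec.independent {a, b}" using B(2) vec.independent_mono[of B "{a, b}"] by auto
    then show ?thesis using independent_pair_minor[OF ab(3)] ab B(1) by blast
  qed
  then obtain a b where ab: "\<And>i. a i \<in> V i" "\<And>i. b i \<in> V i" "\<And>i. \<exists>p. minor (($) (a i)) (($) (b i)) p \<noteq> 0"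
    by metis
  define w where "w i u = ($) (if u then b i else a i)" for i u
  have "form c (\<lambda>i. w i (z i)) l = 0" for z l
  proof -
    have "multilinear_of c (\<chi> i. if z i then b i else a i) = 0" by (rule s(4)) (simp add: ab)
    then show ?thesis by (simp add: multilinear_of_def vec_eq_iff w_def)
  qed
  then show "killed c" unfolding killed_def using ab(3) by (intro exI[of _ w]) (simp add: w_def)
next
  assume "killed c"
  then obtain w :: "'d \<Rightarrow> bool \<Rightarrow> 'n \<Rightarrow> 'a" where w: "\<And>i. \<exists>p. minor (w i False) (w i True) p \<noteq> 0"
    "\<And>z l. form c (\<lambda>i. w i (z i)) l = 0" unfolding killed_def by blast
  define a b where "a i = (\<chi> k. w i False k)" and "b i = (\<chi> k. w i True k)" for i
  define V where "V i = vec.span {a i, b i}" for i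
  have "($) (a i) = w i False" "($) (b i) = w i True" for i by (auto simp: a_def b_def)
  then have ind: "a i \<noteq> b i" "vec.independent {a i, b i}" for i
    using w(1)[of i] minor_independent_pair by metis+
  have "vec.dim (V i) = 2" for i
    unfolding V_def using ind[of i] by (simp add: vec.dim_eq_card_independent)
  moreover have "multilinear_of c v = 0" if v: "\<forall>i. v $ i \<in> V i" for v
  proof -
    have "\<exists>x. v $ i = x False *s a i + x True *s b i" for i
    proof -
      have "v $ i \<in> vec.span (insert (a i) {b i})" using v by (simp add: V_def)
      then obtain r q where "v $ i - r *s a i = q *s b i"
        unfolding vec.span_insert[of "a i" "{b i}"] vec.span_singleton by blast
      then show ?thesis by (intro exI[of _ "\<lambda>u. if u then q else r"]) (simp add: algebra_simps)
    qed
    then obtain x where x: "\<And>i. v $ i = x i False *s a i + x i True *s b i" by metis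
    have "(\<lambda>i. ($) (v $ i)) = (\<lambda>i k. \<Sum>u\<in>UNIV. x i u * w i u k)"
      by (intro ext) (simp add: x a_def b_def UNIV_bool)
    then show ?thesis using w(2) by (simp add: multilinear_of_def form_combination vec_eq_iff)
  qed
  ultimately have "2 \<in> vanishing_dims (multilinear_of c)"
    unfolding vanishing_dims_def by (auto simp: V_def intro!: exI[of _ V])
  then show "\<exists>s\<in>vanishing_dims (multilinear_of c). s \<ge> 2" by blast
qed

lemma alpha_ge_2_iff:
  "alpha TYPE('a::field) TYPE('n::finite) TYPE('d::finite) TYPE('m::finite) \<ge> 2 \<longleftrightarrow>
    (\<forall>c :: ('d \<Rightarrow> 'n) \<times> 'm \<Rightarrow> 'a. killed c)"
proof -
  have "alpha_map (multilinear_of c) \<ge> 2 \<longleftrightarrow> killed c" for c :: "('d \<Rightarrow> 'n) \<times> 'm \<Rightarrow> 'a"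
  proof -
    have "alpha_map (multilinear_of c) \<ge> 2 \<longleftrightarrow> (\<exists>s\<in>vanishing_dims (multilinear_of c). s \<ge> 2)"
      unfolding alpha_map_def
      using zero_in_vanishing_dims[OF multilinear_of_mem, of c]
      by (intro Max_ge_iff finite_vanishing_dims) auto
    then show ?thesis by (simp add: vanishing_dims_iff_killed)
  qed
  moreover have "alpha TYPE('a) TYPE('n) TYPE('d) TYPE('m) \<ge> 2 \<longleftrightarrow>
    (\<forall>T\<in>(multilinear_maps :: ('a ^ 'n ^ 'd \<Rightarrow> 'a ^ 'm) set). alpha_map T \<ge> 2)"
    unfolding alpha_def
    using finite_alpha_map_image multilinear_maps_nonempty
    by (subst Min_ge_iff) auto
  ultimately show ?thesis by (simp add: multilinear_maps_eq)
qed

text \<open>The matrices \<open>a b\<^sup>T - b a\<^sup>T\<close> of the killed planes converge projectively, and the limits are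
  again nonzero and alternating, hence of rank at least two.\<close>

lemma killed_closed:
  fixes t :: "('d::finite \<Rightarrow> 'n::finite) \<times> 'm::finite \<Rightarrow> 'a::alg_closed_field"
  assumes closure: "\<And>n P. polyfun UNIV n P \<Longrightarrow> (\<And>y. killed y \<Longrightarrow> P y = 0) \<Longrightarrow> P t = 0"
  shows "killed t"
proof (rule ccontr)
  assume t: "\<not> killed t"
  define Y :: "(('d \<Rightarrow> 'n) \<times> 'm \<Rightarrow> 'a) set" where "Y = {y. killed y}"
  define P :: "((('d \<Rightarrow> 'n) \<times> 'm \<Rightarrow> 'a) \<Rightarrow> 'a) set" where "P = {f. \<exists>n. polyfun UNIV n f}"
  have "function_ring P"
    unfolding function_ring_def
  proof (intro conjI allI ballI)
    fix f g assume "f \<in> P" "g \<in> P"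
    then obtain m n where mn: "polyfun UNIV m f" "polyfun UNIV n g" by (auto simp: P_def)
    have "polyfun UNIV (max m n) f" "polyfun UNIV (max m n) g"
      by (rule polyfun_mono[OF mn(1)], simp) (rule polyfun_mono[OF mn(2)], simp)
    then show "(\<lambda>x. f x + g x) \<in> P" unfolding P_def by (blast intro: polyfun.add)
    show "(\<lambda>x. f x * g x) \<in> P" unfolding P_def using polyfun.mult[OF mn] by blast
  qed (auto simp: P_def intro: polyfun.const)
  moreover have "determines Y t P"
    unfolding determines_def P_def Y_def using closure by blast
  ultimately obtain G where G: "P \<subseteq> G" "place Y t G"
    using place_exists[of t Y P] t by (auto simp: Y_def)
  interpret place Y t G by (rule G(2))
  have "\<forall>y\<in>Y. \<exists>w :: 'd \<Rightarrow> bool \<Rightarrow> 'n \<Rightarrow> 'a. (\<forall>i. \<exists>p. minor (w i False) (w i True) p \<noteq> 0) \<and>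
      (\<forall>z l. form y (\<lambda>i. w i (z i)) l = 0)"
    by (simp add: Y_def killed_def)
  from bchoice[OF this] obtain w :: "_ \<Rightarrow> 'd \<Rightarrow> bool \<Rightarrow> 'n \<Rightarrow> 'a" where
    w: "\<And>y i. y \<in> Y \<Longrightarrow> \<exists>p. minor (w y i False) (w y i True) p \<noteq> 0"
      "\<And>y z l. y \<in> Y \<Longrightarrow> form y (\<lambda>i. w y i (z i)) l = 0" by blast
  define h where "h i p y = minor (w y i False) (w y i True) p" for i p y
  have "\<forall>i. \<exists>j\<in>UNIV. \<exists>g. g j t = 1 \<and> (\<forall>p\<in>UNIV. g p \<in> G \<and> (\<forall>y\<in>Y. g p y = h i p y / h i j y))"
    by (intro allI projective_limit) (use w(1) in \<open>auto simp: h_def\<close>)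
  then have "\<forall>i. \<exists>j g. g j t = 1 \<and> (\<forall>p. g p \<in> G \<and> (\<forall>y\<in>Y. g p y = h i p y / h i j y))" by blast
  then obtain j g where g: "\<And>i. g i (j i) t = 1" "\<And>i p. g i p \<in> G"
    "\<And>i p y. y \<in> Y \<Longrightarrow> g i p y = h i p y / h i (j i) y"
    unfolding choice_iff by blast
  have form0: "form t (\<lambda>i k. g i (r i, k) t) l = 0" for r l
  proof -
    let ?F = "\<lambda>x. form x (\<lambda>i k. g i (r i, k) x) l"
    have var: "(\<lambda>x. x (I, l)) \<in> G" for I
      using G(1) polyfun.var[of "(I, l)" UNIV 0] unfolding P_def by blast
    have "?F \<in> G"
      unfolding form_def
      by (intro function_ring_sum[OF ring] function_ring_mult[OF ring] function_ring_prod[OF ring] var g(2))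
    moreover have "?F y = 0" if y: "y \<in> Y" for y
    proof -
      \<comment> \<open>The coordinates of row \<open>r i\<close> of the normalised matrix with
        respect to the basis of the plane. Where the pivot entry is 0, division by zero makes the
        row 0 and the form still vanishes.\<close>
      define x where "x i u = (if u then w y i False (r i) else - w y i True (r i)) / h i (j i) y" for i u
      have "(\<lambda>i k. g i (r i, k) y) = (\<lambda>i k. \<Sum>u\<in>UNIV. x i u * w y i u k)"
        by (intro ext) (simp add: g(3)[OF y] h_def minor_def x_def UNIV_bool diff_divide_distrib)
      then show ?thesis using w(2)[OF y] by (simp add: form_combination)
    qed
    ultimately show ?thesis by (rule determinesD[OF det])
  qed
  have diag: "g i (k, k) t = 0" for i k
    by (rule determinesD[OF det g(2)]) (simp add: g(3) h_def minor_def)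
  have "g i (k, k') t + g i (k', k) t = 0" for i k k'
    by (rule determinesD[OF det function_ring_add[OF ring g(2) g(2)]])
      (simp add: g(3) h_def minor_def flip: add_divide_distrib)
  then have anti: "g i (k', k) t = - g i (k, k') t" for i k k'
    by (simp add: eq_neg_iff_add_eq_0 add.commute)
  \<comment> \<open>The two rows of the limit matrix indexed by the entries of the pair
    \<open>j i\<close>. On these two columns the diagonal is 0 and the other entries are 1 and -1,
    so their minor is 1.\<close>
  define w' where "w' i u k = g i (if u then snd (j i) else fst (j i), k) t" for i u k
  have "minor (w' i False) (w' i True) (j i) \<noteq> 0" for i
    using g(1)[of i] anti[of i "snd (j i)" "fst (j i)"]
    by (auto simp: minor_def w'_def diag case_prod_unfold)
  moreover have "form t (\<lambda>i. w' i (z i)) l = 0" for z l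
    using form0[of "\<lambda>i. if z i then snd (j i) else fst (j i)" l] unfolding w'_def .
  ultimately have "killed t" unfolding killed_def by blast
  then show False using t by simp
qed

section \<open>Charts and the dense locus\<close>

definition transform :: "(('d::finite \<Rightarrow> 'n::finite) \<times> 'm \<Rightarrow> 'a::field) \<Rightarrow> ('d \<Rightarrow> 'n \<Rightarrow> 'n \<Rightarrow> 'a) \<Rightarrow>
    ('d \<Rightarrow> 'n) \<times> 'm \<Rightarrow> 'a" where
  "transform c M = (\<lambda>(I, l). \<Sum>J\<in>UNIV. c (J, l) * (\<Prod>i\<in>UNIV. M i (J i) (I i)))"

lemma form_transform: "form (transform c M) w l = form c (\<lambda>i j. \<Sum>k\<in>UNIV. M i j k * w i k) l"
  using form_combination[of c w "\<lambda>i k j. M i j k" l]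
  by (simp add: form_def[of "transform c M"] transform_def form_def mult.commute)

lemma form_unit: "form c (\<lambda>i k. if k = I i then 1 else 0) l = c (I, l)"
proof -
  have "(\<Prod>i\<in>UNIV. if J i = I i then 1 else 0) = (if J = I then 1 else (0::'a))" for J :: "'b \<Rightarrow> 'c"
    by (auto simp: fun_eq_iff intro: prod_zero)
  then show ?thesis
    by (simp add: form_def if_distrib[of "\<lambda>x. _ * x"] cong: if_cong)
qed

text \<open>In the chart with pivots \<open>p\<close>, the plane spanned by the rows of \<open>plane p \<phi> i\<close> is the image of
  the coordinate plane under the inverse of \<open>shear p (- \<phi>) i\<close>.\<close>

definition plane :: "('d \<Rightarrow> bool \<Rightarrow> 'n) \<Rightarrow> ('d \<Rightarrow> bool \<Rightarrow> 'n \<Rightarrow> 'a::field) \<Rightarrow> 'd \<Rightarrow> bool \<Rightarrow> 'n \<Rightarrow> 'a" where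
  "plane p \<phi> i u k = (if k \<in> range (p i) then (if k = p i u then 1 else 0) else \<phi> i u k)"

text \<open>Nonzero entries sit only in non-pivot rows and pivot columns, so \<open>slope\<close>
  has square zero and the shears of \<open>\<phi>\<close> and \<open>- \<phi>\<close> are inverse to
  each other. Both are therefore polynomial in the parameters.\<close>

definition slope :: "('d \<Rightarrow> bool \<Rightarrow> 'n) \<Rightarrow> ('d \<Rightarrow> bool \<Rightarrow> 'n \<Rightarrow> 'a::field) \<Rightarrow> 'd \<Rightarrow> 'n \<Rightarrow> 'n \<Rightarrow> 'a" where
  "slope p \<phi> i j k = (if j \<in> range (p i) then 0 else \<Sum>u\<in>UNIV. if k = p i u then \<phi> i u j else 0)"

definition shear :: "('d \<Rightarrow> bool \<Rightarrow> 'n) \<Rightarrow> ('d \<Rightarrow> bool \<Rightarrow> 'n \<Rightarrow> 'a::field) \<Rightarrow> 'd \<Rightarrow> 'n \<Rightarrow> 'n \<Rightarrow> 'a" where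
  "shear p \<phi> i j k = (if j = k then 1 else 0) + slope p \<phi> i j k"

lemma slope_pivot: "inj (p i) \<Longrightarrow> slope p \<phi> i j (p i u) = (if j \<in> range (p i) then 0 else \<phi> i u j)"
  by (auto simp: slope_def inj_eq)

lemma slope_scale: "slope p (\<lambda>i u k. t * \<phi> i u k) i j k = t * slope p \<phi> i j k"
  by (auto simp: slope_def sum_distrib_left if_distrib[of "\<lambda>x. t * x"] cong: if_cong)

lemma slope_sum:
  fixes p :: "'d \<Rightarrow> bool \<Rightarrow> 'n::finite"
  shows "(\<Sum>k\<in>UNIV. slope p \<phi> i j k * w k) =
    (if j \<in> range (p i) then 0 else \<Sum>u\<in>UNIV. \<phi> i u j * w (p i u))"
proof -
  have "(\<Sum>k\<in>UNIV. (\<Sum>u\<in>UNIV. if k = p i u then \<phi> i u j else 0) * w k)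
      = (\<Sum>u\<in>UNIV. \<Sum>k\<in>UNIV. (if k = p i u then \<phi> i u j else 0) * w k)"
    unfolding sum_distrib_right by (rule sum.swap)
  also have "\<dots> = (\<Sum>u\<in>UNIV. \<phi> i u j * w (p i u))"
    by (intro sum.cong refl) (simp add: if_distrib[of "\<lambda>x. x * _"] cong: if_cong)
  finally have "(\<Sum>k\<in>UNIV. (\<Sum>u\<in>UNIV. if k = p i u then \<phi> i u j else 0) * w k)
      = (\<Sum>u\<in>UNIV. \<phi> i u j * w (p i u))" .
  then show ?thesis by (simp add: slope_def)
qed

lemma shear_sum:
  fixes p :: "'d \<Rightarrow> bool \<Rightarrow> 'n::finite"
  shows "(\<Sum>k\<in>UNIV. shear p \<phi> i j k * w k) =
    w j + (if j \<in> range (p i) then 0 else \<Sum>u\<in>UNIV. \<phi> i u j * w (p i u))"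
proof -
  have "(\<Sum>k\<in>UNIV. shear p \<phi> i j k * w k) =
      (\<Sum>k\<in>UNIV. (if j = k then w k else 0) + slope p \<phi> i j k * w k)"
    unfolding shear_def by (intro sum.cong) (auto simp: distrib_right)
  then show ?thesis by (simp add: sum.distrib slope_sum)
qed

lemma plane_pivot: "inj (p i) \<Longrightarrow> plane p \<phi> i u (p i u') = (if u' = u then 1 else 0)"
  by (auto simp: plane_def inj_eq)

lemma shear_plane:
  fixes p :: "'d \<Rightarrow> bool \<Rightarrow> 'n::finite"
  assumes "inj (p i)" "\<And>u k. \<phi>' i u k = - \<phi> i u k"
  shows "(\<Sum>k\<in>UNIV. shear p \<phi>' i j k * plane p \<phi> i u k) = (if j = p i u then 1 else 0)"
  unfolding shear_sum plane_pivot[of p, OF assms(1)] assms(2)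
  by (auto simp: plane_def if_distrib[of "\<lambda>x. _ * x"] cong: if_cong)

text \<open>An array that is zero at the vertices kills the coordinate planes, and the shear carries
  the planes with parameters \<open>- \<phi>\<close> onto these.\<close>

lemma killed_transform_shear:
  fixes c :: "('d::finite \<Rightarrow> 'n::finite) \<times> 'm \<Rightarrow> 'a::field"
  assumes p: "\<And>i. inj (p i)" and c: "\<And>z l. c (\<lambda>i. p i (z i), l) = 0"
  shows "killed (transform c (shear p \<phi>))"
proof -
  define w where "w = plane p (\<lambda>i u k. - \<phi> i u k)"
  have "minor (w i False) (w i True) (p i False, p i True) \<noteq> 0" for i
    by (simp add: minor_def w_def plane_pivot p)
  moreover have "form (transform c (shear p \<phi>)) (\<lambda>i. w i (z i)) l = 0" for z l
    unfolding form_transform w_def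
    by (subst shear_plane) (simp_all add: p c form_unit[of c "\<lambda>i. p i (z i)"])
  ultimately show ?thesis unfolding killed_def by blast
qed

section \<open>First-order computation and density of the killed arrays\<close>

lemma sum_slot:
  fixes I :: "'d::finite \<Rightarrow> 'n::finite"
  shows "(\<Sum>J\<in>UNIV. if \<forall>j. j \<noteq> i \<longrightarrow> J j = I j then F J else 0) = (\<Sum>k\<in>UNIV. F (I(i := k)))"
proof -
  have "(\<Sum>J\<in>UNIV. if \<forall>j. j \<noteq> i \<longrightarrow> J j = I j then F J else 0)
      = (\<Sum>J | \<forall>j. j \<noteq> i \<longrightarrow> J j = I j. F J)"
    by (simp add: sum.If_cases)
  also have "{J. \<forall>j. j \<noteq> i \<longrightarrow> J j = I j} = range (\<lambda>k. I(i := k))"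
  proof (intro equalityI subsetI)
    fix J assume "J \<in> {J. \<forall>j. j \<noteq> i \<longrightarrow> J j = I j}"
    then have "J = I(i := J i)" by (auto simp: fun_eq_iff)
    then show "J \<in> range (\<lambda>k. I(i := k))" by blast
  qed auto
  also have "(\<Sum>J\<in>range (\<lambda>k. I(i := k)). F J) = (\<Sum>k\<in>UNIV. F (I(i := k)))"
    by (subst sum.reindex) (auto simp: inj_on_def fun_eq_iff split: if_splits)
  finally show ?thesis .
qed

lemma coeff_prod_linear:
  fixes a b :: "'i \<Rightarrow> 'a::comm_ring_1"
  assumes "finite A"
  shows "coeff (\<Prod>i\<in>A. [:a i, b i:]) 0 = (\<Prod>i\<in>A. a i)"
    and "coeff (\<Prod>i\<in>A. [:a i, b i:]) 1 = (\<Sum>i\<in>A. b i * (\<Prod>j\<in>A - {i}. a j))"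
proof -
  show *: "coeff (\<Prod>i\<in>A. [:a i, b i:]) 0 = (\<Prod>i\<in>A. a i)" for A
    by (induction A rule: infinite_finite_induct) (simp_all add: coeff_mult_0)
  show "coeff (\<Prod>i\<in>A. [:a i, b i:]) 1 = (\<Sum>i\<in>A. b i * (\<Prod>j\<in>A - {i}. a j))"
    using assms
  proof (induction A)
    case (insert x A)
    have "(\<Sum>i\<in>A. b i * (\<Prod>j\<in>insert x A - {i}. a j)) = (\<Sum>i\<in>A. a x * (b i * (\<Prod>j\<in>A - {i}. a j)))"
    proof (intro sum.cong refl)
      fix i assume "i \<in> A"
      then have "insert x A - {i} = insert x (A - {i})" using insert.hyps by auto
      then show "b i * (\<Prod>j\<in>insert x A - {i}. a j) = a x * (b i * (\<Prod>j\<in>A - {i}. a j))"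
        using insert.hyps by (simp add: mult_ac)
    qed
    then show ?case
      using insert by (simp add: coeff_mult * sum_distrib_left numeral_eq_Suc add.commute)
  qed simp
qed

text \<open>Surjectivity of the differential of \<open>(\<phi>, c) \<mapsto> transform c (shear p \<phi>)\<close> at a suitable point.\<close>

lemma surjective_differential:
  fixes Q :: "'n::finite set"
  assumes inf: "infinite (UNIV :: 'a::field set)" and m: "CARD('m::finite) \<ge> 2"
    and ineq: "CARD('m) * 2 ^ (CARD('d::finite) - 1) \<le> CARD('d) * card Q"
  shows "\<exists>f :: 'd \<Rightarrow> 'n \<Rightarrow> ('d \<Rightarrow> bool) \<Rightarrow> 'm \<Rightarrow> 'a. \<forall>R. \<exists>\<phi>. \<forall>z l.
    (\<Sum>i\<in>UNIV. \<Sum>k\<in>Q. f i k (z(i := False)) l * \<phi> i (z i) k) = R z l"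
proof -
  obtain t :: "'d \<Rightarrow> (('d \<Rightarrow> bool) \<Rightarrow> 'm \<Rightarrow> 'a) set" where t: "admissible UNIV (\<lambda>_. card Q) t"
    using admissible_exists[OF inf m, of "UNIV :: 'd set" "\<lambda>_. card Q"] ineq by auto
  have "\<exists>f. t i \<subseteq> f ` Q" for i
    using t finite_subset_image_of_card_le[of "t i" Q] by (auto simp: admissible_def)
  then obtain f where f: "\<And>i. t i \<subseteq> f i ` Q" by metis
  define v :: "'d \<times> 'n \<times> bool \<Rightarrow> 'a ^ (('d \<Rightarrow> bool) \<times> 'm)" where
    "v = (\<lambda>(i, k, a). vec_lambda (\<lambda>(z, l). if z i = a then f i k (z(i := False)) l else 0))"
  define X where "X = (UNIV :: 'd set) \<times> Q \<times> (UNIV :: bool set)"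
  have "vec.span (v ` X) = UNIV"
  proof (rule span_UNIV_if_no_annihilator)
    fix \<psi> assume \<psi>: "\<And>x. x \<in> v ` X \<Longrightarrow> (\<Sum>j\<in>UNIV. x $ j * \<psi> j) = 0"
    have "contract UNIV i \<tau> a (\<lambda>z l. \<psi> (z, l)) = 0" if \<tau>: "\<tau> \<in> t i" for i \<tau> a
    proof -
      obtain k where k: "k \<in> Q" "\<tau> = f i k" using f \<tau> by blast
      have "(\<Sum>j\<in>UNIV. v (i, k, a) $ j * \<psi> j) = (\<Sum>z\<in>UNIV. \<Sum>l\<in>UNIV. v (i, k, a) $ (z, l) * \<psi> (z, l))"
        by (simp add: sum.cartesian_product)
      also have "\<dots> = contract UNIV i \<tau> a (\<lambda>z l. \<psi> (z, l))"
        unfolding contract_def by (intro sum.cong) (auto simp: cube_def v_def k)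
      finally show ?thesis using \<psi>[of "v (i, k, a)"] k by (simp add: X_def)
    qed
    then have "\<forall>z\<in>cube UNIV. \<forall>l. \<psi> (z, l) = 0"
      using t unfolding admissible_def separating_def by blast
    then show "\<psi> = (\<lambda>_. 0)" by (auto simp: cube_def fun_eq_iff)
  qed
  have "\<exists>\<phi>. \<forall>z l. (\<Sum>i\<in>UNIV. \<Sum>k\<in>Q. f i k (z(i := False)) l * \<phi> i (z i) k) = R z l" for R
  proof -
    obtain F r where F: "finite F" "F \<subseteq> X" "vec_lambda (\<lambda>(z, l). R z l) = (\<Sum>e\<in>F. r e *s v e)"
      using span_image_explicit[of "vec_lambda (\<lambda>(z, l). R z l)" v X] \<open>vec.span (v ` X) = UNIV\<close> by auto
    define \<phi> where "\<phi> i a k = (if (i, k, a) \<in> F then r (i, k, a) else 0)" for i a k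
    have "(\<Sum>i\<in>UNIV. \<Sum>k\<in>Q. f i k (z(i := False)) l * \<phi> i (z i) k) = R z l" for z l
    proof -
      have "R z l = (\<Sum>e\<in>F. r e * v e $ (z, l))" using arg_cong[OF F(3), of "\<lambda>x. x $ (z, l)"] by simp
      also have "\<dots> = (\<Sum>e\<in>X. (if e \<in> F then r e else 0) * v e $ (z, l))"
        using F(2) by (intro sum.mono_neutral_cong_left) (auto simp: X_def)
      also have "\<dots> = (\<Sum>i\<in>UNIV. \<Sum>k\<in>Q. \<Sum>a\<in>UNIV. \<phi> i a k * v (i, k, a) $ (z, l))"
        by (auto simp: X_def sum.cartesian_product \<phi>_def case_prod_unfold intro!: sum.cong)
      also have "\<dots> = (\<Sum>i\<in>UNIV. \<Sum>k\<in>Q. f i k (z(i := False)) l * \<phi> i (z i) k)"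
        by (intro sum.cong refl)
          (simp add: v_def if_distrib[of "\<lambda>x. _ * x"] mult.commute cong: if_cong)
      finally show ?thesis by simp
    qed
    then show ?thesis by blast
  qed
  then show ?thesis by blast
qed

text \<open>Through \<open>c0\<close> there is a polynomial curve of killed arrays with any
  prescribed velocity \<open>S\<close>, so \<open>polyfun_eq_0_if_curves\<close> applies. Velocities
  off the vertices come from moving the array, those at the vertices only from moving the
  planes.\<close>

lemma killed_dense:
  fixes P :: "(('d::finite \<Rightarrow> 'n::finite) \<times> 'm::finite \<Rightarrow> 'a::field) \<Rightarrow> 'a"
  assumes inf: "infinite (UNIV :: 'a set)" and m: "CARD('m) \<ge> 2" and n: "CARD('n) \<ge> 2"
    and ineq: "CARD('m) * 2 ^ (CARD('d) - 1) \<le> CARD('d) * (CARD('n) - 2)"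
    and P: "polyfun UNIV N P" and zero: "\<And>c. killed c \<Longrightarrow> P c = 0"
  shows "P x = 0"
proof -
  obtain p0 p1 :: 'n where p01: "p0 \<noteq> p1"
    using n card_le_Suc0_iff_eq[of "UNIV :: 'n set"] by fastforce
  define p where "p = (\<lambda>i :: 'd. \<lambda>u. if u then p1 else p0)"
  have inj_p: "inj (p i)" for i using p01 by (auto simp: p_def inj_on_def)
  define Q where "Q = UNIV - {p0, p1}"
  have range_p: "j \<in> range (p i) \<longleftrightarrow> j \<notin> Q" for i j
    by (auto simp: p_def Q_def intro: range_eqI[of _ _ True] range_eqI[of _ _ False])
  have "card Q = CARD('n) - 2" using p01 by (simp add: Q_def card_Diff_subset)
  then obtain f :: "'d \<Rightarrow> 'n \<Rightarrow> ('d \<Rightarrow> bool) \<Rightarrow> 'm \<Rightarrow> 'a" where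
    f: "\<And>R. \<exists>\<phi>. \<forall>z l. (\<Sum>i\<in>UNIV. \<Sum>k\<in>Q. f i k (z(i := False)) l * \<phi> i (z i) k) = R z l"
    using surjective_differential[OF inf m, where 'd = 'd, of Q] ineq by auto
  define vertex where "vertex z = (\<lambda>i. p i (z i))" for z
  \<comment> \<open>To first order, a shear changes the coefficient at a vertex by those at its
    neighbours, the tuples with one entry replaced by a non-pivot. The tensors \<open>f\<close> are
    placed exactly there; the remaining entries, decoded by \<open>I j = p1\<close> with False at
    \<open>i\<close>, give the argument \<open>z(i := False)\<close>.\<close>
  define c0 where "c0 = (\<lambda>(I, l). \<Sum>i\<in>UNIV. if I i \<in> Q \<and> (\<forall>j. j \<noteq> i \<longrightarrow> I j \<notin> Q)
    then f i (I i) (\<lambda>j. j \<noteq> i \<and> I j = p1) l else 0)"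
  have vertex_Q: "vertex z i \<notin> Q" for z i using range_p[of "vertex z i" i] by (simp add: vertex_def)
  have c0_vertex: "c0 (vertex z, l) = 0" for z l by (simp add: c0_def vertex_Q)
  have c0_neighbour: "c0 ((vertex z)(i := k), l) = f i k (z(i := False)) l" if k: "k \<in> Q" for z i k l
  proof -
    have "c0 ((vertex z)(i := k), l) = (\<Sum>i'\<in>UNIV. if i' = i then f i k (z(i := False)) l else 0)"
      unfolding c0_def prod.case
    proof (intro sum.cong refl)
      fix i'
      have "(\<lambda>j. j \<noteq> i \<and> ((vertex z)(i := k)) j = p1) = z(i := False)"
        using p01 by (auto simp: vertex_def p_def fun_eq_iff)
      moreover have "((vertex z)(i := k)) i' \<in> Q \<and> (\<forall>j. j \<noteq> i' \<longrightarrow> ((vertex z)(i := k)) j \<notin> Q) \<longleftrightarrow> i' = i"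
        using k vertex_Q by auto
      ultimately show "(if ((vertex z)(i := k)) i' \<in> Q \<and> (\<forall>j. j \<noteq> i' \<longrightarrow> ((vertex z)(i := k)) j \<notin> Q)
        then f i' (((vertex z)(i := k)) i') (\<lambda>j. j \<noteq> i' \<and> ((vertex z)(i := k)) j = p1) l else 0) =
        (if i' = i then f i k (z(i := False)) l else 0)" by simp
    qed
    then show ?thesis by simp
  qed
  show ?thesis
  proof (rule polyfun_eq_0_if_curves[OF inf P, where c = c0])
    fix S
    obtain \<phi> where \<phi>: "\<And>z l. (\<Sum>i\<in>UNIV. \<Sum>k\<in>Q. f i k (z(i := False)) l * \<phi> i (z i) k) = S (vertex z, l)"
      using f[of "\<lambda>z l. S (vertex z, l)"] by blast
    define \<delta> :: "'n \<Rightarrow> 'n \<Rightarrow> 'a" where "\<delta> j k = (if j = k then 1 else 0)" for j k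
    define E where "E J I = (\<Sum>i\<in>UNIV. slope p \<phi> i (J i) (I i) * (\<Prod>j\<in>UNIV - {i}. \<delta> (J j) (I j)))" for I J
    have prod_\<delta>: "(\<Prod>j\<in>A. \<delta> (J j) (I j)) = (if \<forall>j\<in>A. J j = I j then 1 else 0)"
      for A and I J :: "'d \<Rightarrow> 'n"
      by (auto simp: \<delta>_def intro: prod_zero)
    \<comment> \<open>\<open>E J I\<close> is the derivative at t = 0 of the product of shear
      entries, so \<open>S0\<close> is the part of \<open>S\<close> not produced by moving the
      planes. By the choice of \<open>\<phi>\<close> it is zero at the vertices, hence
      \<open>c0 + t * S0\<close> still kills the coordinate planes.\<close>
    define S0 where "S0 = (\<lambda>(I, l). S (I, l) - (\<Sum>J\<in>UNIV. c0 (J, l) * E J I))"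
    have S0_vertex: "S0 (vertex z, l) = 0" for z l
    proof -
      have "(\<Sum>J\<in>UNIV. c0 (J, l) * E J (vertex z)) = (\<Sum>i\<in>UNIV. \<Sum>J\<in>UNIV.
          if \<forall>j. j \<noteq> i \<longrightarrow> J j = vertex z j then c0 (J, l) * slope p \<phi> i (J i) (p i (z i)) else 0)"
        unfolding E_def sum_distrib_left
        by (subst sum.swap) (auto simp: prod_\<delta> vertex_def intro!: sum.cong)
      also have "\<dots> = (\<Sum>i\<in>UNIV. \<Sum>k\<in>UNIV. c0 ((vertex z)(i := k), l) * slope p \<phi> i k (p i (z i)))"
        by (simp add: sum_slot)
      also have "\<dots> = (\<Sum>i\<in>UNIV. \<Sum>k\<in>Q. f i k (z(i := False)) l * \<phi> i (z i) k)"
        by (intro sum.cong refl sum.mono_neutral_cong_right)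
          (auto simp: slope_pivot inj_p range_p c0_neighbour)
      finally show ?thesis by (simp add: S0_def \<phi>)
    qed
    \<comment> \<open>The transform of \<open>c0 + t * S0\<close> by the shear with parameters
      \<open>t * \<phi>\<close>, written out as polynomials in t.\<close>
    define q where "q = (\<lambda>(I, l). \<Sum>J\<in>UNIV. [:c0 (J, l), S0 (J, l):] *
      (\<Prod>i\<in>UNIV. [:\<delta> (J i) (I i), slope p \<phi> i (J i) (I i):]))"
    have "coeff (q (I, l)) 0 = c0 (I, l)" for I l
    proof -
      have "coeff (q (I, l)) 0 = (\<Sum>J\<in>UNIV. c0 (J, l) * (\<Prod>i\<in>UNIV. \<delta> (J i) (I i)))"
        by (simp add: q_def coeff_sum coeff_mult_0 coeff_prod_linear)
      also have "\<dots> = (\<Sum>J\<in>UNIV. if J = I then c0 (J, l) else 0)"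
        by (intro sum.cong refl) (auto simp: prod_\<delta> fun_eq_iff)
      finally show ?thesis by simp
    qed
    moreover have "coeff (q (I, l)) 1 = S (I, l)" for I l
    proof -
      have "coeff (q (I, l)) 1 = (\<Sum>J\<in>UNIV. c0 (J, l) * E J I + S0 (J, l) * (\<Prod>i\<in>UNIV. \<delta> (J i) (I i)))"
        unfolding q_def prod.case coeff_sum
      proof (intro sum.cong refl)
        fix J
        let ?m = "\<Prod>i\<in>UNIV. [:\<delta> (J i) (I i), slope p \<phi> i (J i) (I i):]"
        have "coeff ([:c0 (J, l), S0 (J, l):] * ?m) 1 = c0 (J, l) * coeff ?m 1 + S0 (J, l) * coeff ?m 0"
          by (simp add: coeff_mult)
        then show "coeff ([:c0 (J, l), S0 (J, l):] * ?m) 1 =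
            c0 (J, l) * E J I + S0 (J, l) * (\<Prod>i\<in>UNIV. \<delta> (J i) (I i))"
          by (simp only: coeff_prod_linear finite E_def)
      qed
      also have "\<dots> = (\<Sum>J\<in>UNIV. c0 (J, l) * E J I) + (\<Sum>J\<in>UNIV. if J = I then S0 (J, l) else 0)"
        unfolding sum.distrib by (intro arg_cong2[where f = "(+)"] sum.cong refl) (auto simp: prod_\<delta> fun_eq_iff)
      finally show ?thesis by (simp add: S0_def)
    qed
    moreover have "P (\<lambda>j. poly (q j) t) = 0" for t
    proof (rule zero)
      have "(\<lambda>j. poly (q j) t) = transform (\<lambda>j. c0 j + t * S0 j) (shear p (\<lambda>i u k. t * \<phi> i u k))"
        by (intro ext) (auto simp: q_def transform_def poly_sum poly_prod shear_def slope_scale \<delta>_def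
            distrib_right mult.assoc intro!: sum.cong prod.cong)
      moreover have "killed (transform (\<lambda>j. c0 j + t * S0 j) (shear p (\<lambda>i u k. t * \<phi> i u k)))"
        using c0_vertex S0_vertex by (intro killed_transform_shear inj_p) (simp add: vertex_def)
      ultimately show "killed (\<lambda>j. poly (q j) t)" by simp
    qed
    ultimately show "\<exists>q. (\<forall>j. coeff (q j) 0 = c0 j \<and> coeff (q j) 1 = S j) \<and> (\<forall>t. P (\<lambda>j. poly (q j) t) = 0)"
      by (intro exI[of _ q]) auto
  qed
qed

section \<open>Covering by charts and the parameter count\<close>

lemma killed_chart:
  fixes c :: "('d::finite \<Rightarrow> 'n::finite) \<times> 'm \<Rightarrow> 'a::field"
  assumes "killed c"
  shows "\<exists>p \<phi> c0. (\<forall>i. inj (p i)) \<and> (\<forall>z l. c0 (\<lambda>i. p i (z i), l) = 0) \<and>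
    c = transform c0 (shear p \<phi>)"
proof -
  obtain w :: "'d \<Rightarrow> bool \<Rightarrow> 'n \<Rightarrow> 'a" where "\<And>i. \<exists>r. minor (w i False) (w i True) r \<noteq> 0"
    and w: "\<And>z l. form c (\<lambda>i. w i (z i)) l = 0"
    using assms unfolding killed_def by blast
  then obtain r where r: "\<And>i. minor (w i False) (w i True) (r i) \<noteq> 0" by metis
  define p where "p i u = (if u then snd (r i) else fst (r i))" for i u
  define D where "D i = minor (w i False) (w i True) (r i)" for i
  have D: "D i = w i False (p i False) * w i True (p i True) - w i False (p i True) * w i True (p i False)"
    for i by (simp add: D_def minor_def p_def case_prod_unfold)
  have D0: "D i \<noteq> 0" for i using r by (simp add: D_def)
  have inj_p: "inj (p i)" for i
  proof -
    have "p i False \<noteq> p i True" using D0[of i] unfolding D by (auto simp: mult.commute)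
    then show ?thesis by (auto simp: inj_on_def) (metis (full_types))+
  qed
  \<comment> \<open>The adjugate of the 2 by 2 block of \<open>w i\<close> at its pivots. Divided by
    the determinant \<open>D i\<close>, it gives the basis \<open>v i\<close> of the same plane
    whose pivot block is the identity.\<close>
  define y where "y i u u' = (if u then (if u' then w i False (p i False) else - w i True (p i False))
    else (if u' then - w i False (p i True) else w i True (p i True)))" for i u u'
  define v where "v i u k = (\<Sum>u'\<in>UNIV. y i u u' / D i * w i u' k)" for i u k
  have v_pivot: "v i u (p i u') = (if u' = u then 1 else 0)" for i u u'
  proof -
    have "D i * v i u (p i u') = (\<Sum>u''\<in>UNIV. y i u u'' * w i u'' (p i u'))"
      using D0[of i] by (simp add: v_def sum_distrib_left)
    also have "\<dots> = (if u' = u then D i else 0)"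
      by (cases u; cases u') (simp_all add: y_def UNIV_bool D algebra_simps)
    finally show ?thesis using D0[of i] by (auto split: if_splits)
  qed
  have form_v: "form c (\<lambda>i. v i (z i)) l = 0" for z l
    unfolding v_def[abs_def] by (subst form_combination) (simp add: w)
  have plane_v: "plane p v = v"
    by (intro ext) (auto simp: plane_def v_pivot inj_eq[OF inj_p])
  define c0 where "c0 = transform c (shear p v)"
  have "c0 (\<lambda>i. p i (z i), l) = 0" for z l
  proof -
    have "c0 (\<lambda>i. p i (z i), l) = form c0 (\<lambda>i k. if k = p i (z i) then 1 else 0) l"
      by (rule form_unit[symmetric])
    also have "\<dots> = form c (\<lambda>i. v i (z i)) l"
    proof -
      have "(\<Sum>k\<in>UNIV. shear p v i j k * (if k = p i (z i) then 1 else 0)) = v i (z i) j" for i j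
      proof -
        have "shear p v i j (p i (z i)) = v i (z i) j"
          by (auto simp: shear_def slope_pivot[of p, OF inj_p] v_pivot inj_eq[OF inj_p])
        then show ?thesis by (simp add: if_distrib[of "\<lambda>x. _ * x"] cong: if_cong)
      qed
      then show ?thesis unfolding c0_def form_transform by simp
    qed
    finally show ?thesis by (simp add: form_v)
  qed
  moreover have "c = transform c0 (shear p (\<lambda>i u k. - v i u k))"
  proof (rule ext)
    fix e :: "('d \<Rightarrow> 'n) \<times> 'm"
    obtain I l where e: "e = (I, l)" by force
    let ?e = "\<lambda>i k. if k = I i then 1 else (0::'a)"
    have "(\<Sum>j'\<in>UNIV. shear p v i j j' * (\<Sum>k\<in>UNIV. shear p (\<lambda>i u k. - v i u k) i j' k * ?e i k)) = ?e i j"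
      for i j
      by (auto simp: shear_sum sum_negf)
    then have "form (transform c0 (shear p (\<lambda>i u k. - v i u k))) ?e l = form c ?e l"
      unfolding c0_def form_transform by simp
    then show "c e = transform c0 (shear p (\<lambda>i u k. - v i u k)) e" by (simp add: form_unit e)
  qed
  ultimately show ?thesis using inj_p by blast
qed

text \<open>Every choice of pivots has its own polynomial; there are finitely many, and a point
  where none of them vanishes lies in no chart. The subtraction is in the integers, so n = 1 is
  covered: then \<open>Ps\<close> is empty and no array is killed.\<close>

lemma exists_not_killed:
  assumes inf: "infinite (UNIV :: 'a::field set)"
    and ineq: "int CARD('d::finite) * (int CARD('n::finite) - 2) < int CARD('m::finite) * 2 ^ (CARD('d) - 1)"
  shows "\<exists>c :: ('d \<Rightarrow> 'n) \<times> 'm \<Rightarrow> 'a. \<not> killed c"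
proof -
  let ?V = "\<lambda>p :: 'd \<Rightarrow> bool \<Rightarrow> 'n. range (\<lambda>z i. p i (z i))"
  define \<Psi> :: "('d \<Rightarrow> bool \<Rightarrow> 'n) \<Rightarrow> (('d \<times> bool \<times> 'n) + (('d \<Rightarrow> 'n) \<times> 'm) \<Rightarrow> 'a) \<Rightarrow> ('d \<Rightarrow> 'n) \<times> 'm \<Rightarrow> 'a" where
    "\<Psi> p x = transform (\<lambda>(I, l). if I \<in> ?V p then 0 else x (Inr (I, l))) (shear p (\<lambda>i u k. x (Inl (i, u, k))))"
    for p x
  define Ps where "Ps = {p :: 'd \<Rightarrow> bool \<Rightarrow> 'n. \<forall>i. inj (p i)}"
  have "\<exists>n P. polyfun UNIV n P \<and> (\<exists>z. P z \<noteq> 0) \<and> (\<forall>x. P (\<Psi> p x) = 0)" if p: "p \<in> Ps" for p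
  proof -
    have inj_p: "inj (p i)" for i using p by (simp add: Ps_def)
    \<comment> \<open>\<open>K1\<close> and \<open>K2\<close> index the variables that
      \<open>\<Psi> p\<close> really reads: parameters of the planes at non-pivot coordinates, and
      coefficients away from the vertices.\<close>
    define K1 where "K1 = (SIGMA i:(UNIV :: 'd set). (UNIV :: bool set) \<times> (UNIV - range (p i)))"
    define K2 where "K2 = (UNIV - ?V p) \<times> (UNIV :: 'm set)"
    define K where "K = Inl ` K1 \<union> Inr ` K2"
    have card_p: "card (range (p i)) = 2" for i using card_image[OF inj_p[of i]] by simp
    have "card (?V p) = card (UNIV :: ('d \<Rightarrow> bool) set)"
    proof (rule card_image, rule injI)
      fix z z' :: "'d \<Rightarrow> bool" assume "(\<lambda>i. p i (z i)) = (\<lambda>i. p i (z' i))"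
      then have "p i (z i) = p i (z' i)" for i by (rule fun_cong)
      then show "z = z'" using inj_p by (auto simp: inj_eq)
    qed
    then have cV: "card (?V p) = 2 ^ CARD('d)" by (simp add: card_fun)
    have n2: "CARD('n) \<ge> 2" using card_p card_mono[of UNIV "range (p i)" for i] by (metis finite subset_UNIV)
    have cV_le: "2 ^ CARD('d) \<le> CARD('d \<Rightarrow> 'n)" using card_mono[of UNIV "?V p"] cV by simp
    have "card K = CARD('d) * (2 * (CARD('n) - 2)) + (CARD('d \<Rightarrow> 'n) - 2 ^ CARD('d)) * CARD('m)"
    proof -
      have "card K = card K1 + card K2"
        unfolding K_def by (subst card_Un_disjoint) (auto simp: card_image)
      moreover have "card K1 = CARD('d) * (2 * (CARD('n) - 2))"
        unfolding K1_def by (simp add: card_cartesian_product card_Diff_subset card_p)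
      moreover have "card K2 = (CARD('d \<Rightarrow> 'n) - 2 ^ CARD('d)) * CARD('m)"
        unfolding K2_def by (simp add: card_cartesian_product card_Diff_subset cV)
      ultimately show ?thesis by simp
    qed
    also have "\<dots> < CARD('d \<Rightarrow> 'n) * CARD('m)"
    proof -
      have "int (CARD('d) * (CARD('n) - 2)) < int (CARD('m) * 2 ^ (CARD('d) - 1))"
        using ineq n2 by (simp add: of_nat_diff)
      then have "CARD('d) * (CARD('n) - 2) < CARD('m) * 2 ^ (CARD('d) - 1)" by linarith
      then have "2 * (CARD('d) * (CARD('n) - 2)) < CARD('m) * (2 * 2 ^ (CARD('d) - 1))" by simp
      also have "(2::nat) * 2 ^ (CARD('d) - 1) = 2 ^ CARD('d)"
        by (simp flip: power_Suc)
      finally have "CARD('d) * (2 * (CARD('n) - 2)) < 2 ^ CARD('d) * CARD('m)" by (simp add: mult_ac)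
      moreover have "2 ^ CARD('d) * CARD('m) \<le> CARD('d \<Rightarrow> 'n) * CARD('m)" using cV_le by (rule mult_right_mono) simp
      ultimately show ?thesis unfolding diff_mult_distrib by linarith
    qed
    also have "\<dots> = card (UNIV :: (('d \<Rightarrow> 'n) \<times> 'm) set)" by (simp add: card_cartesian_product flip: UNIV_Times_UNIV)
    finally have card: "card K < card (UNIV :: (('d \<Rightarrow> 'n) \<times> 'm) set)" .
    have "polyfun K (1 + CARD('d)) (\<lambda>x. \<Psi> p x j)" for j
    proof -
      obtain I l where j: "j = (I, l)" by force
      have slope: "polyfun K 1 (\<lambda>x. slope p (\<lambda>i u k. x (Inl (i, u, k))) i j' k)" for i j' k
      proof (cases "j' \<in> range (p i)")
        case True
        then show ?thesis by (simp add: slope_def polyfun.const)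
      next
        case False
        then have "polyfun K 1 (\<lambda>x. x (Inl (i, u, j')))" for u
          using polyfun.var[of "Inl (i, u, j')" K 0] by (simp add: K_def K1_def image_iff)
        then have "polyfun K 1 (\<lambda>x. if k = p i u then x (Inl (i, u, j')) else 0)" for u
          by (cases "k = p i u") (auto intro: polyfun.const)
        then show ?thesis unfolding slope_def using False by (simp only: if_False) (rule polyfun_sum)
      qed
      have shear: "polyfun K 1 (\<lambda>x. shear p (\<lambda>i u k. x (Inl (i, u, k))) i j' k)" for i j' k
        unfolding shear_def by (intro polyfun.add polyfun.const slope)
      have c: "polyfun K 1 (\<lambda>x. if J \<in> ?V p then 0 else x (Inr (J, l)))" for J
      proof (cases "J \<in> ?V p")
        case False
        then show ?thesis
          using polyfun.var[of "Inr (J, l)" K 0] by (simp add: K_def K2_def image_iff)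
      qed (simp add: polyfun.const)
      show ?thesis
        unfolding \<Psi>_def transform_def j prod.case
        by (intro polyfun_sum polyfun.mult c polyfun_prod[where d = "\<lambda>_. 1"] shear) simp
    qed
    then show ?thesis
      using algebraic_dependence[OF inf _ _ card, of "1 + CARD('d)" "\<lambda>j x. \<Psi> p x j"]
      by (simp add: K_def K1_def K2_def)
  qed
  then have "\<forall>p\<in>Ps. \<exists>n P. polyfun UNIV n P \<and> (\<exists>z. P z \<noteq> 0) \<and> (\<forall>x. P (\<Psi> p x) = 0)" by blast
  then obtain n P where P: "\<And>p. p \<in> Ps \<Longrightarrow> polyfun UNIV (n p) (P p)" "\<And>p. p \<in> Ps \<Longrightarrow> \<exists>z. P p z \<noteq> 0"
    "\<And>p x. p \<in> Ps \<Longrightarrow> P p (\<Psi> p x) = 0"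
    unfolding bchoice_iff by blast
  obtain c where c: "\<And>p. p \<in> Ps \<Longrightarrow> P p c \<noteq> 0"
    using polyfun_common_nonzero[OF inf, of Ps UNIV n P] P(1,2) by auto
  have "\<not> killed c"
  proof
    assume "killed c"
    then obtain p \<phi> c0 where p: "\<And>i. inj (p i)" "\<And>z l. c0 (\<lambda>i. p i (z i), l) = 0"
      "c = transform c0 (shear p \<phi>)" using killed_chart[of c] by blast
    define x where "x = case_sum (\<lambda>(i, u, k). \<phi> i u k) c0"
    have "(\<lambda>(I, l). if I \<in> ?V p then 0 else x (Inr (I, l))) = c0"
      using p(2) by (auto simp: x_def fun_eq_iff)
    moreover have "(\<lambda>i u k. x (Inl (i, u, k))) = \<phi>" by (simp add: x_def)
    ultimately have "\<Psi> p x = c" by (simp only: \<Psi>_def p(3))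
    then show False using c[of p] P(3)[of p x] p(1) by (simp add: Ps_def)
  qed
  then show ?thesis by blast
qed

theorem theorem1p5:
  assumes "CARD('m::finite) \<ge> 2"
  shows "alpha TYPE('a::alg_closed_field) TYPE('n::finite) TYPE('d::finite) TYPE('m) \<ge> 2 \<longleftrightarrow>
    int CARD('d) * (int CARD('n) - 2) \<ge> int CARD('m) * 2 ^ (CARD('d) - 1)"
proof
  assume "alpha TYPE('a) TYPE('n) TYPE('d) TYPE('m) \<ge> 2"
  then have "\<not> (\<exists>c :: ('d \<Rightarrow> 'n) \<times> 'm \<Rightarrow> 'a. \<not> killed c)" by (simp add: alpha_ge_2_iff)
  then show "int CARD('d) * (int CARD('n) - 2) \<ge> int CARD('m) * 2 ^ (CARD('d) - 1)"
    using exists_not_killed[OF infinite_UNIV_alg_closed, where 'd = 'd and 'n = 'n and 'm = 'm]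
    by (meson not_le)
next
  assume ineq: "int CARD('d) * (int CARD('n) - 2) \<ge> int CARD('m) * 2 ^ (CARD('d) - 1)"
  \<comment> \<open>Positivity forces n > 2, so the integer difference n - 2 agrees with the
    truncated one.\<close>
  have "int CARD('m) * 2 ^ (CARD('d) - 1) > 0" by simp
  then have "int CARD('d) * (int CARD('n) - 2) > 0" using ineq by linarith
  then have n: "CARD('n) \<ge> 2" by (simp add: zero_less_mult_iff)
  then have "int (CARD('m) * 2 ^ (CARD('d) - 1)) \<le> int (CARD('d) * (CARD('n) - 2))"
    using ineq by (simp add: of_nat_diff)
  then have "CARD('m) * 2 ^ (CARD('d) - 1) \<le> CARD('d) * (CARD('n) - 2)" by linarith
  then have "killed c" for c :: "('d \<Rightarrow> 'n) \<times> 'm \<Rightarrow> 'a"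
    using killed_closed[of c] killed_dense[OF infinite_UNIV_alg_closed assms n] by blast
  then show "alpha TYPE('a) TYPE('n) TYPE('d) TYPE('m) \<ge> 2" by (simp add: alpha_ge_2_iff)
qed

end
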